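(* Let $\mathcal{I}$ be any one of $\mathcal{P}$, $\mathcal{P}_\infty$, $\mathcal{B}$. The isometry class $\{\mu\in\mathcal{I}: X_\mu$ has the SD2P$\}$ is $G_\delta$-complete in $\mathcal{I}$.
   Context: Coding: $V$ is the set of finitely supported rational sequences; $\mathcal{P}\subset\mathbb{R}^V$ the seminorms on $V$ with pointwise convergence topology; for $\mu\in\mathcal{P}$, $\bar\mu$ is its seminorm extension to $c_{00}$ and $X_\mu$ the completion of $c_{00}/\{\bar\mu=0\}$; $\mathcal{P}_\infty=\{\mu:\dim X_\mu=\infty\}$, $\mathcal{B}=\{\mu\in\mathcal{P}_\infty:\bar\mu$ a norm on $c_{00}\}$, subspace topologies. SD2P: every convex combination of slices $\{x\in B_X:f(x)>1-\alpha\}$ ($f\in S_{X^*}$, $\alpha>0$) of $B_X$ has diameter 2. A set $A$ in a Polish space $Z$ is $G_\delta$-complete if it is $G_\delta$ and every $G_\delta$ subset of every zero-dimensional Polish space is a continuous preimage of $A$. *)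

theory Defs
  imports "HOL-Analysis.Analysis"
begin

typedef qseq = "{x :: nat \<Rightarrow> rat. finite {n. x n \<noteq> 0}}"
  morphisms qs_rep qs_abs
  by (rule exI[of _ "\<lambda>_. 0"]) simp

definition qs_add :: "qseq \<Rightarrow> qseq \<Rightarrow> qseq" where
  "qs_add x y = qs_abs (\<lambda>n. qs_rep x n + qs_rep y n)"

definition qs_scale :: "rat \<Rightarrow> qseq \<Rightarrow> qseq" where
  "qs_scale q x = qs_abs (\<lambda>n. q * qs_rep x n)"

text \<open>Seminorms on the rational vector space V; the set P lives in the product space
  (qseq \<Rightarrow> real), whose standard topology is the product (pointwise) topology.\<close>

definition seminorm_V :: "(qseq \<Rightarrow> real) \<Rightarrow> bool" where
  "seminorm_V \<mu> \<longleftrightarrow>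
     (\<forall>x y. \<mu> (qs_add x y) \<le> \<mu> x + \<mu> y) \<and>
     (\<forall>q x. \<mu> (qs_scale q x) = \<bar>real_of_rat q\<bar> * \<mu> x)"

definition P_set :: "(qseq \<Rightarrow> real) set" where
  "P_set = {\<mu>. seminorm_V \<mu>}"

definition c00 :: "(nat \<Rightarrow> real) set" where
  "c00 = {x. finite {n. x n \<noteq> 0}}"

definition qs_real :: "qseq \<Rightarrow> nat \<Rightarrow> real" where
  "qs_real v = (\<lambda>n. real_of_rat (qs_rep v n))"

definition seminorm_c00 :: "((nat \<Rightarrow> real) \<Rightarrow> real) \<Rightarrow> bool" where
  "seminorm_c00 \<nu> \<longleftrightarrow>
     (\<forall>x\<in>c00. \<forall>y\<in>c00. \<nu> (\<lambda>n. x n + y n) \<le> \<nu> x + \<nu> y) \<and>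
     (\<forall>c. \<forall>x\<in>c00. \<nu> (\<lambda>n. c * x n) = \<bar>c\<bar> * \<nu> x)"

text \<open>The (unique) real seminorm on c00 extending \<mu>; normalised to 0 outside c00.\<close>
definition mu_bar :: "(qseq \<Rightarrow> real) \<Rightarrow> (nat \<Rightarrow> real) \<Rightarrow> real" where
  "mu_bar \<mu> = (THE \<nu>. seminorm_c00 \<nu> \<and> (\<forall>v. \<nu> (qs_real v) = \<mu> v) \<and> (\<forall>x. x \<notin> c00 \<longrightarrow> \<nu> x = 0))"

text \<open>X_mu is the completion of c00 / {mu_bar = 0}.  It is represented concretely as the
  space of mu_bar-Cauchy sequences in c00 with the seminorm N(s) = lim mu_bar(s k);
  X_mu is the Hausdorff quotient of this seminormed space.  All notions below
  (unit ball, norm-one bounded functionals, slices, diameters, linear independence)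
  are formulated via the seminorm and hence are exactly those of the quotient X_mu.\<close>

definition Xcarrier :: "(qseq \<Rightarrow> real) \<Rightarrow> (nat \<Rightarrow> nat \<Rightarrow> real) set" where
  "Xcarrier \<mu> = {s. (\<forall>k. s k \<in> c00) \<and>
      (\<forall>\<epsilon>>0. \<exists>K. \<forall>k\<ge>K. \<forall>l\<ge>K. mu_bar \<mu> (\<lambda>n. s k n - s l n) < \<epsilon>)}"

definition Xnorm :: "(qseq \<Rightarrow> real) \<Rightarrow> (nat \<Rightarrow> nat \<Rightarrow> real) \<Rightarrow> real" where
  "Xnorm \<mu> s = lim (\<lambda>k. mu_bar \<mu> (s k))"

definition Xadd :: "(nat \<Rightarrow> nat \<Rightarrow> real) \<Rightarrow> (nat \<Rightarrow> nat \<Rightarrow> real) \<Rightarrow> (nat \<Rightarrow> nat \<Rightarrow> real)" where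
  "Xadd s t = (\<lambda>k n. s k n + t k n)"

definition Xdiff :: "(nat \<Rightarrow> nat \<Rightarrow> real) \<Rightarrow> (nat \<Rightarrow> nat \<Rightarrow> real) \<Rightarrow> (nat \<Rightarrow> nat \<Rightarrow> real)" where
  "Xdiff s t = (\<lambda>k n. s k n - t k n)"

definition Xscale :: "real \<Rightarrow> (nat \<Rightarrow> nat \<Rightarrow> real) \<Rightarrow> (nat \<Rightarrow> nat \<Rightarrow> real)" where
  "Xscale c s = (\<lambda>k n. c * s k n)"

definition Xlincomb :: "nat \<Rightarrow> (nat \<Rightarrow> real) \<Rightarrow> (nat \<Rightarrow> nat \<Rightarrow> nat \<Rightarrow> real) \<Rightarrow> (nat \<Rightarrow> nat \<Rightarrow> real)" where
  "Xlincomb m c x = (\<lambda>k n. \<Sum>i<m. c i * x i k n)"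

definition Xball :: "(qseq \<Rightarrow> real) \<Rightarrow> (nat \<Rightarrow> nat \<Rightarrow> real) set" where
  "Xball \<mu> = {x \<in> Xcarrier \<mu>. Xnorm \<mu> x \<le> 1}"

definition Xdual_sphere :: "(qseq \<Rightarrow> real) \<Rightarrow> ((nat \<Rightarrow> nat \<Rightarrow> real) \<Rightarrow> real) set" where
  "Xdual_sphere \<mu> = {f.
      (\<forall>x\<in>Xcarrier \<mu>. \<forall>y\<in>Xcarrier \<mu>. f (Xadd x y) = f x + f y) \<and>
      (\<forall>c. \<forall>x\<in>Xcarrier \<mu>. f (Xscale c x) = c * f x) \<and>
      (\<exists>C. \<forall>x\<in>Xcarrier \<mu>. \<bar>f x\<bar> \<le> C * Xnorm \<mu> x) \<and>
      Sup ((\<lambda>x. \<bar>f x\<bar>) ` Xball \<mu>) = 1}"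

definition Xslice :: "(qseq \<Rightarrow> real) \<Rightarrow> ((nat \<Rightarrow> nat \<Rightarrow> real) \<Rightarrow> real) \<Rightarrow> real \<Rightarrow> (nat \<Rightarrow> nat \<Rightarrow> real) set" where
  "Xslice \<mu> f \<alpha> = {x \<in> Xball \<mu>. f x > 1 - \<alpha>}"

definition Xdiam :: "(qseq \<Rightarrow> real) \<Rightarrow> (nat \<Rightarrow> nat \<Rightarrow> real) set \<Rightarrow> real" where
  "Xdiam \<mu> A = Sup {Xnorm \<mu> (Xdiff x y) | x y. x \<in> A \<and> y \<in> A}"

definition SD2P :: "(qseq \<Rightarrow> real) \<Rightarrow> bool" where
  "SD2P \<mu> \<longleftrightarrow>
     (\<forall>m::nat. \<forall>lam f \<alpha>. m \<ge> 1 \<and> (\<forall>i<m. lam i \<ge> 0) \<and> (\<Sum>i<m. lam i) = 1 \<and>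
        (\<forall>i<m. f i \<in> Xdual_sphere \<mu> \<and> \<alpha> i > 0) \<longrightarrow>
        Xdiam \<mu> {Xlincomb m lam x | x. \<forall>i<m. x i \<in> Xslice \<mu> (f i) (\<alpha> i)} = 2)"

definition Xinfdim :: "(qseq \<Rightarrow> real) \<Rightarrow> bool" where
  "Xinfdim \<mu> \<longleftrightarrow>
     (\<forall>m. \<exists>x. (\<forall>i<m. x i \<in> Xcarrier \<mu>) \<and>
        (\<forall>c. Xnorm \<mu> (Xlincomb m c x) = 0 \<longrightarrow> (\<forall>i<m. c i = 0)))"

definition Pinf_set :: "(qseq \<Rightarrow> real) set" where
  "Pinf_set = {\<mu> \<in> P_set. Xinfdim \<mu>}"

definition B_set :: "(qseq \<Rightarrow> real) set" where
  "B_set = {\<mu> \<in> Pinf_set. \<forall>x\<in>c00. mu_bar \<mu> x = 0 \<longrightarrow> x = (\<lambda>_. 0)}"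

definition polish_top :: "'a topology \<Rightarrow> bool" where
  "polish_top W \<longleftrightarrow> completely_metrizable_space W \<and> separable_space W"

text \<open>A is G_delta-complete in Z, where the quantification over zero-dimensional Polish
  spaces W ranges over spaces carried by the type 'z (universally quantified in the theorem).\<close>
definition gdelta_complete :: "'z itself \<Rightarrow> 'a topology \<Rightarrow> 'a set \<Rightarrow> bool" where
  "gdelta_complete _ Z A \<longleftrightarrow>
     gdelta_in Z A \<and>
     (\<forall>(W :: 'z topology) G. polish_top W \<and> W dim_le 0 \<and> gdelta_in W G \<longrightarrow>
        (\<exists>h. continuous_map W Z h \<and> G = {w \<in> topspace W. h w \<in> A}))"

end

theory Submission
  imports Defs "HOL-Library.Function_Algebras"
begin

text \<open>
  A space has the SD2P iff any finitely many slices of its ball contain points \<open>y\<^sub>1, \<dots>, y\<^sub>m\<close> with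
  \<open>\<parallel>y\<^sub>1 + \<dots> + y\<^sub>m\<parallel>\<close> as close to \<open>m\<close> as desired (for the diameter, use the slices of \<open>f\<^sub>i\<close> and \<open>- f\<^sub>i\<close>
  together). A slice of the ball of the \<open>m\<close>-fold max-sum is contained in a product of slices, so by the
  Hahn--Banach theorem this says that every tuple in the open ball is a norm limit of subconvex combinations of
  such tuples. The last condition no longer mentions functionals, may be tested on rational vectors, and is a
  countable intersection of open conditions on \<open>\<mu>\<close>.

  For completeness, write the given \<open>G\<^sub>\<delta>\<close> set as the set of points lying in infinitely many of the clopen sets
  \<open>A\<^sub>i\<close>, and cut the natural numbers into consecutive blocks by a new separator at each \<open>i\<close> with \<open>w \<in> A\<^sub>i\<close>.
  The maximum of the 1-norms over the blocks depends continuously on \<open>w\<close>. With infinitely many blocks it gives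
  a \<open>c\<^sub>0\<close>-sum, which has the SD2P; with finitely many blocks it gives a finite max-sum of 1-spaces, which does not.
\<close>

text \<open>As defined, the SD2P quantifies over all functionals of \<open>X_mu\<close>, an
  uncountable family that itself varies with \<open>\<mu>\<close>; this form gives no bound on the
  complexity. Once separation has removed the functionals, two features make the condition a
  countable intersection of open ones: everything demanded of the produced tuples is a strict
  inequality, and the only hypothesis, \<open>N (x i) < 1\<close>, can be relaxed by an error that
  tends to 0. Coefficients may sum to less than 1 because 0 has to lie in the hull for the gauge
  argument, and because real coefficients can then simply be rounded down to rational ones.

  For hardness, every finite amount of information must fix the norm of the vectors supported in an
  initial segment and still leave both outcomes possible. Block labels do this: the label of a
  coordinate depends on finitely many of the clopen sets.

  No quotient is formed. The arguments concern a seminorm on a subspace of a real vector space; the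
  pointwise structure introduced here turns finite sequences, Cauchy sequences and tuples alike into
  vectors.\<close>

instantiation "fun" :: (type, real_vector) real_vector
begin

definition "c *\<^sub>R f = (\<lambda>x. c *\<^sub>R f x)"

instance
  by standard (simp_all add: scaleR_fun_def fun_eq_iff scaleR_add_left scaleR_add_right)

end

lemma scaleR_fun_apply [simp]: "(c *\<^sub>R f) x = c *\<^sub>R f x"
  by (simp add: scaleR_fun_def)

lemma sum_fun_apply: "(\<Sum>i\<in>I. f i) x = (\<Sum>i\<in>I. f i x)"
  by (induction I rule: infinite_finite_induct) simp_all

section \<open>Hahn--Banach theorem for sublinear functionals\<close>

definition sublinear_on :: "'a::real_vector set \<Rightarrow> ('a \<Rightarrow> real) \<Rightarrow> bool" where
  "sublinear_on S p \<longleftrightarrow>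
     (\<forall>x\<in>S. \<forall>y\<in>S. p (x + y) \<le> p x + p y) \<and> (\<forall>c>0. \<forall>x\<in>S. p (c *\<^sub>R x) \<le> c * p x)"

definition linear_functional_on :: "'a::real_vector set \<Rightarrow> ('a \<Rightarrow> real) \<Rightarrow> bool" where
  "linear_functional_on S f \<longleftrightarrow>
     (\<forall>x\<in>S. \<forall>y\<in>S. f (x + y) = f x + f y) \<and> (\<forall>c. \<forall>x\<in>S. f (c *\<^sub>R x) = c * f x)"

lemma sublinear_onD:
  assumes "sublinear_on S p" "subspace S"
  shows "\<And>x y. x \<in> S \<Longrightarrow> y \<in> S \<Longrightarrow> p (x + y) \<le> p x + p y"
    and "\<And>c x. 0 < c \<Longrightarrow> x \<in> S \<Longrightarrow> p (c *\<^sub>R x) = c * p x"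
    and "p 0 = 0"
    and "\<And>x. x \<in> S \<Longrightarrow> - p (- x) \<le> p x"
proof -
  show add: "\<And>x y. x \<in> S \<Longrightarrow> y \<in> S \<Longrightarrow> p (x + y) \<le> p x + p y"
    using assms by (auto simp: sublinear_on_def)
  have le: "\<And>c x. 0 < c \<Longrightarrow> x \<in> S \<Longrightarrow> p (c *\<^sub>R x) \<le> c * p x"
    using assms by (auto simp: sublinear_on_def)
  show eq: "p (c *\<^sub>R x) = c * p x" if "0 < c" "x \<in> S" for c x
  proof (rule antisym[OF le[OF that]])
    have "p (inverse c *\<^sub>R (c *\<^sub>R x)) \<le> inverse c * p (c *\<^sub>R x)"
      using le that assms(2) by (intro le) (auto simp: subspace_scale)
    then show "c * p x \<le> p (c *\<^sub>R x)"
      using that by (simp add: field_simps)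
  qed
  have "0 \<in> S" using assms(2) by (rule subspace_0)
  from eq[of 2 0, OF _ this] show zero: "p 0 = 0" by simp
  show "- p (- x) \<le> p x" if "x \<in> S" for x
    using add[of x "- x"] that subspace_neg[OF assms(2)] zero by auto
qed

text \<open>The witness is \<open>q' x = inf {q (x + t a) - t q a | t \<ge> 0}\<close>; hence a minimal sublinear functional is odd, and therefore linear.\<close>

lemma sublinear_on_shift:
  assumes S: "subspace S" and q: "sublinear_on S q" and a: "a \<in> S"
  obtains q' where "sublinear_on S q'" "\<And>x. x \<in> S \<Longrightarrow> q' x \<le> q x" "q' (- a) \<le> - q a"
proof -
  define V where "V x = (\<lambda>t. q (x + t *\<^sub>R a) - t * q a) ` {0..}" for x
  define q' where "q' x = Inf (V x)" for x
  note D = sublinear_onD[OF q S]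
  \<comment> \<open>A lower bound that does not involve \<open>t\<close> keeps the infimum
    finite.\<close>
  have lower: "- q (- x) \<le> q (x + t *\<^sub>R a) - t * q a" if "x \<in> S" "t \<ge> 0" for x t
  proof (cases "t = 0")
    case True
    then show ?thesis using D(4)[of x] that by simp
  next
    case False
    have "q (t *\<^sub>R a) \<le> q (x + t *\<^sub>R a) + q (- x)"
      using D(1)[of "x + t *\<^sub>R a" "- x"] that a S by (auto simp: subspace_add subspace_scale subspace_neg)
    then show ?thesis using D(2)[of t a] False that a by auto
  qed
  have bdd: "bdd_below (V x)" if "x \<in> S" for x
    using lower[OF that] unfolding V_def by (intro bdd_belowI2) auto
  have upper: "q' x \<le> q (x + t *\<^sub>R a) - t * q a" if "x \<in> S" "t \<ge> 0" for x t
    unfolding q'_def using bdd[OF that(1)] that(2) by (auto intro!: cInf_lower simp: V_def)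
  have approx: "\<exists>t\<ge>0. q (x + t *\<^sub>R a) - t * q a < q' x + e" if "x \<in> S" "e > 0" for x e
  proof -
    have "Inf (V x) < q' x + e" using that by (simp add: q'_def)
    moreover have "V x \<noteq> {}" by (auto simp: V_def)
    ultimately have "\<exists>v\<in>V x. v < q' x + e" using cInf_lessD by blast
    then show ?thesis by (auto simp: V_def)
  qed
  have "sublinear_on S q'"
    unfolding sublinear_on_def
  proof (intro conjI ballI allI impI)
    fix x y assume xy: "x \<in> S" "y \<in> S"
    show "q' (x + y) \<le> q' x + q' y"
    proof (rule field_le_epsilon)
      fix e :: real assume "e > 0"
      then obtain s t where s: "s \<ge> 0" "q (x + s *\<^sub>R a) - s * q a < q' x + e / 2"
        and t: "t \<ge> 0" "q (y + t *\<^sub>R a) - t * q a < q' y + e / 2"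
        using approx[OF xy(1), of "e / 2"] approx[OF xy(2), of "e / 2"] by auto
      have "q' (x + y) \<le> q ((x + y) + (s + t) *\<^sub>R a) - (s + t) * q a"
        using s t xy S by (intro upper) (auto simp: subspace_add)
      also have "(x + y) + (s + t) *\<^sub>R a = (x + s *\<^sub>R a) + (y + t *\<^sub>R a)"
        by (simp add: algebra_simps)
      also have "q \<dots> \<le> q (x + s *\<^sub>R a) + q (y + t *\<^sub>R a)"
        using xy a S by (intro D(1)) (auto simp: subspace_add subspace_scale)
      finally show "q' (x + y) \<le> q' x + q' y + e" using s t by (simp add: algebra_simps)
    qed
  next
    fix c :: real and x assume c: "c > 0" and x: "x \<in> S"
    show "q' (c *\<^sub>R x) \<le> c * q' x"
    proof (rule field_le_epsilon)
      fix e :: real assume "e > 0"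
      then obtain t where t: "t \<ge> 0" "q (x + t *\<^sub>R a) - t * q a < q' x + e / c"
        using approx[OF x, of "e / c"] c by auto
      have "q' (c *\<^sub>R x) \<le> q (c *\<^sub>R x + (c * t) *\<^sub>R a) - (c * t) * q a"
        using t c x S by (intro upper) (auto simp: subspace_scale)
      also have "c *\<^sub>R x + (c * t) *\<^sub>R a = c *\<^sub>R (x + t *\<^sub>R a)"
        by (simp add: algebra_simps)
      also have "q \<dots> = c * q (x + t *\<^sub>R a)"
        using c x a S by (intro D(2)) (auto simp: subspace_add subspace_scale)
      also have "c * q (x + t *\<^sub>R a) - c * t * q a = c * (q (x + t *\<^sub>R a) - t * q a)"
        by (simp add: algebra_simps)
      also have "\<dots> \<le> c * (q' x + e / c)" using t c by (intro mult_left_mono) auto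
      finally show "q' (c *\<^sub>R x) \<le> c * q' x + e" using c by (simp add: algebra_simps)
    qed
  qed
  moreover have "q' x \<le> q x" if "x \<in> S" for x using upper[OF that, of 0] by simp
  moreover have "q' (- a) \<le> - q a"
    using upper[of "- a" 1] a S D(3) by (simp add: subspace_neg)
  ultimately show thesis by (rule that)
qed

text \<open>Zorn's lemma for the reversed pointwise order. The pointwise infimum of a chain is
  finite on \<open>S\<close> because each member \<open>q\<close> satisfies
  \<open>- p (- x) \<le> q x\<close>.\<close>

lemma minimal_sublinear_on:
  assumes S: "subspace S" and p: "sublinear_on S p"
  obtains q where "sublinear_on S q" "\<And>x. x \<in> S \<Longrightarrow> q x \<le> p x"
    "\<And>q' x. sublinear_on S q' \<Longrightarrow> (\<And>x. x \<in> S \<Longrightarrow> q' x \<le> q x) \<Longrightarrow> x \<in> S \<Longrightarrow> q' x = q x"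
proof -
  \<comment> \<open>Values outside \<open>S\<close> are fixed to be 0, so that members of
    \<open>A\<close> are determined by their values on \<open>S\<close> and comparing them
    everywhere is comparing them on \<open>S\<close>.\<close>
  define A where "A = {q. sublinear_on S q \<and> (\<forall>x\<in>S. q x \<le> p x) \<and> (\<forall>x. x \<notin> S \<longrightarrow> q x = 0)}"
  define res where "res q = (\<lambda>x. if x \<in> S then q x else 0)" for q :: "'a \<Rightarrow> real"
  have res: "sublinear_on S (res q) \<longleftrightarrow> sublinear_on S q" for q
    using S by (auto simp: sublinear_on_def res_def subspace_add subspace_scale)
  have "\<exists>m\<in>A. \<forall>a\<in>A. a \<le> m \<longrightarrow> a = m"
  proof (rule predicate_Zorn[where P = "\<lambda>q q'. q' \<le> q"])
    show "partial_order_on A (relation_of (\<lambda>q q'. q' \<le> q) A)"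
      by (rule partial_order_on_relation_ofI) auto
  next
    fix C assume "C \<in> Chains (relation_of (\<lambda>q q'. q' \<le> q) A)"
    then have CA: "C \<subseteq> A" and chain: "\<And>q q'. q \<in> C \<Longrightarrow> q' \<in> C \<Longrightarrow> q \<le> q' \<or> q' \<le> q"
      by (auto simp: Chains_def relation_of_def)
    show "\<exists>u\<in>A. \<forall>a\<in>C. u \<le> a"
    proof (cases "C = {}")
      case True
      have "res p \<in> A" using p res by (auto simp: A_def) (auto simp: res_def)
      then show ?thesis using True by blast
    next
      case False
      define u where "u x = (INF q\<in>C. q x)" for x
      have lower: "- p (- x) \<le> q x" if "q \<in> C" "x \<in> S" for q x
      proof -
        have "sublinear_on S q" "q (- x) \<le> p (- x)"
          using that CA S by (auto simp: A_def subspace_neg)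
        then show ?thesis using sublinear_onD(4)[of S q x] that S by force
      qed
      have bdd: "bdd_below ((\<lambda>q. q x) ` C)" for x
      proof (cases "x \<in> S")
        case True then show ?thesis using lower by (intro bdd_belowI2) auto
      next
        case F: False
        show ?thesis
          by (rule bdd_belowI2[of _ 0]) (use F CA in \<open>auto simp: A_def\<close>)
      qed
      have le: "u x \<le> q x" if "q \<in> C" for q x
        unfolding u_def using bdd that by (rule cINF_lower)
      have approx: "\<exists>q\<in>C. q x < u x + e" if "e > 0" for x e
      proof -
        have "(INF q\<in>C. q x) < u x + e" using that by (simp add: u_def)
        then show ?thesis using cINF_less_iff[OF False bdd] by blast
      qed
      have "u \<in> A"
        unfolding A_def sublinear_on_def
      proof (intro CollectI conjI ballI allI impI)
        fix x y assume xy: "x \<in> S" "y \<in> S"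
        show "u (x + y) \<le> u x + u y"
        proof (rule field_le_epsilon)
          fix e :: real assume "e > 0"
          then obtain q1 q2 where q: "q1 \<in> C" "q1 x < u x + e / 2" "q2 \<in> C" "q2 y < u y + e / 2"
            using approx[of "e / 2" x] approx[of "e / 2" y] by auto
          \<comment> \<open>In a chain, the smaller of the two near-minimisers serves both
            \<open>x\<close> and \<open>y\<close>.\<close>
          obtain q where "q \<in> C" "q \<le> q1" "q \<le> q2" using chain q by blast
          then have "q x < u x + e / 2" "q y < u y + e / 2"
            using q by (auto simp: le_fun_def intro: le_less_trans)
          moreover have "q (x + y) \<le> q x + q y"
            using \<open>q \<in> C\<close> CA xy by (auto simp: A_def sublinear_on_def)
          ultimately show "u (x + y) \<le> u x + u y + e" using le[OF \<open>q \<in> C\<close>, of "x + y"] by linarith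
        qed
      next
        fix c :: real and x assume c: "c > 0" and x: "x \<in> S"
        show "u (c *\<^sub>R x) \<le> c * u x"
        proof (rule field_le_epsilon)
          fix e :: real assume "e > 0"
          then obtain q where q: "q \<in> C" "q x < u x + e / c" using approx[of "e / c" x] c by auto
          have "u (c *\<^sub>R x) \<le> c * q x"
            using le[OF q(1), of "c *\<^sub>R x"] q(1) CA c x by (force simp: A_def sublinear_on_def)
          also have "\<dots> \<le> c * (u x + e / c)" using q c by (intro mult_left_mono) auto
          finally show "u (c *\<^sub>R x) \<le> c * u x + e" using c by (simp add: algebra_simps)
        qed
      next
        fix x assume "x \<in> S"
        obtain q where "q \<in> C" using False by blast
        then show "u x \<le> p x" using le[of q x] CA \<open>x \<in> S\<close> by (force simp: A_def)
      next
        fix x assume "x \<notin> S"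
        then have "q x = 0" if "q \<in> C" for q using CA that by (auto simp: A_def)
        then have "(\<lambda>q. q x) ` C = {0}" using False by force
        then show "u x = 0" by (simp add: u_def)
      qed
      then show ?thesis using le by (auto simp: le_fun_def)
    qed
  qed
  then obtain q where q: "q \<in> A" and min: "\<And>a. a \<in> A \<Longrightarrow> a \<le> q \<Longrightarrow> a = q" by blast
  show thesis
  proof (rule that)
    show "sublinear_on S q" "\<And>x. x \<in> S \<Longrightarrow> q x \<le> p x" using q by (auto simp: A_def)
    fix q' x assume q': "sublinear_on S q'" "\<And>x. x \<in> S \<Longrightarrow> q' x \<le> q x" and x: "x \<in> S"
    have "res q' \<in> A" using q' q res by (fastforce simp: A_def res_def)
    moreover have "res q' \<le> q" using q' q by (auto simp: le_fun_def res_def A_def)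
    ultimately have "res q' = q" by (rule min)
    then show "q' x = q x" using x by (auto simp: res_def)
  qed
qed

theorem hahn_banach_sublinear:
  assumes S: "subspace S" and p: "sublinear_on S p" and a: "a \<in> S"
  obtains F where "linear_functional_on S F" "\<And>x. x \<in> S \<Longrightarrow> F x \<le> p x" "F a = p a"
proof -
  \<comment> \<open>Shifting at \<open>a\<close> before minimising forces the value at
    \<open>a\<close>: an odd functional \<open>F\<close> below \<open>p'\<close> has
    \<open>- F a = F (- a) \<le> - p a\<close>.\<close>
  obtain p' where p': "sublinear_on S p'" "\<And>x. x \<in> S \<Longrightarrow> p' x \<le> p x" "p' (- a) \<le> - p a"
    using sublinear_on_shift[OF S p a] by blast
  obtain q where q: "sublinear_on S q" "\<And>x. x \<in> S \<Longrightarrow> q x \<le> p' x"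
    and min: "\<And>q' x. sublinear_on S q' \<Longrightarrow> (\<And>x. x \<in> S \<Longrightarrow> q' x \<le> q x) \<Longrightarrow> x \<in> S \<Longrightarrow> q' x = q x"
    using minimal_sublinear_on[OF S p'(1)] by blast
  note D = sublinear_onD[OF q(1) S]
  have neg: "q (- x) = - q x" if x: "x \<in> S" for x
  proof -
    obtain q' where q': "sublinear_on S q'" "\<And>x. x \<in> S \<Longrightarrow> q' x \<le> q x" "q' (- x) \<le> - q x"
      using sublinear_on_shift[OF S q(1) x] by blast
    have "q (- x) \<le> - q x"
      using q' min[OF q'(1,2), of "- x"] x S by (simp add: subspace_neg)
    then show ?thesis using D(4)[OF x] by simp
  qed
  have "linear_functional_on S q"
    unfolding linear_functional_on_def
  proof (intro conjI ballI allI)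
    fix x y assume xy: "x \<in> S" "y \<in> S"
    have "q x \<le> q (x + y) + q (- y)"
      using D(1)[of "x + y" "- y"] xy S by (simp add: subspace_add subspace_neg)
    then show "q (x + y) = q x + q y" using D(1)[OF xy] neg xy by auto
  next
    fix c :: real and x assume x: "x \<in> S"
    consider "c > 0" | "c = 0" | "c < 0" by linarith
    then show "q (c *\<^sub>R x) = c * q x"
    proof cases
      case 3
      then have "q (- ((- c) *\<^sub>R x)) = c * q x"
        using neg[of "(- c) *\<^sub>R x"] D(2)[of "- c" x] x S by (simp add: subspace_scale del: scaleR_minus_left)
      then show ?thesis by simp
    qed (use D x in auto)
  qed
  moreover have "q x \<le> p x" if "x \<in> S" for x using q(2) p'(2) that by force
  moreover have "q a = p a"
    using q(2)[of "- a"] p'(3) neg[OF a] a S q(2)[OF a] p'(2)[OF a] by (auto simp: subspace_neg)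
  ultimately show thesis by (rule that)
qed

section \<open>The strong diameter two property in seminormed spaces\<close>

lemma linear_functional_onD:
  assumes "linear_functional_on S f" "subspace S"
  shows "\<And>x y. x \<in> S \<Longrightarrow> y \<in> S \<Longrightarrow> f (x + y) = f x + f y"
    and "\<And>c x. x \<in> S \<Longrightarrow> f (c *\<^sub>R x) = c * f x"
    and "\<And>x y. x \<in> S \<Longrightarrow> y \<in> S \<Longrightarrow> f (x - y) = f x - f y"
    and "\<And>x. x \<in> S \<Longrightarrow> f (- x) = - f x"
    and "f 0 = 0"
    and "\<And>g I. finite I \<Longrightarrow> (\<And>i. i \<in> I \<Longrightarrow> g i \<in> S) \<Longrightarrow> f (\<Sum>i\<in>I. g i) = (\<Sum>i\<in>I. f (g i))"
proof -
  show add: "\<And>x y. x \<in> S \<Longrightarrow> y \<in> S \<Longrightarrow> f (x + y) = f x + f y"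
    and scl: "\<And>c x. x \<in> S \<Longrightarrow> f (c *\<^sub>R x) = c * f x"
    using assms by (auto simp: linear_functional_on_def)
  show zero: "f 0 = 0" using scl[of 0 0] subspace_0[OF assms(2)] by simp
  show neg: "f (- x) = - f x" if "x \<in> S" for x using scl[of x "- 1"] that by simp
  show "f (x - y) = f x - f y" if "x \<in> S" "y \<in> S" for x y
    using add[of x "- y"] neg[of y] that subspace_neg[OF assms(2)] by simp
  show "f (\<Sum>i\<in>I. g i) = (\<Sum>i\<in>I. f (g i))" if "finite I" "\<And>i. i \<in> I \<Longrightarrow> g i \<in> S" for g and I :: "'b set"
    using that
    by (induction I rule: finite_induct) (auto simp: zero add subspace_sum[OF assms(2)])
qed

definition dual_sphere :: "'a::real_vector set \<Rightarrow> ('a \<Rightarrow> real) \<Rightarrow> ('a \<Rightarrow> real) set" where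
  "dual_sphere S N = {f. linear_functional_on S f \<and> (\<exists>C. \<forall>x\<in>S. \<bar>f x\<bar> \<le> C * N x) \<and>
     Sup ((\<lambda>x. \<bar>f x\<bar>) ` {x \<in> S. N x \<le> 1}) = 1}"

definition strong_diameter_two :: "'a::real_vector set \<Rightarrow> ('a \<Rightarrow> real) \<Rightarrow> bool" where
  "strong_diameter_two S N \<longleftrightarrow>
     (\<forall>m::nat. \<forall>lam f \<alpha>. m \<ge> 1 \<and> (\<forall>i<m. lam i \<ge> 0) \<and> (\<Sum>i<m. lam i) = 1 \<and>
        (\<forall>i<m. f i \<in> dual_sphere S N \<and> \<alpha> i > 0) \<longrightarrow>
        Sup {N (x - y) | x y.
          x \<in> {\<Sum>i<m. lam i *\<^sub>R x i | x. \<forall>i<m. x i \<in> S \<and> N (x i) \<le> 1 \<and> f i (x i) > 1 - \<alpha> i} \<and>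
          y \<in> {\<Sum>i<m. lam i *\<^sub>R x i | x. \<forall>i<m. x i \<in> S \<and> N (x i) \<le> 1 \<and> f i (x i) > 1 - \<alpha> i}} = 2)"

text \<open>Each \<open>y i\<close> has norm at most 1, so the sum is asked to be nearly as long as
  it can be. One common \<open>\<alpha>\<close> suffices, since finitely many slices can be shrunk
  to the same depth.\<close>

definition slices_norm_additive :: "'a::real_vector set \<Rightarrow> ('a \<Rightarrow> real) \<Rightarrow> bool" where
  "slices_norm_additive S N \<longleftrightarrow>
     (\<forall>(m::nat) f \<alpha> \<epsilon>. \<alpha> > 0 \<and> \<epsilon> > 0 \<and> (\<forall>i<m. f i \<in> dual_sphere S N) \<longrightarrow>
        (\<exists>y. (\<forall>i<m. y i \<in> S \<and> N (y i) \<le> 1 \<and> f i (y i) > 1 - \<alpha>) \<and> N (\<Sum>i<m. y i) > real m - \<epsilon>))"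

text \<open>Since the coefficients are rational, for rational vectors this only involves the values of \<open>N\<close>
  at rational vectors.\<close>

definition spread_tuples_dense :: "'a::real_vector set \<Rightarrow> ('a \<Rightarrow> real) \<Rightarrow> bool" where
  "spread_tuples_dense Q N \<longleftrightarrow>
     (\<forall>(m::nat) x \<epsilon>. \<epsilon> > 0 \<and> (\<forall>i<m. x i \<in> Q \<and> N (x i) < 1) \<longrightarrow>
        (\<exists>(J::nat set) t y. finite J \<and> (\<forall>j\<in>J. t j \<in> \<rat> \<and> 0 \<le> t j) \<and> sum t J \<le> 1 \<and>
           (\<forall>j\<in>J. \<forall>i<m. y j i \<in> Q \<and> N (y j i) < 1) \<and>
           (\<forall>j\<in>J. real m - \<epsilon> < N (\<Sum>i<m. y j i)) \<and>
           (\<forall>i<m. N (x i - (\<Sum>j\<in>J. t j *\<^sub>R y j i)) < \<epsilon>)))"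

text \<open>The deficits \<open>1 - c i\<close> are nonnegative and add up to less than
  \<open>a\<close>, hence so is each of them.\<close>

lemma sum_near_max:
  fixes c :: "nat \<Rightarrow> real"
  assumes "\<And>i. i < m \<Longrightarrow> c i \<le> 1" "(\<Sum>i<m. c i) > real m - a" "i < m"
  shows "c i > 1 - a"
proof -
  have "(\<Sum>i<m. c i) = c i + (\<Sum>j\<in>{..<m} - {i}. c j)"
    using assms(3) by (subst sum.remove[of _ i]) auto
  also have "(\<Sum>j\<in>{..<m} - {i}. c j) \<le> (\<Sum>j\<in>{..<m} - {i}. 1)"
    using assms(1) by (intro sum_mono) auto
  also have "(\<Sum>j\<in>{..<m} - {i}. 1) = real m - 1" using assms(3) by (simp add: of_nat_diff)
  finally show ?thesis using assms(2) by linarith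
qed

text \<open>If all \<open>w j\<close> were at most \<open>c\<close>, so would be their combination;
  \<open>0 \<le> c\<close> compensates for a total weight below 1. It selects one good tuple out of
  a subconvex combination.\<close>

lemma subconvex_pigeonhole:
  fixes t w :: "'i \<Rightarrow> real"
  assumes t: "\<And>j. j \<in> J \<Longrightarrow> 0 \<le> t j" "sum t J \<le> 1" and c: "0 \<le> c" "c < (\<Sum>j\<in>J. t j * w j)"
  shows "\<exists>j\<in>J. c < w j"
proof (rule ccontr)
  assume "\<not> ?thesis"
  then have "(\<Sum>j\<in>J. t j * w j) \<le> (\<Sum>j\<in>J. t j * c)"
    using t by (intro sum_mono mult_left_mono) (auto simp: not_less)
  also have "\<dots> = sum t J * c" by (simp add: sum_distrib_right)
  also have "\<dots> \<le> 1 * c" using t c by (intro mult_right_mono) auto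
  finally show False using c by simp
qed

lemma sum_lessThan_add:
  fixes g :: "nat \<Rightarrow> 'a::comm_monoid_add"
  shows "(\<Sum>i<m + k. g i) = (\<Sum>i<m. g i) + (\<Sum>i<k. g (m + i))"
  by (induction k) (simp_all add: add.assoc)

section \<open>Seminormed spaces and functionals of norm one\<close>

locale seminormed_space =
  fixes S :: "'a::real_vector set" and N :: "'a \<Rightarrow> real"
  assumes subsp: "subspace S"
    and triangle: "\<And>x y. x \<in> S \<Longrightarrow> y \<in> S \<Longrightarrow> N (x + y) \<le> N x + N y"
    and scale: "\<And>c x. x \<in> S \<Longrightarrow> N (c *\<^sub>R x) = \<bar>c\<bar> * N x"
begin

lemmas mem = subspace_0[OF subsp] subspace_add[OF subsp] subspace_diff[OF subsp]
  subspace_neg[OF subsp] subspace_scale[OF subsp]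

lemma mem_sum: "(\<And>i. i \<in> I \<Longrightarrow> g i \<in> S) \<Longrightarrow> (\<Sum>i\<in>I. g i) \<in> S"
  by (rule subspace_sum[OF subsp])

lemma N_0 [simp]: "N 0 = 0"
  using scale[of 0 0] mem(1) by simp

lemma N_minus: "x \<in> S \<Longrightarrow> N (- x) = N x"
  using scale[of x "- 1"] by simp

lemma N_nonneg: "x \<in> S \<Longrightarrow> 0 \<le> N x"
  using triangle[of x "- x"] by (simp add: N_minus mem)

lemma N_diff: "x \<in> S \<Longrightarrow> y \<in> S \<Longrightarrow> N (x - y) \<le> N x + N y"
  using triangle[of x "- y"] by (simp add: N_minus mem)

lemma N_diff_ge: "x \<in> S \<Longrightarrow> y \<in> S \<Longrightarrow> N x - N y \<le> N (x - y)"
  using triangle[of "x - y" y] by (simp add: mem)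

lemma N_sum: "(\<And>i. i \<in> I \<Longrightarrow> g i \<in> S) \<Longrightarrow> N (\<Sum>i\<in>I. g i) \<le> (\<Sum>i\<in>I. N (g i))"
proof (induction I rule: infinite_finite_induct)
  case (insert i I)
  then show ?case using triangle[of "g i" "\<Sum>i\<in>I. g i"] mem_sum[of I g] by simp
qed simp_all

text \<open>Here \<open>c\<close> is the norm of \<open>f\<close>. The bound passes from the unit
  ball to all of \<open>S\<close> by homogeneity, and a positive \<open>c\<close> permits dividing
  \<open>f\<close> into the dual sphere.\<close>

lemma functional_normalisable:
  assumes f: "linear_functional_on S f" and C: "\<And>x. x \<in> S \<Longrightarrow> \<bar>f x\<bar> \<le> C * N x"
  defines "c \<equiv> Sup ((\<lambda>x. \<bar>f x\<bar>) ` {x \<in> S. N x \<le> 1})"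
  shows "0 \<le> c" "\<And>x. x \<in> S \<Longrightarrow> \<bar>f x\<bar> \<le> c * N x"
    "c > 0 \<Longrightarrow> (\<lambda>x. f x / c) \<in> dual_sphere S N"
proof -
  note L = linear_functional_onD[OF f subsp]
  have bdd: "bdd_above ((\<lambda>x. \<bar>f x\<bar>) ` {x \<in> S. N x \<le> 1})"
  proof (rule bdd_aboveI2)
    fix x assume x: "x \<in> {x \<in> S. N x \<le> 1}"
    have "\<bar>f x\<bar> \<le> \<bar>C\<bar> * N x"
      using x by (intro order_trans[OF C mult_right_mono[OF abs_ge_self N_nonneg]]) auto
    also have "\<dots> \<le> \<bar>C\<bar> * 1" using x by (intro mult_left_mono) auto
    finally show "\<bar>f x\<bar> \<le> \<bar>C\<bar>" by simp
  qed
  have ub: "\<bar>f x\<bar> \<le> c" if "x \<in> S" "N x \<le> 1" for x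
    unfolding c_def using that by (intro cSup_upper[OF _ bdd]) auto
  show c0: "0 \<le> c" using ub[of 0] mem(1) by simp
  show bound: "\<bar>f x\<bar> \<le> c * N x" if x: "x \<in> S" for x
  \<comment> \<open>A null vector cannot be normalised, but there the given bound by
    \<open>C\<close> already yields \<open>f x = 0\<close>.\<close>
  proof (cases "N x = 0")
    case True then show ?thesis using C[OF x] by simp
  next
    case False
    then have pos: "N x > 0" using N_nonneg[OF x] by simp
    have "\<bar>f (inverse (N x) *\<^sub>R x)\<bar> \<le> c"
      using pos x by (intro ub) (auto simp: mem scale)
    then have "inverse (N x) * \<bar>f x\<bar> \<le> c" using L(2)[OF x] pos by (simp add: abs_mult)
    then show ?thesis using pos by (simp add: field_simps)
  qed
  assume c: "c > 0"
  have "Sup ((\<lambda>x. \<bar>f x / c\<bar>) ` {x \<in> S. N x \<le> 1}) = 1"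
  proof (rule cSup_eq_non_empty)
    show "(\<lambda>x. \<bar>f x / c\<bar>) ` {x \<in> S. N x \<le> 1} \<noteq> {}" using mem(1) by force
    show "v \<le> 1" if "v \<in> (\<lambda>x. \<bar>f x / c\<bar>) ` {x \<in> S. N x \<le> 1}" for v
      using that ub c by auto
    fix v assume v: "\<And>z. z \<in> (\<lambda>x. \<bar>f x / c\<bar>) ` {x \<in> S. N x \<le> 1} \<Longrightarrow> z \<le> v"
    have "c \<le> v * c"
      unfolding c_def
    proof (rule cSup_least)
      show "(\<lambda>x. \<bar>f x\<bar>) ` {x \<in> S. N x \<le> 1} \<noteq> {}" using mem(1) by force
      fix z assume "z \<in> (\<lambda>x. \<bar>f x\<bar>) ` {x \<in> S. N x \<le> 1}"
      then obtain x where x: "x \<in> S" "N x \<le> 1" "z = \<bar>f x\<bar>" by auto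
      then have "\<bar>f x / c\<bar> \<le> v" using v by auto
      then show "z \<le> v * Sup ((\<lambda>x. \<bar>f x\<bar>) ` {x \<in> S. N x \<le> 1})"
        using c x by (simp add: field_simps flip: c_def)
    qed
    then show "1 \<le> v" using c by simp
  qed
  moreover have "linear_functional_on S (\<lambda>x. f x / c)"
    using f by (simp add: linear_functional_on_def add_divide_distrib)
  moreover have "\<forall>x\<in>S. \<bar>f x / c\<bar> \<le> 1 * N x"
    using bound c by (simp add: field_simps)
  ultimately show "(\<lambda>x. f x / c) \<in> dual_sphere S N" unfolding dual_sphere_def by blast
qed

lemma dual_sphereD:
  assumes "f \<in> dual_sphere S N"
  shows "linear_functional_on S f" and "\<And>x. x \<in> S \<Longrightarrow> \<bar>f x\<bar> \<le> N x"
    and "\<And>a. a > 0 \<Longrightarrow> \<exists>x\<in>S. N x < 1 \<and> f x > 1 - a"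
proof -
  obtain C where f: "linear_functional_on S f" and C: "\<And>x. x \<in> S \<Longrightarrow> \<bar>f x\<bar> \<le> C * N x"
    and sup: "Sup ((\<lambda>x. \<bar>f x\<bar>) ` {x \<in> S. N x \<le> 1}) = 1"
    using assms by (auto simp: dual_sphere_def)
  show "linear_functional_on S f" by fact
  note L = linear_functional_onD[OF f subsp]
  show bound: "\<bar>f x\<bar> \<le> N x" if "x \<in> S" for x
    using functional_normalisable(2)[OF f C, of x] that sup by simp
  fix a :: real assume a: "a > 0"
  \<comment> \<open>A loss of \<open>b\<close> occurs twice, in approaching the supremum and in
    shrinking into the open ball; \<open>2 * b \<le> a\<close> gives
    \<open>(1 - b) * (1 - b) \<ge> 1 - a\<close>.\<close>
  define b where "b = min (a / 2) (1 / 2)"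
  have b: "0 < b" "b \<le> 1 / 2" "2 * b \<le> a" using a by (auto simp: b_def)
  have ne: "(\<lambda>x. \<bar>f x\<bar>) ` {x \<in> S. N x \<le> 1} \<noteq> {}" using mem(1) by force
  have "\<exists>v\<in>(\<lambda>x. \<bar>f x\<bar>) ` {x \<in> S. N x \<le> 1}. 1 - b < v"
    using less_cSupD[OF ne, of "1 - b"] b sup by auto
  then obtain x where x: "x \<in> S" "N x \<le> 1" "\<bar>f x\<bar> > 1 - b" by auto
  define z where "z = (if f x \<ge> 0 then x else - x)"
  have z: "z \<in> S" "N z \<le> 1" "f z > 1 - b"
    using x L(4) by (auto simp: z_def mem N_minus)
  have "(1 - b) * N z \<le> 1 - b" using z b by (intro mult_left_le) auto
  moreover have "N ((1 - b) *\<^sub>R z) = (1 - b) * N z" using b by (simp add: scale[OF z(1)])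
  ultimately have "N ((1 - b) *\<^sub>R z) < 1" using b by linarith
  moreover have "f ((1 - b) *\<^sub>R z) > 1 - a"
  proof -
    have "1 - a \<le> (1 - b) * (1 - b)"
      using b mult_pos_pos[OF b(1) b(1)] by (simp add: algebra_simps del: mult_pos_pos)
    also have "\<dots> < (1 - b) * f z" using z b by (intro mult_strict_left_mono) auto
    finally show ?thesis using L(2)[OF z(1)] by simp
  qed
  ultimately show "\<exists>x\<in>S. N x < 1 \<and> f x > 1 - a"
    using z(1) by (intro bexI[of _ "(1 - b) *\<^sub>R z"]) (auto simp: mem)
qed

section \<open>Diameter of combinations of slices and norms of sums\<close>

lemma dual_sphere_minus: "f \<in> dual_sphere S N \<Longrightarrow> (\<lambda>x. - f x) \<in> dual_sphere S N"
  unfolding dual_sphere_def linear_functional_on_def by simp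

text \<open>With equal weights \<open>1 / m\<close> the combinations lie in the unit ball, so two of
  them at distance nearly 2 must themselves have norm nearly 1. Multiplying one of them by
  \<open>m\<close> gives the required sum, which is why the distance is taken within
  \<open>\<epsilon> / m\<close> of 2.\<close>

lemma strong_diameter_two_imp_slices_norm_additive:
  assumes "strong_diameter_two S N"
  shows "slices_norm_additive S N"
  unfolding slices_norm_additive_def
proof (intro allI impI, elim conjE)
  fix m :: nat and f and \<alpha> \<epsilon> :: real
  assume \<alpha>: "\<alpha> > 0" and \<epsilon>: "\<epsilon> > 0" and f: "\<forall>i<m. f i \<in> dual_sphere S N"
  show "\<exists>y. (\<forall>i<m. y i \<in> S \<and> N (y i) \<le> 1 \<and> f i (y i) > 1 - \<alpha>) \<and> N (\<Sum>i<m. y i) > real m - \<epsilon>"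
  proof (cases "m = 0")
    case True then show ?thesis using \<epsilon> by auto
  next
    case False
    define A where "A = {\<Sum>i<m. (1 / real m) *\<^sub>R x i | x.
      \<forall>i<m. x i \<in> S \<and> N (x i) \<le> 1 \<and> f i (x i) > 1 - \<alpha>}"
    have sup: "Sup {N (x - y) | x y. x \<in> A \<and> y \<in> A} = 2"
      using assms[unfolded strong_diameter_two_def, rule_format, of m "\<lambda>_. 1 / real m" f "\<lambda>_. \<alpha>"]
        False f \<alpha> by (simp add: A_def)
    have "\<forall>i<m. \<exists>x. x \<in> S \<and> N x < 1 \<and> f i x > 1 - \<alpha>" using dual_sphereD(3) f \<alpha> by blast
    then obtain x0 where "\<forall>i<m. x0 i \<in> S \<and> N (x0 i) < 1 \<and> f i (x0 i) > 1 - \<alpha>" by metis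
    then have "(\<Sum>i<m. (1 / real m) *\<^sub>R x0 i) \<in> A" unfolding A_def by force
    then have ne: "{N (x - y) | x y. x \<in> A \<and> y \<in> A} \<noteq> {}" by blast
    have "\<exists>v\<in>{N (x - y) | x y. x \<in> A \<and> y \<in> A}. 2 - \<epsilon> / m < v"
      using less_cSupD[OF ne, of "2 - \<epsilon> / m"] False \<epsilon> sup by auto
    then obtain a b where ab: "a \<in> A" "b \<in> A" "N (a - b) > 2 - \<epsilon> / m" by blast
    have A: "v \<in> S \<and> N v \<le> 1" if vA: "v \<in> A" for v
    proof -
      obtain x where x: "v = (\<Sum>i<m. (1 / real m) *\<^sub>R x i)" "\<forall>i<m. x i \<in> S \<and> N (x i) \<le> 1"
        using vA unfolding A_def by blast
      have "N v \<le> (\<Sum>i<m. N ((1 / real m) *\<^sub>R x i))" unfolding x(1) using x by (intro N_sum) (auto simp: mem)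
      also have "\<dots> \<le> (\<Sum>i<m. 1 / real m)" using x by (intro sum_mono) (auto simp: scale divide_right_mono)
      finally show ?thesis using x False by (auto simp: mem intro!: mem_sum)
    qed
    obtain y where y: "a = (\<Sum>i<m. (1 / real m) *\<^sub>R y i)"
      "\<forall>i<m. y i \<in> S \<and> N (y i) \<le> 1 \<and> f i (y i) > 1 - \<alpha>"
      using ab(1) by (auto simp: A_def)
    have "N a > 1 - \<epsilon> / m" using ab N_diff[of a b] A[of a] A[of b] by auto
    moreover have "N a = (1 / real m) * N (\<Sum>i<m. y i)"
    proof -
      have "a = (1 / real m) *\<^sub>R (\<Sum>i<m. y i)" unfolding y(1) by (simp add: scaleR_sum_right)
      then show ?thesis using scale[of "\<Sum>i<m. y i" "1 / real m"] mem_sum[of "{..<m}" y] y(2) by simp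
    qed
    ultimately have "real m * (1 - \<epsilon> / m) < real m * ((1 / real m) * N (\<Sum>i<m. y i))"
      using False by (intro mult_strict_left_mono) auto
    then have "N (\<Sum>i<m. y i) > real m - \<epsilon>" using False by (simp add: right_diff_distrib)
    then show ?thesis using y(2) by blast
  qed
qed

lemma slices_norm_additive_imp_strong_diameter_two:
  assumes "slices_norm_additive S N"
  shows "strong_diameter_two S N"
  unfolding strong_diameter_two_def
proof (intro allI impI, elim conjE)
  fix m :: nat and lam :: "nat \<Rightarrow> real" and f and \<alpha> :: "nat \<Rightarrow> real"
  assume m: "m \<ge> 1" and lam: "\<forall>i<m. lam i \<ge> 0" "(\<Sum>i<m. lam i) = 1"
    and f: "\<forall>i<m. f i \<in> dual_sphere S N \<and> \<alpha> i > 0"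
  define A where "A = {\<Sum>i<m. lam i *\<^sub>R x i | x.
    \<forall>i<m. x i \<in> S \<and> N (x i) \<le> 1 \<and> f i (x i) > 1 - \<alpha> i}"
  define a where "a = Min (\<alpha> ` {..<m})"
  have a: "a > 0" "\<And>i. i < m \<Longrightarrow> a \<le> \<alpha> i"
    using m f by (auto simp: a_def Min_gr_iff lessThan_empty_iff)
  have A: "v \<in> S \<and> N v \<le> 1" if vA: "v \<in> A" for v
  proof -
    obtain x where x: "v = (\<Sum>i<m. lam i *\<^sub>R x i)" "\<forall>i<m. x i \<in> S \<and> N (x i) \<le> 1"
      using vA unfolding A_def by blast
    have "N v \<le> (\<Sum>i<m. N (lam i *\<^sub>R x i))" unfolding x(1) using x by (intro N_sum) (auto simp: mem)
    also have "\<dots> \<le> (\<Sum>i<m. lam i)" using x lam by (intro sum_mono) (auto simp: scale mult_left_le)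
    finally show ?thesis using x lam by (auto simp: mem intro!: mem_sum)
  qed
  have key: "\<exists>u v. u \<in> A \<and> v \<in> A \<and> N (u - v) > 2 - \<epsilon>" if \<epsilon>: "\<epsilon> > 0" for \<epsilon>
  proof -
    define g where "g i = (if i < m then f i else (\<lambda>x. - f (i - m) x))" for i
    have "\<forall>i<m+m. g i \<in> dual_sphere S N" using f dual_sphere_minus by (auto simp: g_def)
    then obtain y where y: "\<forall>i<m+m. y i \<in> S \<and> N (y i) \<le> 1 \<and> g i (y i) > 1 - a"
      and Ny: "N (\<Sum>i<m+m. y i) > real (m + m) - \<epsilon>"
      using assms a(1) \<epsilon> unfolding slices_norm_additive_def by blast
    define z where "z i = - y (m + i)" for i
    have z: "z i \<in> S \<and> N (z i) \<le> 1 \<and> f i (z i) > 1 - \<alpha> i" if "i < m" for i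
    proof -
      have "y (m + i) \<in> S" "N (y (m + i)) \<le> 1" "- f i (y (m + i)) > 1 - a"
        using y[rule_format, of "m + i"] that by (auto simp: g_def)
      moreover have "f i (z i) = - f i (y (m + i))"
        unfolding z_def using f that \<open>y (m + i) \<in> S\<close> linear_functional_onD(4)[OF dual_sphereD(1) subsp] by blast
      ultimately show ?thesis using a(2)[OF that] by (auto simp: z_def mem N_minus)
    qed
    have y': "y i \<in> S \<and> N (y i) \<le> 1 \<and> f i (y i) > 1 - \<alpha> i" if "i < m" for i
      using y[rule_format, of i] a(2)[OF that] that by (auto simp: g_def)
    define u v where "u = (\<Sum>i<m. lam i *\<^sub>R y i)" and "v = (\<Sum>i<m. lam i *\<^sub>R z i)"
    have uv: "u \<in> A" "v \<in> A" unfolding A_def u_def v_def using y' z by blast+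
    \<comment> \<open>The full sum has norm above \<open>2 * m - \<epsilon>\<close>. The part
      \<open>r\<close> outside \<open>u - v\<close> has norm at most \<open>2 * m - 2\<close>, since
      the factors \<open>1 - lam i\<close> add up to \<open>m - 1\<close>; so more than
      \<open>2 - \<epsilon>\<close> is left for \<open>u - v\<close>. This handles arbitrary
      weights.\<close>
    define r where "r = (\<Sum>i<m. (1 - lam i) *\<^sub>R (y i - z i))"
    have "(\<Sum>i<m+m. y i) = (u - v) + r"
      unfolding sum_lessThan_add u_def v_def r_def z_def
      by (simp add: sum.distrib[symmetric] sum_subtractf[symmetric] algebra_simps)
    moreover have "r \<in> S" unfolding r_def using y' z by (auto simp: mem intro!: mem_sum)
    moreover have "u - v \<in> S" using uv A by (auto simp: mem)
    ultimately have "real (m + m) - \<epsilon> < N (u - v) + N r" using Ny triangle[of "u - v" r] by simp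
    moreover have "N r \<le> 2 * real m - 2"
    proof -
      have lam1: "lam i \<le> 1" if "i < m" for i
        using member_le_sum[of i "{..<m}" lam] lam that by simp
      have "N r \<le> (\<Sum>i<m. N ((1 - lam i) *\<^sub>R (y i - z i)))"
        unfolding r_def using y' z by (intro N_sum) (auto simp: mem)
      also have "\<dots> \<le> (\<Sum>i<m. (1 - lam i) * 2)"
      proof (intro sum_mono)
        fix i assume "i \<in> {..<m}"
        then have i: "i < m" by simp
        have "N (y i - z i) \<le> 2" using N_diff[of "y i" "z i"] y'[OF i] z[OF i] by linarith
        then have "(1 - lam i) * N (y i - z i) \<le> (1 - lam i) * 2"
          using lam1[OF i] by (intro mult_left_mono) auto
        then show "N ((1 - lam i) *\<^sub>R (y i - z i)) \<le> (1 - lam i) * 2"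
          using lam1[OF i] y'[OF i] z[OF i] by (subst scale) (auto simp: mem)
      qed
      also have "\<dots> = 2 * real m - 2" using lam by (simp add: sum_subtractf sum_distrib_right[symmetric])
      finally show ?thesis .
    qed
    ultimately show ?thesis using uv by (intro exI[of _ u] exI[of _ v]) auto
  qed
  have "Sup {N (x - y) | x y. x \<in> A \<and> y \<in> A} = 2"
  proof (rule cSup_eq_non_empty)
    show "{N (x - y) | x y. x \<in> A \<and> y \<in> A} \<noteq> {}" using key[of 1] by auto
    show "v \<le> 2" if v: "v \<in> {N (x - y) | x y. x \<in> A \<and> y \<in> A}" for v
    proof -
      obtain x y where "v = N (x - y)" "x \<in> A" "y \<in> A" using v by blast
      then show ?thesis using N_diff[of x y] A[of x] A[of y] by auto
    qed
    fix w assume w: "\<And>z. z \<in> {N (x - y) | x y. x \<in> A \<and> y \<in> A} \<Longrightarrow> z \<le> w"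
    show "2 \<le> w"
    proof (rule field_le_epsilon)
      fix e :: real assume "e > 0"
      then obtain u v where "u \<in> A" "v \<in> A" "N (u - v) > 2 - e" using key by blast
      then show "2 \<le> w + e" using w[of "N (u - v)"] by force
    qed
  qed
  then show "Sup {N (x - y) | x y.
      x \<in> {\<Sum>i<m. lam i *\<^sub>R x i | x. \<forall>i<m. x i \<in> S \<and> N (x i) \<le> 1 \<and> f i (x i) > 1 - \<alpha> i} \<and>
      y \<in> {\<Sum>i<m. lam i *\<^sub>R x i | x. \<forall>i<m. x i \<in> S \<and> N (x i) \<le> 1 \<and> f i (x i) > 1 - \<alpha> i}} = 2"
    unfolding A_def .
qed

end

text \<open>For a nonzero factor the reverse inequality follows by scaling back with the inverse;
  for the factor 0 it needs \<open>0 \<le> N 0\<close>, which the triangle inequality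
  supplies.\<close>

lemma seminormed_spaceI:
  assumes "subspace S" and tri: "\<And>x y. x \<in> S \<Longrightarrow> y \<in> S \<Longrightarrow> N (x + y) \<le> N x + N y"
    and le: "\<And>c x. x \<in> S \<Longrightarrow> N (c *\<^sub>R x) \<le> \<bar>c\<bar> * N x"
  shows "seminormed_space S N"
proof
  show "N (c *\<^sub>R x) = \<bar>c\<bar> * N x" if x: "x \<in> S" for c x
  proof (cases "c = 0")
    case True
    have "0 \<le> N 0" using tri[of 0 0] subspace_0[OF assms(1)] by simp
    then show ?thesis using True le[OF x, of 0] by simp
  next
    case False
    have "N (inverse c *\<^sub>R (c *\<^sub>R x)) \<le> \<bar>inverse c\<bar> * N (c *\<^sub>R x)"
      using x by (intro le) (simp add: subspace_scale[OF assms(1)])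
    then have "\<bar>c\<bar> * N x \<le> N (c *\<^sub>R x)" using False by (simp add: field_simps)
    then show ?thesis using le[OF x, of c] by simp
  qed
qed (use assms in auto)

section \<open>Elimination of the functionals\<close>

context seminormed_space
begin

text \<open>Choose \<open>x i\<close> deep inside the slice of \<open>f i\<close>. The functional
  sending a tuple to the sum of the \<open>f i (y i)\<close> is nearly \<open>m\<close> at
  \<open>x\<close>, hence at the approximating combination, hence at one of the combined tuples. For
  that tuple every single \<open>f i (y i)\<close> must be nearly 1.\<close>

lemma spread_tuples_dense_imp_slices_norm_additive:
  assumes Q: "Q \<subseteq> S" and dense: "\<And>s e. s \<in> S \<Longrightarrow> e > 0 \<Longrightarrow> \<exists>q\<in>Q. N (s - q) < e"
    and spread: "spread_tuples_dense Q N"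
  shows "slices_norm_additive S N"
  unfolding slices_norm_additive_def
proof (intro allI impI, elim conjE)
  fix m :: nat and f and \<alpha> \<epsilon> :: real
  assume \<alpha>: "\<alpha> > 0" and \<epsilon>: "\<epsilon> > 0" and f: "\<forall>i<m. f i \<in> dual_sphere S N"
  show "\<exists>y. (\<forall>i<m. y i \<in> S \<and> N (y i) \<le> 1 \<and> f i (y i) > 1 - \<alpha>) \<and> N (\<Sum>i<m. y i) > real m - \<epsilon>"
  proof (cases "m = 0")
    case True then show ?thesis using \<epsilon> by auto
  next
    case False
    \<comment> \<open>\<open>a \<le> 1\<close> ensures \<open>0 \<le> m - a\<close>, as the
      pigeonhole argument requires. Each index loses at most \<open>3 * d\<close>:
      \<open>2 * d\<close> in choosing \<open>x i\<close> in \<open>Q\<close>, and \<open>d\<close>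
      in replacing it by the combination; with \<open>d = a / (4 * m)\<close> the total stays below
      \<open>a\<close>.\<close>
    define a where "a = min \<alpha> 1"
    define d where "d = a / (4 * real m)"
    have a: "0 < a" "a \<le> 1" "a \<le> \<alpha>" using \<alpha> by (auto simp: a_def)
    have d: "0 < d" "real m * (3 * d) < a" using a False by (auto simp: d_def field_simps)
    have lin: "linear_functional_on S (f i)" and bound: "\<And>x. x \<in> S \<Longrightarrow> \<bar>f i x\<bar> \<le> N x"
      if "i < m" for i using dual_sphereD f that by blast+
    note L = linear_functional_onD[OF lin subsp]
    have "\<exists>q. q \<in> Q \<and> N q < 1 \<and> f i q > 1 - 2 * d" if i: "i < m" for i
    proof -
      obtain s where s: "s \<in> S" "N s < 1" "f i s > 1 - d" using dual_sphereD(3) f i d(1) by blast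
      obtain q where q: "q \<in> Q" "N (s - q) < min d (1 - N s)"
        using dense[of s "min d (1 - N s)"] s d by auto
      have "q \<in> S" using q Q by auto
      have "N q < 1" using N_diff_ge[OF \<open>q \<in> S\<close> s(1)] q N_minus[of "s - q"] \<open>q \<in> S\<close> s by (simp add: mem)
      moreover have "f i s - f i q < d"
        using L(3)[OF i s(1) \<open>q \<in> S\<close>] bound[OF i, of "s - q"] q s \<open>q \<in> S\<close> by (simp add: mem abs_le_iff)
      ultimately show ?thesis using s q by (intro exI[of _ q]) auto
    qed
    then obtain x where x: "\<forall>i<m. x i \<in> Q \<and> N (x i) < 1 \<and> f i (x i) > 1 - 2 * d" by metis
    have "min \<epsilon> d > 0" using \<epsilon> d by simp
    then obtain J :: "nat set" and t y where J: "finite J" and t: "\<forall>j\<in>J. t j \<in> \<rat> \<and> 0 \<le> t j" "sum t J \<le> 1"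
      and y: "\<forall>j\<in>J. \<forall>i<m. y j i \<in> Q \<and> N (y j i) < 1"
      and Ny: "\<forall>j\<in>J. real m - min \<epsilon> d < N (\<Sum>i<m. y j i)"
      and xy: "\<forall>i<m. N (x i - (\<Sum>j\<in>J. t j *\<^sub>R y j i)) < min \<epsilon> d"
      using spread[unfolded spread_tuples_dense_def, rule_format, of "min \<epsilon> d" m x] x by blast
    have yS: "y j i \<in> S" if "j \<in> J" "i < m" for i j using y Q that by blast
    define w where "w j = (\<Sum>i<m. f i (y j i))" for j
    have "real m - a < (\<Sum>i<m. 1 - 3 * d)" using d by (simp add: right_diff_distrib)
    also have "\<dots> \<le> (\<Sum>i<m. f i (\<Sum>j\<in>J. t j *\<^sub>R y j i))"
    proof (intro sum_mono)
      fix i assume "i \<in> {..<m}"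
      then have i: "i < m" by simp
      have k: "(\<Sum>j\<in>J. t j *\<^sub>R y j i) \<in> S" using yS i by (auto simp: mem intro!: mem_sum)
      have "x i \<in> S" using x i Q by auto
      have "f i (x i) - f i (\<Sum>j\<in>J. t j *\<^sub>R y j i) < d"
        using L(3)[OF i \<open>x i \<in> S\<close> k] bound[OF i, of "x i - (\<Sum>j\<in>J. t j *\<^sub>R y j i)"] xy i k \<open>x i \<in> S\<close>
        by (force simp: mem)
      then show "1 - 3 * d \<le> f i (\<Sum>j\<in>J. t j *\<^sub>R y j i)" using x i by force
    qed
    also have "\<dots> = (\<Sum>i<m. \<Sum>j\<in>J. t j * f i (y j i))"
    proof (intro sum.cong refl)
      fix i assume "i \<in> {..<m}"
      then have i: "i < m" by simp
      show "f i (\<Sum>j\<in>J. t j *\<^sub>R y j i) = (\<Sum>j\<in>J. t j * f i (y j i))"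
        using yS[OF _ i] by (subst L(6)[OF i J]) (auto simp: mem L(2)[OF i])
    qed
    also have "\<dots> = (\<Sum>j\<in>J. t j * w j)" by (subst sum.swap) (simp add: w_def sum_distrib_left)
    finally have big: "real m - a < (\<Sum>j\<in>J. t j * w j)" .
    have "\<exists>j\<in>J. real m - a < w j"
      using t a False big by (intro subconvex_pigeonhole[of J t]) auto
    then obtain j where j: "j \<in> J" "w j > real m - a" by blast
    have "f i (y j i) > 1 - a" if "i < m" for i
      using bound yS[OF j(1)] y j that
      by (intro sum_near_max[where c = "\<lambda>i. f i (y j i)" and m = m]) (force simp: w_def)+
    then show ?thesis
      using yS[OF j(1)] y Ny j a by (intro exI[of _ "y j"]) fastforce
  qed
qed

text \<open>If \<open>x\<close> were far from the hull, the Hahn--Banach theorem applied to the functional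
  \<open>p u = inf {r + M (u - r k) / e | r \<ge> 0, k \<in> K}\<close>, which is at most 1 on \<open>D\<close> and at least 1 at \<open>x\<close>,
  would give functionals \<open>G i\<close> whose norms sum to more than 1 because \<open>N (x i) < 1\<close>. But by assumption
  some \<open>y \<in> D\<close> almost attains all these norms simultaneously.\<close>

lemma slices_norm_additive_imp_hull:
  fixes m :: nat
  assumes add: "slices_norm_additive S N" and x: "\<And>i. i < m \<Longrightarrow> x i \<in> S \<and> N (x i) < 1" and e: "e > 0"
  defines "D \<equiv> {y. (\<forall>i. y i \<in> S) \<and> (\<forall>i<m. N (y i) \<le> 1) \<and> N (\<Sum>i<m. y i) > real m - e}"
  shows "\<exists>k\<in>convex hull (insert 0 D). \<forall>i<m. N (x i - k i) < e"
proof (rule ccontr)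
  assume contra: "\<not> ?thesis"
  define K where "K = convex hull (insert 0 D)"
  define T where "T = {u :: nat \<Rightarrow> 'a. \<forall>i. u i \<in> S}"
  \<comment> \<open>The 1-norm of a tuple dominates the norm of every coordinate, so being far in
    one coordinate means being far in \<open>M\<close>.\<close>
  define M where "M u = (\<Sum>i<m. N (u i))" for u
  have T: "subspace T" by (auto simp: subspace_def T_def mem)
  have "insert 0 D \<subseteq> T" by (auto simp: D_def T_def mem)
  then have KT: "K \<subseteq> T" unfolding K_def by (rule hull_minimal) (rule subspace_imp_convex[OF T])
  have K0: "0 \<in> K" unfolding K_def by (rule hull_inc) simp
  have convK: "convex K" unfolding K_def by simp
  have M_nonneg: "0 \<le> M u" if "u \<in> T" for u
    using that by (auto simp: M_def T_def intro!: sum_nonneg N_nonneg)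
  have M_add: "M (u + v) \<le> M u + M v" if "u \<in> T" "v \<in> T" for u v
    using that by (auto simp: M_def T_def sum.distrib[symmetric] intro!: sum_mono triangle)
  have M_scale: "M (c *\<^sub>R u) = \<bar>c\<bar> * M u" if "u \<in> T" for u c
    using that by (simp add: M_def T_def scale sum_distrib_left)
  define V where "V u = {r + M (u - r *\<^sub>R k) / e | r k. 0 \<le> r \<and> k \<in> K}" for u
  define p where "p u = Inf (V u)" for u
  have inT: "u - r *\<^sub>R k \<in> T" if "u \<in> T" "k \<in> K" for u r k
    using that KT T by (auto intro: subspace_diff subspace_scale)
  have V_nonneg: "0 \<le> v" if "u \<in> T" "v \<in> V u" for u v
    using that e M_nonneg[OF inT] by (auto simp: V_def)
  have bdd: "bdd_below (V u)" if "u \<in> T" for u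
    using V_nonneg[OF that] by (meson bdd_belowI)
  have upper: "p u \<le> r + M (u - r *\<^sub>R k) / e" if "u \<in> T" "0 \<le> r" "k \<in> K" for u r k
    unfolding p_def using bdd that by (intro cInf_lower) (auto simp: V_def)
  have V_ne: "V u \<noteq> {}" for u using K0 unfolding V_def by blast
  have approx: "\<exists>r k. 0 \<le> r \<and> k \<in> K \<and> r + M (u - r *\<^sub>R k) / e < p u + d" if "d > 0" for u d
  proof -
    have "Inf (V u) < p u + d" using that by (simp add: p_def)
    then obtain v where "v \<in> V u" "v < p u + d" using cInf_lessD[OF V_ne] by blast
    then show ?thesis unfolding V_def by blast
  qed
  have "sublinear_on T p"
    unfolding sublinear_on_def
  proof (intro conjI ballI allI impI)
    fix u v assume uv: "u \<in> T" "v \<in> T"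
    show "p (u + v) \<le> p u + p v"
    proof (rule field_le_epsilon)
      fix d :: real assume "d > 0"
      then obtain r k s l where r: "0 \<le> r" "k \<in> K" "r + M (u - r *\<^sub>R k) / e < p u + d / 2"
        and s: "0 \<le> s" "l \<in> K" "s + M (v - s *\<^sub>R l) / e < p v + d / 2"
        using approx[of "d / 2" u] approx[of "d / 2" v] by (auto simp del: times_divide_eq_right)
      \<comment> \<open>Convexity of \<open>K\<close> merges the two witnesses: \<open>h\<close> is
        their average with weights proportional to \<open>r\<close> and \<open>s\<close>.\<close>
      obtain h where h: "h \<in> K" "(r + s) *\<^sub>R h = r *\<^sub>R k + s *\<^sub>R l"
      proof (cases "r + s = 0")
        case True
        then have "r = 0" "s = 0" using r s by auto
        then show ?thesis using that[OF K0] by simp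
      next
        case False
        show ?thesis
        proof (rule that)
          show "(r / (r + s)) *\<^sub>R k + (s / (r + s)) *\<^sub>R l \<in> K"
            using r s False by (intro convexD[OF convK]) (auto simp: add_divide_distrib[symmetric])
          show "(r + s) *\<^sub>R ((r / (r + s)) *\<^sub>R k + (s / (r + s)) *\<^sub>R l) = r *\<^sub>R k + s *\<^sub>R l"
            using False by (simp add: scaleR_add_right del: scaleR_left_distrib)
        qed
      qed
      have "p (u + v) \<le> (r + s) + M ((u + v) - (r + s) *\<^sub>R h) / e"
        using uv r s h T by (intro upper) (auto intro: subspace_add)
      also have "(u + v) - (r + s) *\<^sub>R h = (u - r *\<^sub>R k) + (v - s *\<^sub>R l)" unfolding h(2) by simp
      also have "M \<dots> / e \<le> (M (u - r *\<^sub>R k) + M (v - s *\<^sub>R l)) / e"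
        using uv r s e by (intro divide_right_mono M_add inT) auto
      finally show "p (u + v) \<le> p u + p v + d"
        using r s unfolding add_divide_distrib by linarith
    qed
  next
    fix c :: real and u assume c: "c > 0" and u: "u \<in> T"
    show "p (c *\<^sub>R u) \<le> c * p u"
    proof (rule field_le_epsilon)
      fix d :: real assume "d > 0"
      then obtain r k where r: "0 \<le> r" "k \<in> K" "r + M (u - r *\<^sub>R k) / e < p u + d / c"
        using approx[of "d / c" u] c by auto
      have "p (c *\<^sub>R u) \<le> c * r + M (c *\<^sub>R u - (c * r) *\<^sub>R k) / e"
        using u r c T by (intro upper) (auto intro: subspace_scale)
      also have "c *\<^sub>R u - (c * r) *\<^sub>R k = c *\<^sub>R (u - r *\<^sub>R k)" by (simp add: scaleR_diff_right)
      also have "M \<dots> = c * M (u - r *\<^sub>R k)" using M_scale[OF inT] u r c by simp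
      also have "c * r + c * M (u - r *\<^sub>R k) / e = c * (r + M (u - r *\<^sub>R k) / e)"
        by (simp add: algebra_simps)
      also have "\<dots> \<le> c * (p u + d / c)" using r c by (intro mult_left_mono) auto
      also have "\<dots> = c * p u + d" using c by (simp add: distrib_left)
      finally show "p (c *\<^sub>R u) \<le> c * p u + d" .
    qed
  qed
  define x' where "x' i = (if i < m then x i else 0)" for i
  have x'T: "x' \<in> T" using x by (auto simp: x'_def T_def mem)
  have px: "1 \<le> p x'"
    unfolding p_def
  proof (rule cInf_greatest[OF V_ne])
    fix v assume "v \<in> V x'"
    then obtain r k where v: "v = r + M (x' - r *\<^sub>R k) / e" "0 \<le> r" "k \<in> K" unfolding V_def by blast
    have M0: "0 \<le> M (x' - r *\<^sub>R k) / e" using M_nonneg[OF inT[OF x'T v(3)]] e by simp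
    show "1 \<le> v"
    proof (cases "r \<ge> 1")
      case True then show ?thesis using v M0 by linarith
    next
      case False
      \<comment> \<open>As 0 belongs to \<open>K\<close>, the vector \<open>r k\<close> lies in
        \<open>K\<close> again and is therefore at distance at least \<open>e\<close> from
        \<open>x\<close> in some coordinate.\<close>
      have "r *\<^sub>R k + (1 - r) *\<^sub>R 0 \<in> K" using False v K0 by (intro convexD[OF convK]) auto
      then obtain i where i: "i < m" "N (x i - (r *\<^sub>R k) i) \<ge> e"
        using contra by (force simp: K_def not_less)
      have "N ((x' - r *\<^sub>R k) i) \<le> M (x' - r *\<^sub>R k)"
        unfolding M_def using i inT[OF x'T v(3)] by (intro member_le_sum) (auto simp: T_def intro!: N_nonneg)
      then have "e \<le> M (x' - r *\<^sub>R k)" using i by (simp add: x'_def)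
      then have "1 \<le> M (x' - r *\<^sub>R k) / e" using e by simp
      then show ?thesis using v by linarith
    qed
  qed
  obtain F where F: "linear_functional_on T F" and Fp: "\<And>u. u \<in> T \<Longrightarrow> F u \<le> p u" and Fx: "F x' = p x'"
    using hahn_banach_sublinear[OF T \<open>sublinear_on T p\<close> x'T] by blast
  note FL = linear_functional_onD[OF F T]
  have p_le: "p u \<le> M u / e" if "u \<in> T" for u using upper[OF that, of 0 0] K0 by simp
  define E where "E i v = (\<lambda>j. if j = i then v else (0::'a))" for i :: nat and v
  have ET: "E i v \<in> T" if "v \<in> S" for i v using that by (auto simp: E_def T_def mem)
  have ME: "M (E i v) = N v" if "i < m" for i v
    using that by (simp add: M_def E_def if_distrib[of N] cong: if_cong)
  define G where "G i v = F (E i v)" for i v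
  have lin: "linear_functional_on S (G i)" for i
    unfolding linear_functional_on_def
  proof (intro conjI ballI allI)
    fix u v assume uv: "u \<in> S" "v \<in> S"
    have "E i (u + v) = E i u + E i v" by (auto simp: E_def fun_eq_iff)
    then show "G i (u + v) = G i u + G i v" using FL(1) ET uv by (simp add: G_def)
  next
    fix c u assume u: "u \<in> S"
    have "E i (c *\<^sub>R u) = c *\<^sub>R E i u" by (auto simp: E_def fun_eq_iff)
    then show "G i (c *\<^sub>R u) = c * G i u" using FL(2) ET u by (simp add: G_def)
  qed
  have bound: "\<bar>G i v\<bar> \<le> (1 / e) * N v" if "i < m" "v \<in> S" for i v
  proof -
    have 1: "G i w \<le> N w / e" if "w \<in> S" for w
      using Fp[OF ET[OF that]] p_le[OF ET[OF that]] ME[OF \<open>i < m\<close>] unfolding G_def by (metis order_trans)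
    have "G i (- v) = - G i v" using linear_functional_onD(4)[OF lin subsp] that by blast
    then show ?thesis using 1[of v] 1[of "- v"] that N_minus[of v] by (auto simp: mem abs_le_iff)
  qed
  have decomp: "F u = (\<Sum>i<m. G i (u i))" if u: "u \<in> T" for u
  proof -
    define u' where "u' = (\<Sum>i<m. E i (u i))"
    have u'T: "u' \<in> T" unfolding u'_def using u by (intro subspace_sum[OF T] ET) (auto simp: T_def)
    have u'i: "u' i = u i" if "i < m" for i
      unfolding u'_def using that by (simp add: E_def sum_fun_apply)
    \<comment> \<open>Tuples are indexed by all natural numbers, but \<open>M\<close> sees only the
      first \<open>m\<close> entries; being dominated by \<open>M / e\<close>, the functional
      \<open>F\<close> ignores the others.\<close>
    have Fz: "F v \<le> 0" if "v \<in> T" "\<And>i. i < m \<Longrightarrow> v i = 0" for v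
      using Fp[OF that(1)] p_le[OF that(1)] that(2) by (simp add: M_def)
    have "F (u - u') \<le> 0" "F (u' - u) \<le> 0"
      using u'i u u'T T by (auto intro!: Fz subspace_diff)
    then have "F u = F u'" using FL(3)[OF u u'T] FL(3)[OF u'T u] by simp
    also have "\<dots> = (\<Sum>i<m. G i (u i))"
      unfolding u'_def G_def using u by (intro FL(6) ET) (auto simp: T_def)
    finally show ?thesis .
  qed
  define c where "c i = Sup ((\<lambda>x. \<bar>G i x\<bar>) ` {x \<in> S. N x \<le> 1})" for i
  have c0: "0 \<le> c i" and cN: "\<And>v. v \<in> S \<Longrightarrow> \<bar>G i v\<bar> \<le> c i * N v"
    and csph: "c i > 0 \<Longrightarrow> (\<lambda>x. G i x / c i) \<in> dual_sphere S N" if "i < m" for i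
    using functional_normalisable[OF lin bound] that unfolding c_def by blast+
  have Fx1: "1 \<le> (\<Sum>i<m. G i (x i))" using decomp[OF x'T] px Fx by (simp add: x'_def)
  have le: "G i (x i) \<le> c i * N (x i)" if "i < m" for i
    using cN[OF that, of "x i"] x[OF that] by auto
  have "\<exists>i<m. c i > 0"
  proof (rule ccontr)
    assume *: "\<not> ?thesis"
    have "G i (x i) \<le> 0" if "i < m" for i
    proof -
      have "c i = 0" using * c0[OF that] that by (meson order.antisym not_less)
      then show ?thesis using le[OF that] by simp
    qed
    then have "(\<Sum>i<m. G i (x i)) \<le> 0" by (intro sum_nonpos) auto
    then show False using Fx1 by simp
  qed
  then obtain i0 where i0: "i0 < m" "c i0 > 0" by blast
  define C where "C = (\<Sum>i<m. c i)"
  have "(\<Sum>i<m. G i (x i)) < C"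
    unfolding C_def
  proof (rule sum_strict_mono_ex1)
    show "\<forall>i\<in>{..<m}. G i (x i) \<le> c i"
    proof
      fix i assume "i \<in> {..<m}"
      then have i: "i < m" by simp
      have "c i * N (x i) \<le> c i * 1" using c0[OF i] x[OF i] by (intro mult_left_mono) auto
      then show "G i (x i) \<le> c i" using le[OF i] by simp
    qed
    have "G i0 (x i0) < c i0 * 1"
      using i0 x[OF i0(1)] by (intro le_less_trans[OF le[OF i0(1)]] mult_strict_left_mono) auto
    then show "\<exists>i\<in>{..<m}. G i (x i) < c i" using i0 by auto
  qed simp
  then have C1: "1 < C" using Fx1 by simp
  \<comment> \<open>With this choice \<open>C * (1 - a) = (C + 1) / 2\<close>, which exceeds
    1.\<close>
  define a where "a = (C - 1) / (2 * C)"
  have a: "0 < a" "C * (1 - a) > 1" using C1 by (auto simp: a_def field_simps)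
  \<comment> \<open>A functional of norm one is required at every index. Where
    \<open>c i = 0\<close> the normalised \<open>G i0\<close> stands in; such an index contributes 0
    to both sides of the final estimate.\<close>
  define g where "g i = (if c i > 0 then (\<lambda>v. G i v / c i) else (\<lambda>v. G i0 v / c i0))" for i
  have "\<forall>i<m. g i \<in> dual_sphere S N" using csph i0 by (auto simp: g_def)
  then obtain y where y: "\<forall>i<m. y i \<in> S \<and> N (y i) \<le> 1 \<and> g i (y i) > 1 - a"
    and Ny: "N (\<Sum>i<m. y i) > real m - e"
    using add a(1) e unfolding slices_norm_additive_def by blast
  define y' where "y' i = (if i < m then y i else 0)" for i
  have y'D: "y' \<in> D" using y Ny by (auto simp: D_def y'_def mem)
  then have y'T: "y' \<in> T" and y'K: "y' \<in> K" by (auto simp: D_def T_def K_def intro: hull_inc)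
  have "F y' \<le> 1" using Fp[OF y'T] upper[OF y'T, of 1 y'] y'K by (simp add: M_def)
  moreover have "C * (1 - a) \<le> F y'"
  proof -
    have "C * (1 - a) = (\<Sum>i<m. c i * (1 - a))" by (simp add: C_def sum_distrib_right)
    also have "\<dots> \<le> (\<Sum>i<m. G i (y i))"
    proof (intro sum_mono)
      fix i assume "i \<in> {..<m}"
      then have i: "i < m" by simp
      show "c i * (1 - a) \<le> G i (y i)"
      proof (cases "c i > 0")
        case True
        then have "1 - a < G i (y i) / c i" using y i by (auto simp: g_def)
        then show ?thesis using True by (simp add: field_simps)
      next
        case False
        then have "c i = 0" using c0[OF i] by simp
        then show ?thesis using cN[OF i, of "y i"] y i by auto
      qed
    qed
    also have "\<dots> = F y'" using decomp[OF y'T] by (simp add: y'_def)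
    finally show ?thesis .
  qed
  ultimately show False using a by simp
qed

text \<open>The hull lemma gives a combination with real coefficients of tuples in the closed ball.
  All its conditions have room, so the vectors can be moved into \<open>Q\<close> and the open ball,
  and the coefficients rounded down to rationals without raising their sum.\<close>

lemma slices_norm_additive_imp_spread_tuples_dense:
  assumes Q: "Q \<subseteq> S" and dense: "\<And>s e. s \<in> S \<Longrightarrow> e > 0 \<Longrightarrow> \<exists>q\<in>Q. N (s - q) < e"
    and add: "slices_norm_additive S N"
  shows "spread_tuples_dense Q N"
  unfolding spread_tuples_dense_def
proof (intro allI impI, elim conjE)
  fix m :: nat and x and \<epsilon> :: real
  assume \<epsilon>: "\<epsilon> > 0" and x: "\<forall>i<m. x i \<in> Q \<and> N (x i) < 1"
  have xS: "x i \<in> S" if "i < m" for i using x Q that by auto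
  define D where "D = {y. (\<forall>i. y i \<in> S) \<and> (\<forall>i<m. N (y i) \<le> 1) \<and> N (\<Sum>i<m. y i) > real m - \<epsilon> / 2}"
  have "\<exists>k\<in>convex hull (insert 0 D). \<forall>i<m. N (x i - k i) < \<epsilon> / 2"
    unfolding D_def using x xS \<epsilon> by (intro slices_norm_additive_imp_hull[OF add]) auto
  then obtain k where "k \<in> convex hull (insert 0 D)" and xk: "\<And>i. i < m \<Longrightarrow> N (x i - k i) < \<epsilon> / 2" by blast
  then obtain n u z where u: "\<forall>j\<in>{1::nat..n}. 0 \<le> u j \<and> z j \<in> insert 0 D" "sum u {1..n} = 1"
    and k: "(\<Sum>j = 1..n. u j *\<^sub>R z j) = k"
    unfolding convex_hull_indexed by blast
  \<comment> \<open>Indices outside \<open>J\<close> carry the vector 0; dropping them turns the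
    convex combination into a subconvex one.\<close>
  define J where "J = {j \<in> {1..n}. z j \<in> D}"
  have J: "finite J" by (simp add: J_def)
  have u0: "0 \<le> u j" if "j \<in> J" for j using u that by (auto simp: J_def)
  have uJ: "sum u J \<le> 1" unfolding u(2)[symmetric] using u(1) by (intro sum_mono2) (auto simp: J_def)
  have kJ: "k = (\<Sum>j\<in>J. u j *\<^sub>R z j)"
    unfolding k[symmetric] J_def using u by (intro sum.mono_neutral_right) auto
  have zS: "z j i \<in> S" if "j \<in> J" for i j using that by (simp add: J_def D_def)
  have zN: "N (z j i) \<le> 1" if "j \<in> J" "i < m" for i j using that by (simp add: J_def D_def)
  have zD: "N (\<Sum>i<m. z j i) > real m - \<epsilon> / 2" if "j \<in> J" for j using that by (simp add: J_def D_def)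
  \<comment> \<open>The norm of a sum of \<open>m\<close> vectors drops by at most
    \<open>m * \<eta>\<close>, and the combination moves by at most \<open>2 * \<eta>\<close>; both
    must fit into the remaining \<open>\<epsilon> / 2\<close>.\<close>
  define \<eta> where "\<eta> = min (1 / 2) (\<epsilon> / (4 * (real m + 1)))"
  have \<eta>: "0 < \<eta>" "\<eta> \<le> 1 / 2" using \<epsilon> by (simp_all add: \<eta>_def min_def)
  have "(real m + 1) * \<eta> \<le> (real m + 1) * (\<epsilon> / (4 * (real m + 1)))"
    by (intro mult_left_mono) (auto simp: \<eta>_def)
  also have "\<dots> = \<epsilon> / 4" by (simp add: field_simps)
  finally have m\<eta>: "real m * \<eta> + \<eta> \<le> \<epsilon> / 4" by (simp add: algebra_simps)
  have "\<exists>q. q \<in> Q \<and> N q < 1 \<and> N (s - q) < \<eta>" if s: "s \<in> S" "N s \<le> 1" for s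
  proof -
    \<comment> \<open>Shrinking first by the factor \<open>1 - \<eta> / 2\<close> leaves room for an
      approximation within \<open>\<eta> / 2\<close> that stays in the open ball.\<close>
    define s' where "s' = (1 - \<eta> / 2) *\<^sub>R s"
    have s': "s' \<in> S" using s by (simp add: s'_def mem)
    obtain q where q: "q \<in> Q" "N (s' - q) < \<eta> / 2" using dense[OF s', of "\<eta> / 2"] \<eta> by auto
    have qS: "q \<in> S" using q Q by auto
    have "(1 - \<eta> / 2) * N s \<le> (1 - \<eta> / 2) * 1" using s \<eta> by (intro mult_left_mono) auto
    then have "N s' \<le> 1 - \<eta> / 2" using scale[OF s(1), of "1 - \<eta> / 2"] \<eta> by (simp add: s'_def)
    moreover have "N q \<le> N s' + N (s' - q)" using N_diff[of s' "s' - q"] s' qS by (simp add: mem)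
    ultimately have "N q < 1" using q by linarith
    moreover have "N (s - q) \<le> N (s - s') + N (s' - q)"
      using triangle[of "s - s'" "s' - q"] s s' qS by (simp add: mem)
    moreover have "N (s - s') \<le> \<eta> / 2"
    proof -
      have "s - s' = (\<eta> / 2) *\<^sub>R s" by (simp add: s'_def scaleR_diff_left)
      then have "N (s - s') = (\<eta> / 2) * N s" using scale[OF s(1), of "\<eta> / 2"] \<eta> by simp
      also have "\<dots> \<le> (\<eta> / 2) * 1" using s \<eta> by (intro mult_left_mono) auto
      finally show ?thesis by simp
    qed
    ultimately show ?thesis using q by (intro exI[of _ q]) auto
  qed
  then have "\<forall>j i. \<exists>q. j \<in> J \<and> i < m \<longrightarrow> q \<in> Q \<and> N q < 1 \<and> N (z j i - q) < \<eta>" using zS zN by blast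
  then obtain y where y: "\<And>j i. j \<in> J \<Longrightarrow> i < m \<Longrightarrow> y j i \<in> Q \<and> N (y j i) < 1 \<and> N (z j i - y j i) < \<eta>"
    by metis
  have yS: "y j i \<in> S" if "j \<in> J" "i < m" for i j using y[OF that] Q by auto
  \<comment> \<open>Rounding each coefficient by at most \<open>\<theta>\<close> costs less than
    \<open>\<eta>\<close> in total.\<close>
  define \<theta> where "\<theta> = \<eta> / (real (card J) + 1)"
  have \<theta>: "0 < \<theta>" "real (card J) * \<theta> < \<eta>" using \<eta> by (auto simp: \<theta>_def field_simps)
  have "\<exists>r. r \<in> \<rat> \<and> 0 \<le> r \<and> r \<le> v \<and> v - r \<le> \<theta>" if "0 \<le> v" for v
  proof (cases "v = 0")
    case True then show ?thesis using \<theta> by (intro exI[of _ 0]) auto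
  next
    case False
    then have "max 0 (v - \<theta>) < v" using that \<theta> by auto
    then obtain r where "r \<in> \<rat>" "max 0 (v - \<theta>) < r" "r < v"
      using Rats_dense_in_real by blast
    then show ?thesis by (intro exI[of _ r]) auto
  qed
  then have "\<forall>j. \<exists>r. j \<in> J \<longrightarrow> r \<in> \<rat> \<and> 0 \<le> r \<and> r \<le> u j \<and> u j - r \<le> \<theta>" using u0 by blast
  then obtain t where t: "\<And>j. j \<in> J \<Longrightarrow> t j \<in> \<rat> \<and> 0 \<le> t j \<and> t j \<le> u j \<and> u j - t j \<le> \<theta>" by metis
  have tJ: "sum t J \<le> 1" using sum_mono[of J t u] t uJ by force
  have Ny: "real m - \<epsilon> < N (\<Sum>i<m. y j i)" if j: "j \<in> J" for j
  proof -
    have "N (\<Sum>i<m. z j i) - N (\<Sum>i<m. y j i) \<le> N ((\<Sum>i<m. z j i) - (\<Sum>i<m. y j i))"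
      using zS yS j by (intro N_diff_ge) (auto intro!: mem_sum)
    also have "\<dots> = N (\<Sum>i<m. z j i - y j i)" by (simp add: sum_subtractf)
    also have "\<dots> \<le> (\<Sum>i<m. N (z j i - y j i))"
      using zS yS j by (intro N_sum) (auto simp: mem)
    also have "\<dots> \<le> (\<Sum>i<m. \<eta>)" using y j by (intro sum_mono) force
    finally have "N (\<Sum>i<m. z j i) - N (\<Sum>i<m. y j i) \<le> real m * \<eta>" by simp
    then show ?thesis using zD[OF j] m\<eta> \<eta> \<epsilon> by linarith
  qed
  have Nx: "N (x i - (\<Sum>j\<in>J. t j *\<^sub>R y j i)) < \<epsilon>" if i: "i < m" for i
  proof -
    have ki: "k i \<in> S" unfolding kJ using zS by (auto simp: sum_fun_apply mem intro!: mem_sum)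
    have yi: "(\<Sum>j\<in>J. t j *\<^sub>R y j i) \<in> S" using yS i by (auto simp: mem intro!: mem_sum)
    have "k i - (\<Sum>j\<in>J. t j *\<^sub>R y j i) = (\<Sum>j\<in>J. (u j - t j) *\<^sub>R z j i + t j *\<^sub>R (z j i - y j i))"
      unfolding kJ by (simp add: sum_fun_apply sum_subtractf[symmetric] algebra_simps)
    also have "N \<dots> \<le> (\<Sum>j\<in>J. N ((u j - t j) *\<^sub>R z j i + t j *\<^sub>R (z j i - y j i)))"
      using zS yS i by (intro N_sum) (auto simp: mem)
    also have "\<dots> \<le> (\<Sum>j\<in>J. \<theta> + t j * \<eta>)"
    proof (intro sum_mono)
      fix j assume j: "j \<in> J"
      have "N ((u j - t j) *\<^sub>R z j i + t j *\<^sub>R (z j i - y j i)) \<le> (u j - t j) * N (z j i) + t j * N (z j i - y j i)"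
        using triangle[of "(u j - t j) *\<^sub>R z j i" "t j *\<^sub>R (z j i - y j i)"] zS[OF j] yS[OF j i] t[OF j]
        by (simp add: mem scale)
      also have "\<dots> \<le> (u j - t j) * 1 + t j * \<eta>"
        using t[OF j] zN[OF j i] y[OF j i] by (intro add_mono mult_left_mono) auto
      also have "\<dots> \<le> \<theta> + t j * \<eta>" using t[OF j] by simp
      finally show "N ((u j - t j) *\<^sub>R z j i + t j *\<^sub>R (z j i - y j i)) \<le> \<theta> + t j * \<eta>" .
    qed
    also have "\<dots> = real (card J) * \<theta> + sum t J * \<eta>" by (simp add: sum.distrib sum_distrib_right)
    also have "\<dots> \<le> \<eta> + 1 * \<eta>" using \<theta> tJ \<eta> by (intro add_mono mult_right_mono) auto
    finally have "N (k i - (\<Sum>j\<in>J. t j *\<^sub>R y j i)) \<le> 2 * \<eta>" by simp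
    moreover have "N (x i - (\<Sum>j\<in>J. t j *\<^sub>R y j i)) \<le> N (x i - k i) + N (k i - (\<Sum>j\<in>J. t j *\<^sub>R y j i))"
      using triangle[of "x i - k i" "k i - (\<Sum>j\<in>J. t j *\<^sub>R y j i)"] xS[OF i] ki yi by (simp add: mem)
    moreover have "\<eta> \<le> \<epsilon> / 4" using m\<eta> \<eta> by (smt (verit) mult_nonneg_nonneg of_nat_0_le_iff)
    ultimately show ?thesis using xk[OF i] by linarith
  qed
  show "\<exists>(J::nat set) t y. finite J \<and> (\<forall>j\<in>J. t j \<in> \<rat> \<and> 0 \<le> t j) \<and> sum t J \<le> 1 \<and>
           (\<forall>j\<in>J. \<forall>i<m. y j i \<in> Q \<and> N (y j i) < 1) \<and>
           (\<forall>j\<in>J. real m - \<epsilon> < N (\<Sum>i<m. y j i)) \<and>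
           (\<forall>i<m. N (x i - (\<Sum>j\<in>J. t j *\<^sub>R y j i)) < \<epsilon>)"
    using J t tJ y Ny Nx by (intro exI[of _ J] exI[of _ t] exI[of _ y]) simp
qed

theorem strong_diameter_two_iff_spread_tuples_dense:
  assumes "Q \<subseteq> S" and "\<And>s e. s \<in> S \<Longrightarrow> e > 0 \<Longrightarrow> \<exists>q\<in>Q. N (s - q) < e"
  shows "strong_diameter_two S N \<longleftrightarrow> spread_tuples_dense Q N"
  using strong_diameter_two_imp_slices_norm_additive slices_norm_additive_imp_strong_diameter_two
    slices_norm_additive_imp_spread_tuples_dense[OF assms]
    spread_tuples_dense_imp_slices_norm_additive[OF assms]
  by blast

end

text \<open>Applied to the embedding of c00 into the completion by constant sequences.\<close>

lemma spread_tuples_dense_image: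
  assumes "linear j"
  shows "spread_tuples_dense (j ` Q) N \<longleftrightarrow> spread_tuples_dense Q (\<lambda>x. N (j x))"
proof -
  have j: "j (x - (\<Sum>k\<in>J. t k *\<^sub>R y k)) = j x - (\<Sum>k\<in>J. t k *\<^sub>R j (y k))"
    "j (\<Sum>k\<in>J. y k) = (\<Sum>k\<in>J. j (y k))" for x y and t :: "nat \<Rightarrow> real" and J :: "nat set"
    using assms by (simp_all add: linear_diff linear_sum linear_scale)
  show ?thesis
    unfolding spread_tuples_dense_def
  proof (intro iffI allI impI; elim conjE)
    fix m :: nat and x and \<epsilon> :: real
    assume H: "\<forall>m x \<epsilon>. 0 < \<epsilon> \<and> (\<forall>i<m. x i \<in> j ` Q \<and> N (x i) < 1) \<longrightarrow>
      (\<exists>(J::nat set) t y. finite J \<and> (\<forall>j\<in>J. t j \<in> \<rat> \<and> 0 \<le> t j) \<and> sum t J \<le> 1 \<and>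
        (\<forall>k\<in>J. \<forall>i<m. y k i \<in> j ` Q \<and> N (y k i) < 1) \<and>
        (\<forall>j\<in>J. real m - \<epsilon> < N (\<Sum>i<m. y j i)) \<and>
        (\<forall>i<m. N (x i - (\<Sum>j\<in>J. t j *\<^sub>R y j i)) < \<epsilon>))"
      and \<epsilon>: "0 < \<epsilon>" and x: "\<forall>i<m. x i \<in> Q \<and> N (j (x i)) < 1"
    obtain J :: "nat set" and t y where J: "finite J" "\<forall>j\<in>J. t j \<in> \<rat> \<and> 0 \<le> t j" "sum t J \<le> 1"
      and y: "\<forall>k\<in>J. \<forall>i<m. y k i \<in> j ` Q \<and> N (y k i) < 1"
      and Ny: "\<forall>j\<in>J. real m - \<epsilon> < N (\<Sum>i<m. y j i)"
      and Nx: "\<forall>i<m. N (j (x i) - (\<Sum>j\<in>J. t j *\<^sub>R y j i)) < \<epsilon>"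
      using H[rule_format, of \<epsilon> m "\<lambda>i. j (x i)"] \<epsilon> x by blast
    have "\<forall>k i. \<exists>v. k \<in> J \<and> i < m \<longrightarrow> v \<in> Q \<and> y k i = j v" using y by blast
    then obtain y' where y': "\<And>k i. k \<in> J \<Longrightarrow> i < m \<Longrightarrow> y' k i \<in> Q \<and> y k i = j (y' k i)" by metis
    show "\<exists>(J::nat set) t y. finite J \<and> (\<forall>j\<in>J. t j \<in> \<rat> \<and> 0 \<le> t j) \<and> sum t J \<le> 1 \<and>
        (\<forall>k\<in>J. \<forall>i<m. y k i \<in> Q \<and> N (j (y k i)) < 1) \<and>
        (\<forall>k\<in>J. real m - \<epsilon> < N (j (\<Sum>i<m. y k i))) \<and>
        (\<forall>i<m. N (j (x i - (\<Sum>j\<in>J. t j *\<^sub>R y j i))) < \<epsilon>)"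
    proof (intro exI conjI)
      show "\<forall>k\<in>J. real m - \<epsilon> < N (j (\<Sum>i<m. y' k i))" using Ny y' by (simp add: j)
      show "\<forall>i<m. N (j (x i - (\<Sum>j\<in>J. t j *\<^sub>R y' j i))) < \<epsilon>" using Nx y' by (simp add: j)
      show "\<forall>k\<in>J. \<forall>i<m. y' k i \<in> Q \<and> N (j (y' k i)) < 1" using y y' by auto
    qed (use J in auto)
  next
    fix m :: nat and x and \<epsilon> :: real
    assume H: "\<forall>m x \<epsilon>. 0 < \<epsilon> \<and> (\<forall>i<m. x i \<in> Q \<and> N (j (x i)) < 1) \<longrightarrow>
      (\<exists>(J::nat set) t y. finite J \<and> (\<forall>j\<in>J. t j \<in> \<rat> \<and> 0 \<le> t j) \<and> sum t J \<le> 1 \<and>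
        (\<forall>k\<in>J. \<forall>i<m. y k i \<in> Q \<and> N (j (y k i)) < 1) \<and>
        (\<forall>k\<in>J. real m - \<epsilon> < N (j (\<Sum>i<m. y k i))) \<and>
        (\<forall>i<m. N (j (x i - (\<Sum>j\<in>J. t j *\<^sub>R y j i))) < \<epsilon>))"
      and \<epsilon>: "0 < \<epsilon>" and x: "\<forall>i<m. x i \<in> j ` Q \<and> N (x i) < 1"
    have "\<forall>i. \<exists>v. i < m \<longrightarrow> v \<in> Q \<and> x i = j v" using x by blast
    then obtain x' where x': "\<And>i. i < m \<Longrightarrow> x' i \<in> Q \<and> x i = j (x' i)" by metis
    obtain J :: "nat set" and t y where J: "finite J" "\<forall>j\<in>J. t j \<in> \<rat> \<and> 0 \<le> t j" "sum t J \<le> 1"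
      and y: "\<forall>k\<in>J. \<forall>i<m. y k i \<in> Q \<and> N (j (y k i)) < 1"
      and Ny: "\<forall>k\<in>J. real m - \<epsilon> < N (j (\<Sum>i<m. y k i))"
      and Nx: "\<forall>i<m. N (j (x' i - (\<Sum>j\<in>J. t j *\<^sub>R y j i))) < \<epsilon>"
      using H[rule_format, of \<epsilon> m x'] \<epsilon> x x' by auto
    show "\<exists>(J::nat set) t y. finite J \<and> (\<forall>j\<in>J. t j \<in> \<rat> \<and> 0 \<le> t j) \<and> sum t J \<le> 1 \<and>
        (\<forall>k\<in>J. \<forall>i<m. y k i \<in> j ` Q \<and> N (y k i) < 1) \<and>
        (\<forall>j\<in>J. real m - \<epsilon> < N (\<Sum>i<m. y j i)) \<and>
        (\<forall>i<m. N (x i - (\<Sum>j\<in>J. t j *\<^sub>R y j i)) < \<epsilon>)"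
      using J y Ny Nx x' by (intro exI[of _ J] exI[of _ t] exI[of _ "\<lambda>k i. j (y k i)"]) (auto simp: j)
  qed
qed

section \<open>The extension of a seminorm to real sequences\<close>

lemma subspace_c00: "subspace c00"
  unfolding subspace_def
proof (intro conjI ballI allI)
  show "0 \<in> c00" by (simp add: c00_def)
next
  fix x y assume "x \<in> c00" "y \<in> c00"
  then show "x + y \<in> c00"
    unfolding c00_def by (auto intro: finite_subset[of _ "{n. x n \<noteq> 0} \<union> {n. y n \<noteq> 0}"])
next
  fix c x assume "x \<in> c00"
  then show "c *\<^sub>R x \<in> c00"
    unfolding c00_def by (auto intro: finite_subset[of _ "{n. x n \<noteq> 0}"])
qed

lemmas c00_mem = subspace_0[OF subspace_c00] subspace_add[OF subspace_c00] subspace_diff[OF subspace_c00]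
  subspace_neg[OF subspace_c00] subspace_scale[OF subspace_c00]

lemma seminorm_c00_iff: "seminorm_c00 \<nu> \<longleftrightarrow> seminormed_space c00 \<nu>"
  unfolding seminorm_c00_def seminormed_space_def
  by (auto simp: subspace_c00 plus_fun_def scaleR_fun_def)

lemma qs_rep_finite: "finite {n. qs_rep v n \<noteq> 0}"
  using qs_rep[of v] by simp

lemma qs_rep_abs: "finite {n. f n \<noteq> 0} \<Longrightarrow> qs_rep (qs_abs f) = f"
  by (rule qs_abs_inverse) simp

lemma qs_real_c00: "qs_real v \<in> c00"
  using qs_rep_finite[of v] by (simp add: qs_real_def c00_def)

lemma qs_real_add: "qs_real (qs_add v w) = qs_real v + qs_real w"
proof -
  have "finite {n. qs_rep v n + qs_rep w n \<noteq> 0}"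
    by (rule finite_subset[of _ "{n. qs_rep v n \<noteq> 0} \<union> {n. qs_rep w n \<noteq> 0}"]) (auto simp: qs_rep_finite)
  then show ?thesis by (simp add: qs_real_def qs_add_def qs_rep_abs fun_eq_iff of_rat_add)
qed

lemma qs_real_scale: "qs_real (qs_scale q v) = real_of_rat q *\<^sub>R qs_real v"
proof -
  have "finite {n. q * qs_rep v n \<noteq> 0}"
    by (rule finite_subset[of _ "{n. qs_rep v n \<noteq> 0}"]) (auto simp: qs_rep_finite)
  then show ?thesis by (simp add: qs_real_def qs_scale_def qs_rep_abs fun_eq_iff of_rat_mult)
qed

lemma inj_qs_real: "inj qs_real"
proof (rule injI)
  fix v w assume "qs_real v = qs_real w"
  then have "qs_rep v = qs_rep w" by (auto simp: qs_real_def fun_eq_iff)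
  then show "v = w" by (simp add: qs_rep_inject)
qed

lemma range_qs_real: "range qs_real = {x \<in> c00. range x \<subseteq> \<rat>}"
proof (intro set_eqI iffI)
  fix x :: "nat \<Rightarrow> real" assume "x \<in> range qs_real"
  then show "x \<in> {x \<in> c00. range x \<subseteq> \<rat>}" using qs_real_c00 by (auto simp: qs_real_def)
next
  fix x :: "nat \<Rightarrow> real" assume x: "x \<in> {x \<in> c00. range x \<subseteq> \<rat>}"
  then have "\<forall>n. \<exists>q. x n = real_of_rat q" by (auto simp: Rats_def image_iff)
  then obtain q where q: "\<And>n. x n = real_of_rat (q n)" by metis
  have "finite {n. q n \<noteq> 0}" using x q by (simp add: c00_def)
  then have "qs_real (qs_abs q) = x" using q by (simp add: qs_real_def qs_rep_abs fun_eq_iff)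
  then show "x \<in> range qs_real" by blast
qed

definition qs_of :: "(nat \<Rightarrow> real) \<Rightarrow> qseq" where
  "qs_of = inv qs_real"

lemma qs_of_real [simp]: "qs_of (qs_real v) = v"
  by (simp add: qs_of_def inv_f_f[OF inj_qs_real])

lemma qs_real_of: "x \<in> range qs_real \<Longrightarrow> qs_real (qs_of x) = x"
  by (simp add: qs_of_def f_inv_into_f)

lemma range_qs_real_closed:
  shows range_qs_real_0: "0 \<in> range qs_real"
    and range_qs_real_add: "\<And>x y. x \<in> range qs_real \<Longrightarrow> y \<in> range qs_real \<Longrightarrow> x + y \<in> range qs_real"
    and range_qs_real_scale: "\<And>c x. c \<in> \<rat> \<Longrightarrow> x \<in> range qs_real \<Longrightarrow> c *\<^sub>R x \<in> range qs_real"
    and range_qs_real_diff: "\<And>x y. x \<in> range qs_real \<Longrightarrow> y \<in> range qs_real \<Longrightarrow> x - y \<in> range qs_real"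
  unfolding range_qs_real by (auto simp: c00_mem image_subset_iff)

lemma range_qs_real_sum:
  "(\<And>i. i \<in> I \<Longrightarrow> g i \<in> range qs_real) \<Longrightarrow> (\<Sum>i\<in>I. g i) \<in> range qs_real"
  by (induction I rule: infinite_finite_induct) (auto simp del: image_iff intro: range_qs_real_closed)

definition unit_vec :: "nat \<Rightarrow> nat \<Rightarrow> real" where
  "unit_vec n = (\<lambda>k. if k = n then 1 else 0)"

lemma unit_vec_range: "unit_vec n \<in> range qs_real"
  unfolding range_qs_real by (auto simp: unit_vec_def c00_def)

lemma unit_vec_c00: "unit_vec n \<in> c00"
  by (simp add: unit_vec_def c00_def)

lemma sum_unit_vec:
  assumes "finite A" "\<And>n. n \<notin> A \<Longrightarrow> x n = 0"
  shows "x = (\<Sum>n\<in>A. x n *\<^sub>R unit_vec n)"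
  using assms by (auto simp: fun_eq_iff sum_fun_apply unit_vec_def if_distrib[of "\<lambda>v. _ * v"] cong: if_cong)

section \<open>Weighted 1-norms and the extension to real scalars\<close>

definition weighted_l1 :: "(nat \<Rightarrow> real) \<Rightarrow> (nat \<Rightarrow> real) \<Rightarrow> real" where
  "weighted_l1 c x = (\<Sum>n | x n \<noteq> 0. c n * \<bar>x n\<bar>)"

lemma weighted_l1_eq:
  assumes "finite A" "\<And>n. n \<notin> A \<Longrightarrow> x n = 0"
  shows "weighted_l1 c x = (\<Sum>n\<in>A. c n * \<bar>x n\<bar>)"
  unfolding weighted_l1_def using assms by (intro sum.mono_neutral_left) auto

lemma seminormed_space_weighted_l1:
  assumes c: "\<And>n. 0 \<le> c n"
  shows "seminormed_space c00 (weighted_l1 c)"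
proof
  show "subspace c00" by (rule subspace_c00)
next
  fix x y assume xy: "x \<in> c00" "y \<in> c00"
  define A where "A = {n. x n \<noteq> 0} \<union> {n. y n \<noteq> 0}"
  have A: "finite A" "\<And>n. n \<notin> A \<Longrightarrow> x n = 0" "\<And>n. n \<notin> A \<Longrightarrow> y n = 0"
    using xy by (auto simp: A_def c00_def)
  have "(\<Sum>n\<in>A. c n * \<bar>x n + y n\<bar>) \<le> (\<Sum>n\<in>A. c n * \<bar>x n\<bar> + c n * \<bar>y n\<bar>)"
    using c by (intro sum_mono) (simp add: distrib_left[symmetric] mult_left_mono)
  then show "weighted_l1 c (x + y) \<le> weighted_l1 c x + weighted_l1 c y"
    using A by (simp add: weighted_l1_eq[of A] sum.distrib)
next
  fix r x assume x: "x \<in> c00"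
  then have "finite {n. x n \<noteq> 0}" by (simp add: c00_def)
  then have "weighted_l1 c (r *\<^sub>R x) = (\<Sum>n | x n \<noteq> 0. c n * \<bar>(r *\<^sub>R x) n\<bar>)"
    by (intro weighted_l1_eq) auto
  then show "weighted_l1 c (r *\<^sub>R x) = \<bar>r\<bar> * weighted_l1 c x"
    by (simp add: weighted_l1_def sum_distrib_left abs_mult mult.left_commute)
qed

lemma seminorm_le_weighted_l1:
  assumes "seminormed_space c00 \<nu>" "x \<in> c00"
  shows "\<nu> x \<le> weighted_l1 (\<lambda>n. \<nu> (unit_vec n)) x"
proof -
  interpret seminormed_space c00 \<nu> by fact
  have fin: "finite {n. x n \<noteq> 0}" using assms by (simp add: c00_def)
  have "\<nu> x = \<nu> (\<Sum>n | x n \<noteq> 0. x n *\<^sub>R unit_vec n)"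
    using sum_unit_vec[OF fin, of x] by simp
  also have "\<dots> \<le> (\<Sum>n | x n \<noteq> 0. \<nu> (x n *\<^sub>R unit_vec n))"
    by (intro N_sum) (auto simp: mem unit_vec_c00)
  finally show ?thesis by (simp add: weighted_l1_def scale unit_vec_c00 mult.commute)
qed

text \<open>Only the values \<open>c n\<close> at the unit vectors enter, so one rational
  approximant serves all seminorms that share these values.\<close>

lemma weighted_l1_dense:
  assumes x: "x \<in> c00" and e: "e > 0" and c: "\<And>n. 0 \<le> c n"
  shows "\<exists>v. weighted_l1 c (x - qs_real v) < e"
proof -
  define A where "A = {n. x n \<noteq> 0}"
  have A: "finite A" using x by (simp add: A_def c00_def)
  \<comment> \<open>\<open>c n + 1\<close> avoids a zero denominator, and \<open>card A + 1\<close>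
    makes the sum of the errors strictly smaller than \<open>e\<close>.\<close>
  define d where "d n = e / ((real (card A) + 1) * (c n + 1))" for n
  have d: "0 < d n" for n using e c[of n] by (auto simp: d_def intro!: divide_pos_pos mult_pos_pos add_nonneg_pos)
  have "\<forall>n. \<exists>q. q \<in> \<rat> \<and> x n < q \<and> q < x n + d n"
    using d Rats_dense_in_real by (metis less_add_same_cancel1)
  then obtain q where q: "\<And>n. q n \<in> \<rat>" "\<And>n. x n < q n" "\<And>n. q n < x n + d n" by metis
  define r where "r n = (if n \<in> A then q n else 0)" for n
  have "finite {n. r n \<noteq> 0}" by (rule finite_subset[OF _ A]) (auto simp: r_def)
  then have "r \<in> range qs_real" unfolding range_qs_real using q by (auto simp: c00_def r_def)
  then obtain v where v: "qs_real v = r" by auto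
  have "weighted_l1 c (x - r) = (\<Sum>n\<in>A. c n * \<bar>x n - q n\<bar>)"
    using A by (subst weighted_l1_eq[of A]) (auto simp: r_def A_def)
  also have "\<dots> \<le> (\<Sum>n\<in>A. e / (real (card A) + 1))"
  proof (intro sum_mono)
    fix n
    have "c n * \<bar>x n - q n\<bar> \<le> (c n + 1) * d n"
      using q(2,3)[of n] c[of n] by (intro mult_mono) auto
    also have "\<dots> = e / (real (card A) + 1)" using c[of n] by (simp add: d_def)
    finally show "c n * \<bar>x n - q n\<bar> \<le> e / (real (card A) + 1)" .
  qed
  also have "\<dots> < e" using e by (simp add: field_simps)
  finally show ?thesis using v by auto
qed

text \<open>The extension is the infimal convolution of \<open>\<mu>\<close> with the largest candidate, the \<open>\<mu> (e\<^sub>n)\<close>-weighted 1-norm.\<close>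

lemma mu_bar_extension:
  assumes \<mu>: "seminorm_V \<mu>"
  shows "\<exists>\<nu>. seminormed_space c00 \<nu> \<and> (\<forall>v. \<nu> (qs_real v) = \<mu> v) \<and> (\<forall>x. x \<notin> c00 \<longrightarrow> \<nu> x = 0)"
proof -
  have add: "\<And>v w. \<mu> (qs_add v w) \<le> \<mu> v + \<mu> w"
    and scl: "\<And>q v. \<mu> (qs_scale q v) = \<bar>real_of_rat q\<bar> * \<mu> v"
    using \<mu> by (auto simp: seminorm_V_def)
  define \<mu>' where "\<mu>' x = \<mu> (qs_of x)" for x
  have add': "\<mu>' (x + y) \<le> \<mu>' x + \<mu>' y" if "x \<in> range qs_real" "y \<in> range qs_real" for x y
    using that add by (auto simp: \<mu>'_def qs_real_add[symmetric])
  have scl': "\<mu>' (q *\<^sub>R x) = \<bar>q\<bar> * \<mu>' x" if q: "q \<in> \<rat>" and x: "x \<in> range qs_real" for x q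
  proof -
    obtain p v where "q = real_of_rat p" "x = qs_real v" using q x by (auto simp: Rats_def)
    then show ?thesis using scl by (simp add: \<mu>'_def qs_real_scale[symmetric])
  qed
  have zero': "\<mu>' 0 = 0" using scl'[of 0 0] range_qs_real_0 by simp
  have pos': "0 \<le> \<mu>' x" if "x \<in> range qs_real" for x
    using add'[of x "(-1) *\<^sub>R x"] scl'[of "-1" x] that zero' range_qs_real_scale[of "-1" x] by auto
  define c where "c n = \<mu>' (unit_vec n)" for n
  have c: "0 \<le> c n" for n unfolding c_def by (rule pos'[OF unit_vec_range])
  interpret L: seminormed_space c00 "weighted_l1 c" by (rule seminormed_space_weighted_l1[OF c])
  \<comment> \<open>This domination on rational vectors is the reason why the infimal convolution
    does not fall below \<open>\<mu>\<close> there.\<close>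
  have dom: "\<mu>' x \<le> weighted_l1 c x" if x: "x \<in> range qs_real" for x
  proof -
    have fin: "finite {n. x n \<noteq> 0}" and rat: "\<And>n. x n \<in> \<rat>"
      using x unfolding range_qs_real by (auto simp: c00_def)
    have "\<mu>' (\<Sum>n\<in>A. x n *\<^sub>R unit_vec n) \<le> (\<Sum>n\<in>A. c n * \<bar>x n\<bar>)" if "finite A" for A
      using that
    proof (induction A rule: finite_induct)
      case (insert a A)
      have "\<mu>' (x a *\<^sub>R unit_vec a + (\<Sum>n\<in>A. x n *\<^sub>R unit_vec n)) \<le>
          \<mu>' (x a *\<^sub>R unit_vec a) + \<mu>' (\<Sum>n\<in>A. x n *\<^sub>R unit_vec n)"
        using rat by (intro add' range_qs_real_sum range_qs_real_scale unit_vec_range)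
      moreover have "\<mu>' (x a *\<^sub>R unit_vec a) = c a * \<bar>x a\<bar>"
        using scl'[OF rat unit_vec_range] by (simp add: c_def mult.commute)
      ultimately show ?case
        using insert.IH unfolding sum.insert[OF insert.hyps] by linarith
    qed (simp only: sum.empty zero' order.refl)
    from this[OF fin] show ?thesis
      using sum_unit_vec[OF fin, of x] by (simp add: weighted_l1_def)
  qed
  define V where "V x = (\<lambda>v. \<mu> v + weighted_l1 c (x - qs_real v)) ` UNIV" for x
  define \<nu> where "\<nu> x = Inf (V x)" for x
  have mem: "x - qs_real v \<in> c00" if "x \<in> c00" for x v using that qs_real_c00 by (simp add: c00_mem)
  have \<mu>_nonneg: "0 \<le> \<mu> v" for v using pos'[of "qs_real v"] by (simp add: \<mu>'_def)
  have V_nonneg: "0 \<le> \<mu> v + weighted_l1 c (x - qs_real v)" if "x \<in> c00" for x v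
    using \<mu>_nonneg[of v] L.N_nonneg[OF mem[OF that], of v] by simp
  have bdd: "bdd_below (V x)" if "x \<in> c00" for x
    unfolding V_def using V_nonneg[OF that] by (rule bdd_belowI2)
  have upper: "\<nu> x \<le> \<mu> v + weighted_l1 c (x - qs_real v)" if "x \<in> c00" for x v
    unfolding \<nu>_def using bdd[OF that] by (intro cInf_lower) (auto simp: V_def)
  have approx: "\<exists>v. \<mu> v + weighted_l1 c (x - qs_real v) < \<nu> x + e" if "e > 0" for x e
  proof -
    have "Inf (V x) < \<nu> x + e" using that by (simp add: \<nu>_def)
    moreover have "V x \<noteq> {}" by (simp add: V_def)
    ultimately obtain w where "w \<in> V x" "w < \<nu> x + e" using cInf_lessD by blast
    then show ?thesis by (auto simp: V_def)
  qed
  have ext: "\<nu> (qs_real u) = \<mu> u" for u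
  proof (rule antisym)
    show "\<nu> (qs_real u) \<le> \<mu> u" using upper[OF qs_real_c00, of u u] by simp
    show "\<mu> u \<le> \<nu> (qs_real u)"
      unfolding \<nu>_def
    proof (rule cInf_greatest)
      show "V (qs_real u) \<noteq> {}" by (simp add: V_def)
      fix w assume "w \<in> V (qs_real u)"
      then obtain v where w: "w = \<mu> v + weighted_l1 c (qs_real u - qs_real v)" by (auto simp: V_def)
      have "qs_real u - qs_real v \<in> range qs_real" by (intro range_qs_real_diff) auto
      then have "\<mu>' (qs_real v + (qs_real u - qs_real v)) \<le> \<mu>' (qs_real v) + weighted_l1 c (qs_real u - qs_real v)"
        using add'[of "qs_real v" "qs_real u - qs_real v"] dom[of "qs_real u - qs_real v"] by auto
      then show "\<mu> u \<le> w" by (simp add: w \<mu>'_def)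
    qed
  qed
  have tri: "\<nu> (x + y) \<le> \<nu> x + \<nu> y" if x: "x \<in> c00" and y: "y \<in> c00" for x y
  proof (rule field_le_epsilon)
    fix e :: real assume "e > 0"
    then obtain v w where v: "\<mu> v + weighted_l1 c (x - qs_real v) < \<nu> x + e / 2"
      and w: "\<mu> w + weighted_l1 c (y - qs_real w) < \<nu> y + e / 2"
      using approx[of "e / 2" x] approx[of "e / 2" y] by auto
    have "\<nu> (x + y) \<le> \<mu> (qs_add v w) + weighted_l1 c ((x + y) - qs_real (qs_add v w))"
      using x y by (intro upper) (simp add: c00_mem)
    also have "(x + y) - qs_real (qs_add v w) = (x - qs_real v) + (y - qs_real w)"
      by (simp add: qs_real_add)
    also have "weighted_l1 c \<dots> \<le> weighted_l1 c (x - qs_real v) + weighted_l1 c (y - qs_real w)"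
      by (intro L.triangle mem x y)
    finally show "\<nu> (x + y) \<le> \<nu> x + \<nu> y + e" using v w add[of v w] by linarith
  qed
  have rat: "\<nu> (real_of_rat q *\<^sub>R x) \<le> \<bar>real_of_rat q\<bar> * \<nu> x" if x: "x \<in> c00" for q x
  proof (cases "q = 0")
    case True
    \<comment> \<open>The zero vector of V, obtained as 0 times an arbitrary vector.\<close>
    have "qs_real (qs_scale 0 undefined) = 0" by (simp add: qs_real_scale)
    then have "\<nu> 0 = 0" using ext[of "qs_scale 0 undefined"] scl[of 0] by simp
    then show ?thesis using True by simp
  next
    case False
    then have q: "\<bar>real_of_rat q\<bar> > 0" by simp
    show ?thesis
    proof (rule field_le_epsilon)
      fix e :: real assume "e > 0"
      then obtain v where v: "\<mu> v + weighted_l1 c (x - qs_real v) < \<nu> x + e / \<bar>real_of_rat q\<bar>"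
        using approx[of "e / \<bar>real_of_rat q\<bar>" x] q by auto
      have "\<nu> (real_of_rat q *\<^sub>R x) \<le>
          \<mu> (qs_scale q v) + weighted_l1 c (real_of_rat q *\<^sub>R x - qs_real (qs_scale q v))"
        using x by (intro upper) (simp add: c00_mem)
      also have "real_of_rat q *\<^sub>R x - qs_real (qs_scale q v) = real_of_rat q *\<^sub>R (x - qs_real v)"
        by (simp add: qs_real_scale scaleR_diff_right)
      also have "\<mu> (qs_scale q v) + weighted_l1 c (real_of_rat q *\<^sub>R (x - qs_real v)) =
          \<bar>real_of_rat q\<bar> * (\<mu> v + weighted_l1 c (x - qs_real v))"
        using scl L.scale[OF mem[OF x]] by (simp add: distrib_left)
      also have "\<dots> \<le> \<bar>real_of_rat q\<bar> * (\<nu> x + e / \<bar>real_of_rat q\<bar>)"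
        using v q by (intro mult_left_mono) auto
      also have "\<dots> = \<bar>real_of_rat q\<bar> * \<nu> x + e" using q by (simp add: distrib_left)
      finally show "\<nu> (real_of_rat q *\<^sub>R x) \<le> \<bar>real_of_rat q\<bar> * \<nu> x + e" .
    qed
  qed
  have lip: "\<nu> x \<le> weighted_l1 c x" if "x \<in> c00" for x
  proof -
    have "qs_real (qs_scale 0 undefined) = 0" by (simp add: qs_real_scale)
    then show ?thesis using upper[OF that, of "qs_scale 0 undefined"] scl[of 0] by simp
  qed
  have \<nu>_nonneg: "0 \<le> \<nu> x" if "x \<in> c00" for x
    unfolding \<nu>_def using V_nonneg[OF that] by (intro cInf_greatest) (auto simp: V_def)
  \<comment> \<open>Homogeneity is known for rational factors. A real \<open>r\<close> is replaced
    by a slightly larger rational, and the remaining multiple \<open>- d\<close> of \<open>x\<close>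
    is controlled by the 1-norm bound \<open>lip\<close>.\<close>
  have scl_le: "\<nu> (r *\<^sub>R x) \<le> \<bar>r\<bar> * \<nu> x" if x: "x \<in> c00" for r x
  proof (rule field_le_epsilon)
    fix e :: real assume e: "e > 0"
    \<comment> \<open>The change of the factor costs at most \<open>d * \<nu> x\<close> and the
      remainder \<open>d * weighted_l1 c x\<close>; the summand 1 makes \<open>b\<close>
      positive.\<close>
    define b where "b = \<nu> x + weighted_l1 c x + 1"
    have b: "b > 0" using \<nu>_nonneg[OF x] L.N_nonneg[OF x] by (simp add: b_def)
    obtain q where q: "r < real_of_rat q" "real_of_rat q < r + e / b"
      using of_rat_dense[of r "r + e / b"] e b by auto
    define d where "d = real_of_rat q - r"
    have d: "0 < d" "d * b < e" using q b by (auto simp: d_def field_simps)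
    have "\<nu> (r *\<^sub>R x) = \<nu> (real_of_rat q *\<^sub>R x + (- d) *\<^sub>R x)"
      by (simp add: d_def scaleR_add_left[symmetric] del: scaleR_minus_left)
    also have "\<dots> \<le> \<nu> (real_of_rat q *\<^sub>R x) + \<nu> ((- d) *\<^sub>R x)" using x by (intro tri) (auto simp: c00_mem)
    also have "\<dots> \<le> \<bar>real_of_rat q\<bar> * \<nu> x + d * weighted_l1 c x"
      using rat[OF x, of q] lip[of "(- d) *\<^sub>R x"] L.scale[OF x, of "- d"] d(1) x
      by (simp add: c00_mem)
    also have "\<bar>real_of_rat q\<bar> \<le> \<bar>r\<bar> + d" using d(1) unfolding d_def by linarith
    then have "\<bar>real_of_rat q\<bar> * \<nu> x + d * weighted_l1 c x \<le> (\<bar>r\<bar> + d) * \<nu> x + d * weighted_l1 c x"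
      using \<nu>_nonneg[OF x] by (simp add: mult_right_mono)
    also have "\<dots> \<le> \<bar>r\<bar> * \<nu> x + d * b" using d(1) by (simp add: b_def algebra_simps)
    finally show "\<nu> (r *\<^sub>R x) \<le> \<bar>r\<bar> * \<nu> x + e" using d by linarith
  qed
  \<comment> \<open>The normalisation outside c00 that \<open>mu_bar\<close> prescribes.\<close>
  define \<nu>' where "\<nu>' x = (if x \<in> c00 then \<nu> x else 0)" for x
  have "seminormed_space c00 \<nu>'"
    by (rule seminormed_spaceI) (auto simp: \<nu>'_def c00_mem subspace_c00 tri scl_le)
  moreover have "\<nu>' (qs_real v) = \<mu> v" for v by (simp add: \<nu>'_def qs_real_c00 ext)
  ultimately show ?thesis by (intro exI[of _ \<nu>']) (simp add: \<nu>'_def)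
qed

text \<open>Both seminorms agree at the unit vectors, so both lie below the same weighted 1-norm,
  and rational vectors are dense for it.\<close>

lemma seminorm_le_if_eq_on_rationals:
  assumes "seminormed_space c00 \<nu>1" "seminormed_space c00 \<nu>2"
    and eq: "\<And>v. \<nu>1 (qs_real v) = \<nu>2 (qs_real v)" and x: "x \<in> c00"
  shows "\<nu>1 x \<le> \<nu>2 x"
proof (rule field_le_epsilon)
  fix e :: real assume e: "e > 0"
  interpret A: seminormed_space c00 \<nu>1 by fact
  interpret B: seminormed_space c00 \<nu>2 by fact
  define c where "c = (\<lambda>n. \<nu>1 (unit_vec n))"
  have c2: "c = (\<lambda>n. \<nu>2 (unit_vec n))"
  proof
    fix n
    obtain v where "unit_vec n = qs_real v" using unit_vec_range by blast
    then show "c n = \<nu>2 (unit_vec n)" using eq by (simp add: c_def)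
  qed
  have "0 \<le> c n" for n unfolding c_def by (rule A.N_nonneg[OF unit_vec_c00])
  then obtain v where v: "weighted_l1 c (x - qs_real v) < e / 2"
    using weighted_l1_dense[OF x, of "e / 2" c] e by auto
  have m: "x - qs_real v \<in> c00" using x qs_real_c00 by (simp add: c00_mem)
  have "\<nu>1 x \<le> \<nu>1 (x - qs_real v) + \<nu>1 (qs_real v)" using A.triangle[OF m qs_real_c00, of v] by simp
  moreover have "\<nu>1 (x - qs_real v) \<le> weighted_l1 c (x - qs_real v)"
    using seminorm_le_weighted_l1[OF assms(1) m] by (simp add: c_def)
  moreover have "\<nu>2 (qs_real v) \<le> \<nu>2 x + \<nu>2 (x - qs_real v)" using B.N_diff[OF x m] by simp
  moreover have "\<nu>2 (x - qs_real v) \<le> weighted_l1 c (x - qs_real v)"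
    using seminorm_le_weighted_l1[OF assms(2) m] by (simp add: c2)
  ultimately show "\<nu>1 x \<le> \<nu>2 x + e" using eq[of v] v by linarith
qed

lemma mu_bar_unique:
  assumes "seminormed_space c00 \<nu>" "\<And>v. \<nu> (qs_real v) = \<mu> v" "\<And>x. x \<notin> c00 \<Longrightarrow> \<nu> x = 0"
  shows "mu_bar \<mu> = \<nu>"
  unfolding mu_bar_def seminorm_c00_iff
proof (rule the_equality)
  show "seminormed_space c00 \<nu> \<and> (\<forall>v. \<nu> (qs_real v) = \<mu> v) \<and> (\<forall>x. x \<notin> c00 \<longrightarrow> \<nu> x = 0)"
    using assms by blast
  fix \<nu>' assume \<nu>': "seminormed_space c00 \<nu>' \<and> (\<forall>v. \<nu>' (qs_real v) = \<mu> v) \<and> (\<forall>x. x \<notin> c00 \<longrightarrow> \<nu>' x = 0)"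
  show "\<nu>' = \<nu>"
  proof
    fix x show "\<nu>' x = \<nu> x"
      using seminorm_le_if_eq_on_rationals[of \<nu> \<nu>' x] seminorm_le_if_eq_on_rationals[of \<nu>' \<nu> x] assms \<nu>'
      by (cases "x \<in> c00") (auto intro: antisym)
  qed
qed

lemma mu_bar_props:
  assumes "seminorm_V \<mu>"
  shows "seminormed_space c00 (mu_bar \<mu>)" "mu_bar \<mu> (qs_real v) = \<mu> v"
proof -
  obtain \<nu> where "seminormed_space c00 \<nu>" "\<And>v. \<nu> (qs_real v) = \<mu> v" "\<And>x. x \<notin> c00 \<Longrightarrow> \<nu> x = 0"
    using mu_bar_extension[OF assms] by blast
  then show "seminormed_space c00 (mu_bar \<mu>)" "mu_bar \<mu> (qs_real v) = \<mu> v"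
    using mu_bar_unique[of \<nu> \<mu>] by auto
qed

section \<open>The SD2P is a countable intersection of open conditions\<close>

lemma Xcarrier_iff:
  "s \<in> Xcarrier \<mu> \<longleftrightarrow> (\<forall>k. s k \<in> c00) \<and> (\<forall>e>0. \<exists>K. \<forall>k\<ge>K. \<forall>l\<ge>K. mu_bar \<mu> (s k - s l) < e)"
  by (simp add: Xcarrier_def fun_diff_def)

text \<open>The operations \<open>Xadd\<close>, \<open>Xdiff\<close>, \<open>Xscale\<close> and
  \<open>Xlincomb\<close> are the pointwise vector operations on functions, so the two sides unfold
  to the same formula.\<close>

lemma SD2P_iff: "SD2P \<mu> \<longleftrightarrow> strong_diameter_two (Xcarrier \<mu>) (Xnorm \<mu>)"
proof -
  have ops: "Xadd s t = s + t" "Xdiff s t = s - t" "Xscale c s = c *\<^sub>R s"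
    "Xlincomb m lam x = (\<Sum>i<m. lam i *\<^sub>R x i)" for s t c m lam x
    by (simp_all add: Xadd_def Xdiff_def Xscale_def Xlincomb_def fun_eq_iff sum_fun_apply)
  have "Xdual_sphere \<mu> = dual_sphere (Xcarrier \<mu>) (Xnorm \<mu>)"
    by (simp add: Xdual_sphere_def dual_sphere_def linear_functional_on_def Xball_def ops conj_assoc)
  then show ?thesis
    by (simp add: SD2P_def strong_diameter_two_def Xdiam_def Xslice_def Xball_def ops conj_assoc)
qed

lemma linear_const: "linear (\<lambda>x (_::nat). x :: nat \<Rightarrow> real)"
  by (rule linearI) (simp_all add: fun_eq_iff)

context
  fixes \<mu> :: "qseq \<Rightarrow> real"
  assumes \<mu>: "seminorm_V \<mu>"
begin

interpretation M: seminormed_space c00 "mu_bar \<mu>"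
  by (rule mu_bar_props(1)[OF \<mu>])

text \<open>\<open>Xnorm\<close> is defined through \<open>lim\<close>, which says something only
  about convergent sequences; by the reverse triangle inequality the norms form a Cauchy
  sequence.\<close>

lemma Xnorm_tendsto:
  assumes "s \<in> Xcarrier \<mu>"
  shows "(\<lambda>k. mu_bar \<mu> (s k)) \<longlonglongrightarrow> Xnorm \<mu> s"
proof -
  have s: "\<And>k. s k \<in> c00" using assms by (simp add: Xcarrier_iff)
  have "\<bar>mu_bar \<mu> (s k) - mu_bar \<mu> (s l)\<bar> \<le> mu_bar \<mu> (s k - s l)" for k l
    using M.N_diff_ge[OF s s, of k l] M.N_diff_ge[OF s s, of l k] M.N_minus[of "s k - s l"] s
    by (simp add: c00_mem abs_le_iff)
  then have "Cauchy (\<lambda>k. mu_bar \<mu> (s k))"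
    using assms unfolding Cauchy_def Xcarrier_iff dist_real_def by (meson le_less_trans)
  then show ?thesis unfolding Xnorm_def by (simp add: Cauchy_convergent convergent_LIMSEQ_iff[symmetric])
qed

lemma seminormed_space_X: "seminormed_space (Xcarrier \<mu>) (Xnorm \<mu>)"
proof
  have add: "s + t \<in> Xcarrier \<mu>" if s: "s \<in> Xcarrier \<mu>" and t: "t \<in> Xcarrier \<mu>" for s t
    unfolding Xcarrier_iff
  proof (intro conjI allI impI)
    show "(s + t) k \<in> c00" for k using s t by (simp add: Xcarrier_iff c00_mem)
    fix e :: real assume "e > 0"
    then obtain K L where K: "\<And>k l. k \<ge> K \<Longrightarrow> l \<ge> K \<Longrightarrow> mu_bar \<mu> (s k - s l) < e / 2"
      and L: "\<And>k l. k \<ge> L \<Longrightarrow> l \<ge> L \<Longrightarrow> mu_bar \<mu> (t k - t l) < e / 2"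
      using s t unfolding Xcarrier_iff by (meson half_gt_zero)
    have "mu_bar \<mu> ((s + t) k - (s + t) l) < e" if "k \<ge> max K L" "l \<ge> max K L" for k l
    proof -
      have "(s + t) k - (s + t) l = (s k - s l) + (t k - t l)" by simp
      then have "mu_bar \<mu> ((s + t) k - (s + t) l) \<le> mu_bar \<mu> (s k - s l) + mu_bar \<mu> (t k - t l)"
        using M.triangle[of "s k - s l" "t k - t l"] s t by (simp only: Xcarrier_iff c00_mem)
      then show ?thesis using K[of k l] L[of k l] that by auto
    qed
    then show "\<exists>K. \<forall>k\<ge>K. \<forall>l\<ge>K. mu_bar \<mu> ((s + t) k - (s + t) l) < e" by blast
  qed
  have scale: "c *\<^sub>R s \<in> Xcarrier \<mu>" if s: "s \<in> Xcarrier \<mu>" for c s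
    unfolding Xcarrier_iff
  proof (intro conjI allI impI)
    show "(c *\<^sub>R s) k \<in> c00" for k using s by (simp add: Xcarrier_iff c00_mem)
    fix e :: real assume e: "e > 0"
    then obtain K where K: "\<And>k l. k \<ge> K \<Longrightarrow> l \<ge> K \<Longrightarrow> mu_bar \<mu> (s k - s l) < e / (\<bar>c\<bar> + 1)"
      using s unfolding Xcarrier_iff by (metis abs_add_one_gt_zero add.commute divide_pos_pos)
    have "mu_bar \<mu> ((c *\<^sub>R s) k - (c *\<^sub>R s) l) < e" if "k \<ge> K" "l \<ge> K" for k l
    proof -
      have m: "s k - s l \<in> c00" using s by (simp add: Xcarrier_iff c00_mem)
      have "(c *\<^sub>R s) k - (c *\<^sub>R s) l = c *\<^sub>R (s k - s l)" by (simp add: scaleR_diff_right)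
      then have "mu_bar \<mu> ((c *\<^sub>R s) k - (c *\<^sub>R s) l) = \<bar>c\<bar> * mu_bar \<mu> (s k - s l)"
        using M.scale[OF m] by simp
      also have "\<dots> \<le> (\<bar>c\<bar> + 1) * mu_bar \<mu> (s k - s l)"
        using M.N_nonneg[OF m] by (intro mult_right_mono) auto
      also have "\<dots> < (\<bar>c\<bar> + 1) * (e / (\<bar>c\<bar> + 1))"
        using K[OF that] by (intro mult_strict_left_mono) auto
      also have "\<dots> = e" by simp
      finally show ?thesis .
    qed
    then show "\<exists>K. \<forall>k\<ge>K. \<forall>l\<ge>K. mu_bar \<mu> ((c *\<^sub>R s) k - (c *\<^sub>R s) l) < e" by blast
  qed
  have "0 \<in> Xcarrier \<mu>" by (simp add: Xcarrier_iff c00_mem)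
  with add scale show "subspace (Xcarrier \<mu>)" by (simp add: subspace_def)
  show "Xnorm \<mu> (s + t) \<le> Xnorm \<mu> s + Xnorm \<mu> t" if s: "s \<in> Xcarrier \<mu>" and t: "t \<in> Xcarrier \<mu>" for s t
  proof (rule LIMSEQ_le[OF Xnorm_tendsto[OF add[OF s t]]])
    show "(\<lambda>k. mu_bar \<mu> (s k) + mu_bar \<mu> (t k)) \<longlonglongrightarrow> Xnorm \<mu> s + Xnorm \<mu> t"
      by (intro tendsto_add Xnorm_tendsto s t)
    show "\<exists>N. \<forall>k\<ge>N. mu_bar \<mu> ((s + t) k) \<le> mu_bar \<mu> (s k) + mu_bar \<mu> (t k)"
      using s t M.triangle by (simp add: Xcarrier_iff)
  qed
  show "Xnorm \<mu> (c *\<^sub>R s) = \<bar>c\<bar> * Xnorm \<mu> s" if s: "s \<in> Xcarrier \<mu>" for c s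
  proof (rule LIMSEQ_unique[OF Xnorm_tendsto[OF scale[OF s]]])
    have "mu_bar \<mu> ((c *\<^sub>R s) k) = \<bar>c\<bar> * mu_bar \<mu> (s k)" for k
      using s M.scale by (simp add: Xcarrier_iff)
    then show "(\<lambda>k. mu_bar \<mu> ((c *\<^sub>R s) k)) \<longlonglongrightarrow> \<bar>c\<bar> * Xnorm \<mu> s"
      using Xnorm_tendsto[OF s] by (simp only:) (intro tendsto_mult tendsto_const)
  qed
qed

lemma const_Xcarrier: "x \<in> c00 \<Longrightarrow> (\<lambda>_. x) \<in> Xcarrier \<mu>"
  by (simp add: Xcarrier_iff)

lemma Xnorm_const: "Xnorm \<mu> (\<lambda>_. x) = mu_bar \<mu> x"
  by (simp add: Xnorm_def)

lemma const_dense: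
  assumes s: "s \<in> Xcarrier \<mu>" and e: "e > 0"
  shows "\<exists>x\<in>c00. Xnorm \<mu> (s - (\<lambda>_. x)) < e"
proof -
  interpret X: seminormed_space "Xcarrier \<mu>" "Xnorm \<mu>" by (rule seminormed_space_X)
  obtain K where K: "\<And>k l. k \<ge> K \<Longrightarrow> l \<ge> K \<Longrightarrow> mu_bar \<mu> (s k - s l) < e / 2"
    using s e unfolding Xcarrier_iff by (meson half_gt_zero)
  have sK: "s K \<in> c00" using s by (simp add: Xcarrier_iff)
  have "s - (\<lambda>_. s K) \<in> Xcarrier \<mu>" using s const_Xcarrier[OF sK] by (intro X.mem)
  from Xnorm_tendsto[OF this] have "Xnorm \<mu> (s - (\<lambda>_. s K)) \<le> e / 2"
    by (rule LIMSEQ_le_const2) (use K in \<open>force intro: less_imp_le\<close>)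
  then show ?thesis using sK e by (intro bexI[of _ "s K"]) auto
qed

lemma rational_dense:
  assumes x: "x \<in> c00" and e: "e > 0"
  shows "\<exists>v. mu_bar \<mu> (x - qs_real v) < e"
proof -
  have "\<exists>v. weighted_l1 (\<lambda>n. mu_bar \<mu> (unit_vec n)) (x - qs_real v) < e"
    using x e by (rule weighted_l1_dense) (rule M.N_nonneg[OF unit_vec_c00])
  then obtain v where "weighted_l1 (\<lambda>n. mu_bar \<mu> (unit_vec n)) (x - qs_real v) < e" by blast
  moreover have "x - qs_real v \<in> c00" using x qs_real_c00 by (simp add: c00_mem)
  ultimately show ?thesis
    using seminorm_le_weighted_l1[OF mu_bar_props(1)[OF \<mu>]] by (meson le_less_trans)
qed

text \<open>Constant sequences are dense in the completion. This version serves the block norms,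
  which are handled on all of c00.\<close>

lemma SD2P_iff_c00: "SD2P \<mu> \<longleftrightarrow> spread_tuples_dense c00 (mu_bar \<mu>)"
proof -
  interpret X: seminormed_space "Xcarrier \<mu>" "Xnorm \<mu>" by (rule seminormed_space_X)
  have "SD2P \<mu> \<longleftrightarrow> spread_tuples_dense ((\<lambda>x _. x) ` c00) (Xnorm \<mu>)"
    unfolding SD2P_iff using const_Xcarrier const_dense
    by (intro X.strong_diameter_two_iff_spread_tuples_dense) auto
  also have "\<dots> \<longleftrightarrow> spread_tuples_dense c00 (mu_bar \<mu>)"
    by (simp add: spread_tuples_dense_image[OF linear_const] Xnorm_const)
  finally show ?thesis .
qed

text \<open>On rational vectors \<open>mu_bar \<mu>\<close> takes values of \<open>\<mu>\<close>
  itself, that is, coordinates of the code; this links the condition to the product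
  topology.\<close>

lemma SD2P_iff_rational: "SD2P \<mu> \<longleftrightarrow> spread_tuples_dense (range qs_real) (mu_bar \<mu>)"
proof -
  interpret X: seminormed_space "Xcarrier \<mu>" "Xnorm \<mu>" by (rule seminormed_space_X)
  have "SD2P \<mu> \<longleftrightarrow> spread_tuples_dense ((\<lambda>x _. x) ` range qs_real) (Xnorm \<mu>)"
    unfolding SD2P_iff
  proof (rule X.strong_diameter_two_iff_spread_tuples_dense)
    show "(\<lambda>x _. x) ` range qs_real \<subseteq> Xcarrier \<mu>" using const_Xcarrier qs_real_c00 by auto
    fix s and e :: real assume s: "s \<in> Xcarrier \<mu>" and e: "e > 0"
    obtain x where x: "x \<in> c00" "Xnorm \<mu> (s - (\<lambda>_. x)) < e / 2" using const_dense[OF s, of "e / 2"] e by auto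
    obtain v where v: "mu_bar \<mu> (x - qs_real v) < e / 2" using rational_dense[OF x(1), of "e / 2"] e by auto
    have eq: "s - (\<lambda>_. qs_real v) = (s - (\<lambda>_. x)) + (\<lambda>_. x - qs_real v)" by (simp add: fun_eq_iff)
    have "Xnorm \<mu> ((s - (\<lambda>_. x)) + (\<lambda>_. x - qs_real v)) \<le> Xnorm \<mu> (s - (\<lambda>_. x)) + Xnorm \<mu> (\<lambda>_. x - qs_real v)"
      using s x qs_real_c00 by (intro X.triangle X.mem const_Xcarrier c00_mem) auto
    then have "Xnorm \<mu> (s - (\<lambda>_. qs_real v)) < e"
      using x v Xnorm_const[of "x - qs_real v"] unfolding eq[symmetric] by linarith
    then show "\<exists>q\<in>(\<lambda>x _. x) ` range qs_real. Xnorm \<mu> (s - q) < e" by blast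
  qed
  also have "\<dots> \<longleftrightarrow> spread_tuples_dense (range qs_real) (mu_bar \<mu>)"
    by (simp add: spread_tuples_dense_image[OF linear_const] Xnorm_const)
  finally show ?thesis .
qed

end

section \<open>Countably many open conditions on the code\<close>

lemma countable_qseq: "countable (UNIV :: qseq set)"
proof -
  have "\<exists>l. v = qs_abs (\<lambda>n. if n < length l then l ! n else 0)" for v
  proof -
    obtain m where m: "\<And>n. qs_rep v n \<noteq> 0 \<Longrightarrow> n < m"
      using qs_rep_finite[of v] by (auto simp: finite_nat_set_iff_bounded)
    have "qs_rep v = (\<lambda>n. if n < length (map (qs_rep v) [0..<m]) then map (qs_rep v) [0..<m] ! n else 0)"
      using m by (auto simp: fun_eq_iff)
    then show ?thesis using qs_rep_inverse[of v] by metis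
  qed
  then have *: "UNIV = range (\<lambda>l. qs_abs (\<lambda>n. if n < length l then l ! n else 0))" by blast
  show ?thesis by (subst *) (intro countable_image countableI_type)
qed

text \<open>An implication with hypothesis \<open>\<mu> (xs ! i) < 1\<close> for all
  \<open>i\<close> is not visibly open, since the negated hypothesis is closed. The first disjunct
  replaces \<open>1 \<le> \<mu> (xs ! i)\<close> by the open condition
  \<open>1 - e < \<mu> (xs ! i)\<close>; quantifying over all small \<open>e\<close> restores the
  original meaning.\<close>

definition spread_condition :: "qseq list \<Rightarrow> real \<Rightarrow> (qseq \<Rightarrow> real) \<Rightarrow> bool" where
  "spread_condition xs e \<mu> \<longleftrightarrow>
     (\<exists>i<length xs. 1 - e < \<mu> (xs ! i)) \<or>
     (\<exists>(J::nat set) t y. finite J \<and> (\<forall>j\<in>J. t j \<in> \<rat> \<and> 0 \<le> t j) \<and> sum t J \<le> 1 \<and>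
        (\<forall>j\<in>J. \<forall>i<length xs. \<mu> (y j i) < 1) \<and>
        (\<forall>j\<in>J. real (length xs) - e < \<mu> (qs_of (\<Sum>i<length xs. qs_real (y j i)))) \<and>
        (\<forall>i<length xs. \<mu> (qs_of (qs_real (xs ! i) - (\<Sum>j\<in>J. t j *\<^sub>R qs_real (y j i)))) < e))"

lemma open_eval_less: "open {\<mu> :: 'a \<Rightarrow> real. \<mu> v < c}" "open {\<mu> :: 'a \<Rightarrow> real. c < \<mu> v}"
  by (intro open_Collect_less continuous_intros continuous_on_product_coordinates)+

lemma open_spread_condition: "open {\<mu>. spread_condition xs e \<mu>}"
proof -
  have "open {\<mu> :: qseq \<Rightarrow> real. (\<forall>j\<in>J. \<forall>i<length xs. \<mu> (y j i) < 1) \<and>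
        (\<forall>j\<in>J. real (length xs) - e < \<mu> (qs_of (\<Sum>i<length xs. qs_real (y j i)))) \<and>
        (\<forall>i<length xs. \<mu> (qs_of (qs_real (xs ! i) - (\<Sum>j\<in>J. t j *\<^sub>R qs_real (y j i)))) < e)}"
    if "finite J" for J :: "nat set" and t y
  proof -
    have "{\<mu> :: qseq \<Rightarrow> real. (\<forall>j\<in>J. \<forall>i<length xs. \<mu> (y j i) < 1) \<and>
        (\<forall>j\<in>J. real (length xs) - e < \<mu> (qs_of (\<Sum>i<length xs. qs_real (y j i)))) \<and>
        (\<forall>i<length xs. \<mu> (qs_of (qs_real (xs ! i) - (\<Sum>j\<in>J. t j *\<^sub>R qs_real (y j i)))) < e)} =
      (\<Inter>j\<in>J. \<Inter>i\<in>{..<length xs}. {\<mu>. \<mu> (y j i) < 1}) \<inter>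
      (\<Inter>j\<in>J. {\<mu>. real (length xs) - e < \<mu> (qs_of (\<Sum>i<length xs. qs_real (y j i)))}) \<inter>
      (\<Inter>i\<in>{..<length xs}. {\<mu>. \<mu> (qs_of (qs_real (xs ! i) - (\<Sum>j\<in>J. t j *\<^sub>R qs_real (y j i)))) < e})"
      by auto
    also have "open \<dots>"
      using that by (intro open_Int open_INT ballI open_eval_less) auto
    finally show ?thesis .
  qed
  then have "open (\<Union>(J, t, y) \<in> {(J, t, y). finite (J::nat set) \<and> (\<forall>j\<in>J. t j \<in> \<rat> \<and> 0 \<le> t j) \<and> sum t J \<le> 1}.
      {\<mu> :: qseq \<Rightarrow> real. (\<forall>j\<in>J. \<forall>i<length xs. \<mu> (y j i) < 1) \<and>
        (\<forall>j\<in>J. real (length xs) - e < \<mu> (qs_of (\<Sum>i<length xs. qs_real (y j i)))) \<and>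
        (\<forall>i<length xs. \<mu> (qs_of (qs_real (xs ! i) - (\<Sum>j\<in>J. t j *\<^sub>R qs_real (y j i)))) < e)})"
      (is "open ?U")
    by (intro open_UN) auto
  moreover have "open (\<Union>i\<in>{..<length xs}. {\<mu> :: qseq \<Rightarrow> real. 1 - e < \<mu> (xs ! i)})" (is "open ?V")
    by (intro open_UN ballI open_eval_less)
  moreover have "{\<mu>. spread_condition xs e \<mu>} = ?V \<union> ?U"
    unfolding spread_condition_def by blast
  ultimately show ?thesis by (simp add: open_Un)
qed

lemma SD2P_iff_spread_condition:
  assumes \<mu>: "seminorm_V \<mu>"
  shows "SD2P \<mu> \<longleftrightarrow> (\<forall>xs (n::nat). spread_condition xs (1 / (real n + 1)) \<mu>)"
proof -
  note ext = mu_bar_props(2)[OF \<mu>]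
  have ext': "\<mu> (qs_of x) = mu_bar \<mu> x" if "x \<in> range qs_real" for x
    using ext[of "qs_of x"] qs_real_of[OF that] by simp
  have sums: "(\<Sum>i<m. qs_real (y i)) \<in> range qs_real" for m :: nat and y
    by (intro range_qs_real_sum) auto
  have diffs: "qs_real x - (\<Sum>j\<in>J. t j *\<^sub>R qs_real (y j)) \<in> range qs_real"
    if "\<forall>j\<in>J. t j \<in> \<rat> \<and> 0 \<le> t j" for x y J and t :: "nat \<Rightarrow> real"
    using that by (intro range_qs_real_diff range_qs_real_sum range_qs_real_scale) auto
  show ?thesis
    unfolding SD2P_iff_rational[OF \<mu>]
  proof (intro iffI allI)
    fix xs and n :: nat
    assume H: "spread_tuples_dense (range qs_real) (mu_bar \<mu>)"
    define e where "e = 1 / (real n + 1)"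
    have e: "e > 0" by (simp add: e_def)
    show "spread_condition xs (1 / (real n + 1)) \<mu>"
      unfolding e_def[symmetric]
    proof (cases "\<forall>i<length xs. \<mu> (xs ! i) < 1")
      case False
      then obtain i where "i < length xs" "\<mu> (xs ! i) \<ge> 1" by (auto simp: not_less)
      then show "spread_condition xs e \<mu>" unfolding spread_condition_def using e by force
    next
      case True
      then obtain J :: "nat set" and t y where J: "finite J" "\<forall>j\<in>J. t j \<in> \<rat> \<and> 0 \<le> t j" "sum t J \<le> 1"
        and y: "\<forall>j\<in>J. \<forall>i<length xs. y j i \<in> range qs_real \<and> mu_bar \<mu> (y j i) < 1"
        and Ny: "\<forall>j\<in>J. real (length xs) - e < mu_bar \<mu> (\<Sum>i<length xs. y j i)"
        and Nx: "\<forall>i<length xs. mu_bar \<mu> (qs_real (xs ! i) - (\<Sum>j\<in>J. t j *\<^sub>R y j i)) < e"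
        using H[unfolded spread_tuples_dense_def, rule_format, of e "length xs" "\<lambda>i. qs_real (xs ! i)"] e
        by (auto simp: ext)
      have yq: "qs_real (qs_of (y j i)) = y j i" if "j \<in> J" "i < length xs" for i j
        using y that by (intro qs_real_of) auto
      have "\<forall>j\<in>J. real (length xs) - e < \<mu> (qs_of (\<Sum>i<length xs. qs_real (qs_of (y j i))))"
        unfolding ext'[OF sums] using Ny yq by simp
      moreover have "\<forall>i<length xs. \<mu> (qs_of (qs_real (xs ! i) - (\<Sum>j\<in>J. t j *\<^sub>R qs_real (qs_of (y j i))))) < e"
        unfolding ext'[OF diffs[OF J(2)]] using Nx yq by simp
      moreover have "\<forall>j\<in>J. \<forall>i<length xs. \<mu> (qs_of (y j i)) < 1" using y ext' by auto
      ultimately show "spread_condition xs e \<mu>"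
        unfolding spread_condition_def using J
        by (intro disjI2 exI[of _ J] exI[of _ t] exI[of _ "\<lambda>j i. qs_of (y j i)"]) simp
    qed
  next
    assume H: "\<forall>xs (n::nat). spread_condition xs (1 / (real n + 1)) \<mu>"
    show "spread_tuples_dense (range qs_real) (mu_bar \<mu>)"
      unfolding spread_tuples_dense_def
    proof (intro allI impI, elim conjE)
      fix m :: nat and x and \<epsilon> :: real
      assume \<epsilon>: "\<epsilon> > 0" and x: "\<forall>i<m. x i \<in> range qs_real \<and> mu_bar \<mu> (x i) < 1"
      \<comment> \<open>An error below every gap \<open>1 - mu_bar \<mu> (x i)\<close> excludes the
        first disjunct of \<open>spread_condition\<close>; below \<open>\<epsilon>\<close> it makes
        the second one strong enough.\<close>
      define d where "d = Min (insert \<epsilon> ((\<lambda>i. 1 - mu_bar \<mu> (x i)) ` {..<m}))"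
      have "d > 0" using \<epsilon> x by (auto simp: d_def)
      then obtain n :: nat where n: "1 / (real n + 1) < d" using reals_Archimedean[of d] by (auto simp: inverse_eq_divide add.commute)
      define e where "e = 1 / (real n + 1)"
      have ex: "e < 1 - mu_bar \<mu> (x i)" if "i < m" for i
        using n that by (auto simp: d_def e_def)
      have e\<epsilon>: "e \<le> \<epsilon>" using n by (auto simp: d_def e_def)
      define xs where "xs = map (\<lambda>i. qs_of (x i)) [0..<m]"
      have len: "length xs = m" and nth: "\<And>i. i < m \<Longrightarrow> xs ! i = qs_of (x i)" by (auto simp: xs_def)
      have "\<not> 1 - e < \<mu> (xs ! i)" if "i < m" for i
        using ex[OF that] ext'[of "x i"] x that by (force simp: nth)
      then obtain J :: "nat set" and t y where J: "finite J" "\<forall>j\<in>J. t j \<in> \<rat> \<and> 0 \<le> t j" "sum t J \<le> 1"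
        and y: "\<forall>j\<in>J. \<forall>i<m. \<mu> (y j i) < 1"
        and Ny: "\<forall>j\<in>J. real m - e < \<mu> (qs_of (\<Sum>i<m. qs_real (y j i)))"
        and Nx: "\<forall>i<m. \<mu> (qs_of (qs_real (xs ! i) - (\<Sum>j\<in>J. t j *\<^sub>R qs_real (y j i)))) < e"
        using H[rule_format, of xs n] unfolding spread_condition_def len e_def[symmetric] by blast
      have xq: "qs_real (xs ! i) = x i" if "i < m" for i
        using x that by (simp add: nth qs_real_of)
      have "\<forall>j\<in>J. real m - \<epsilon> < mu_bar \<mu> (\<Sum>i<m. qs_real (y j i))"
        using Ny e\<epsilon> unfolding ext'[OF sums] by force
      moreover have "\<forall>i<m. mu_bar \<mu> (x i - (\<Sum>j\<in>J. t j *\<^sub>R qs_real (y j i))) < \<epsilon>"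
        using Nx e\<epsilon> xq unfolding ext'[OF diffs[OF J(2)]] by force
      ultimately show "\<exists>(J::nat set) t y. finite J \<and> (\<forall>j\<in>J. t j \<in> \<rat> \<and> 0 \<le> t j) \<and> sum t J \<le> 1 \<and>
           (\<forall>j\<in>J. \<forall>i<m. y j i \<in> range qs_real \<and> mu_bar \<mu> (y j i) < 1) \<and>
           (\<forall>j\<in>J. real m - \<epsilon> < mu_bar \<mu> (\<Sum>i<m. y j i)) \<and>
           (\<forall>i<m. mu_bar \<mu> (x i - (\<Sum>j\<in>J. t j *\<^sub>R y j i)) < \<epsilon>)"
        using J y by (intro exI[of _ J] exI[of _ t] exI[of _ "\<lambda>j i. qs_real (y j i)"]) (simp add: ext)
    qed
  qed
qed

lemma gdelta_SD2P:
  assumes "I \<subseteq> P_set"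
  shows "gdelta_in (subtopology euclidean I) {\<mu> \<in> I. SD2P \<mu>}"
proof -
  define T where "T = (\<Inter>(xs, n) \<in> UNIV \<times> UNIV. {\<mu>. spread_condition xs (1 / (real (n::nat) + 1)) \<mu>})"
  have "countable (UNIV :: qseq list set)"
    using countable_lists[OF countable_qseq] by (simp add: lists_UNIV)
  then have "countable (UNIV \<times> UNIV :: (qseq list \<times> nat) set)" by (intro countable_SIGMA) auto
  then have "gdelta_in euclidean T"
    unfolding T_def using open_spread_condition
    by (intro gdelta_in_Inter) (auto intro!: open_imp_gdelta_in simp: open_openin[symmetric])
  moreover have "{\<mu> \<in> I. SD2P \<mu>} = T \<inter> I"
    using assms SD2P_iff_spread_condition by (auto simp: T_def P_set_def)
  ultimately show ?thesis unfolding gdelta_in_subtopology by blast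
qed

section \<open>Block norms\<close>

text \<open>\<open>b\<close> labels each coordinate with its block. A label that is not attained
  gives the zero seminorm, so the supremum below may run over all natural numbers.\<close>

definition block_l1 :: "(nat \<Rightarrow> nat) \<Rightarrow> nat \<Rightarrow> (nat \<Rightarrow> real) \<Rightarrow> real" where
  "block_l1 b k = weighted_l1 (\<lambda>n. of_bool (b n = k))"

definition block_norm :: "(nat \<Rightarrow> nat) \<Rightarrow> (nat \<Rightarrow> real) \<Rightarrow> real" where
  "block_norm b x = (if x \<in> c00 then (SUP k. block_l1 b k x) else 0)"

lemma seminormed_space_block_l1: "seminormed_space c00 (block_l1 b k)"
  unfolding block_l1_def by (rule seminormed_space_weighted_l1) simp

interpretation block: seminormed_space c00 "block_l1 b k" for b k
  by (rule seminormed_space_block_l1)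

lemma block_l1_eq:
  assumes "finite A" "\<And>n. n \<notin> A \<Longrightarrow> x n = 0"
  shows "block_l1 b k x = (\<Sum>n\<in>A. of_bool (b n = k) * \<bar>x n\<bar>)"
  unfolding block_l1_def using assms by (rule weighted_l1_eq)

lemma block_l1_le: 
  assumes x: "x \<in> c00"
  shows "block_l1 b k x \<le> block_norm b x"
proof -
  have "block_l1 b k x \<le> (\<Sum>n | x n \<noteq> 0. \<bar>x n\<bar>)" for k
    unfolding block_l1_def weighted_l1_def by (intro sum_mono) auto
  then have "bdd_above (range (\<lambda>k. block_l1 b k x))" by (intro bdd_aboveI2) auto
  then show ?thesis using x by (auto simp: block_norm_def intro: cSUP_upper)
qed

lemma block_norm_least:
  assumes "x \<in> c00" "\<And>k. block_l1 b k x \<le> C"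
  shows "block_norm b x \<le> C"
  using assms by (auto simp: block_norm_def intro: cSUP_least)

text \<open>Only the labels on the support of a vector matter, which is what makes the reduction
  continuous.\<close>

lemma block_norm_cong:
  assumes "\<And>n. x n \<noteq> 0 \<Longrightarrow> b n = b' n"
  shows "block_norm b x = block_norm b' x"
proof -
  have "block_l1 b k x = block_l1 b' k x" for k
    unfolding block_l1_def weighted_l1_def using assms by (intro sum.cong) auto
  then show ?thesis by (simp add: block_norm_def)
qed

lemma seminormed_space_block_norm: "seminormed_space c00 (block_norm b)"
proof (rule seminormed_spaceI)
  fix x y assume xy: "x \<in> c00" "y \<in> c00"
  show "block_norm b (x + y) \<le> block_norm b x + block_norm b y"
  proof (rule block_norm_least)
    show "x + y \<in> c00" using xy by (simp add: c00_mem)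
    show "block_l1 b k (x + y) \<le> block_norm b x + block_norm b y" for k
      using block.triangle[OF xy, of b k] block_l1_le[OF xy(1), of b k] block_l1_le[OF xy(2), of b k]
      by linarith
  qed
next
  fix c x assume x: "x \<in> c00"
  show "block_norm b (c *\<^sub>R x) \<le> \<bar>c\<bar> * block_norm b x"
  proof (rule block_norm_least)
    show "c *\<^sub>R x \<in> c00" using x by (simp add: c00_mem)
    show "block_l1 b k (c *\<^sub>R x) \<le> \<bar>c\<bar> * block_norm b x" for k
      using block.scale[OF x] block_l1_le[OF x] by (simp add: mult_left_mono)
  qed
qed (rule subspace_c00)

interpretation blocks: seminormed_space c00 "block_norm b" for b
  by (rule seminormed_space_block_norm)

text \<open>Isolates one coordinate inside its own block; it bounds the coordinate by the norm and
  also the rest of the block by what the coordinate leaves over.\<close>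

lemma block_l1_split:
  assumes x: "x \<in> c00"
  shows "block_l1 b (b p) x = \<bar>x p\<bar> + block_l1 b (b p) (x - x p *\<^sub>R unit_vec p)"
proof -
  define A where "A = {n. x n \<noteq> 0}"
  have A: "finite (insert p A)" "\<And>n. n \<notin> insert p A \<Longrightarrow> x n = 0"
    using x by (auto simp: A_def c00_def)
  have "block_l1 b (b p) x = \<bar>x p\<bar> + (\<Sum>n\<in>insert p A - {p}. of_bool (b n = b p) * \<bar>x n\<bar>)"
    using sum.remove[of "insert p A" p "\<lambda>n. of_bool (b n = b p) * \<bar>x n\<bar>"] A(1)
    by (subst block_l1_eq[OF A]) (simp_all only: insertI1 simp_thms of_bool_eq mult_1)
  also have "(\<Sum>n\<in>insert p A - {p}. of_bool (b n = b p) * \<bar>x n\<bar>) =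
      (\<Sum>n\<in>insert p A - {p}. of_bool (b n = b p) * \<bar>(x - x p *\<^sub>R unit_vec p) n\<bar>)"
    by (intro sum.cong) (auto simp: unit_vec_def)
  also have "\<dots> = block_l1 b (b p) (x - x p *\<^sub>R unit_vec p)"
    using A by (intro block_l1_eq[symmetric]) (auto simp: unit_vec_def)
  finally show ?thesis .
qed

lemma coord_le_block_norm: "x \<in> c00 \<Longrightarrow> \<bar>x p\<bar> \<le> block_norm b x"
  using block_l1_split[of x b p] block_l1_le[of x b "b p"] unit_vec_c00[of p]
    block.N_nonneg[of "x - x p *\<^sub>R unit_vec p" b "b p"]
  by (simp add: c00_mem)

lemma block_l1_unit_vec: "block_l1 b k (unit_vec p) = of_bool (b p = k)"
  by (subst block_l1_eq[of "{p}"]) (auto simp: unit_vec_def)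

text \<open>Perturb a tuple by the same unit vector in an unused block and average over many such blocks.\<close>

lemma spread_block_norm_if_infinite:
  assumes inf: "infinite (range b)"
  shows "spread_tuples_dense c00 (block_norm b)"
  unfolding spread_tuples_dense_def
proof (intro allI impI, elim conjE)
  fix m :: nat and x and \<epsilon> :: real
  assume \<epsilon>: "\<epsilon> > 0" and x: "\<forall>i<m. x i \<in> c00 \<and> block_norm b (x i) < 1"
  define A where "A = (\<Union>i<m. {n. x i n \<noteq> 0})"
  have A: "finite A" using x by (auto simp: A_def c00_def)
  obtain n :: nat where n: "1 / (real n + 1) < \<epsilon>"
    using reals_Archimedean[OF \<epsilon>] by (auto simp: inverse_eq_divide add.commute)
  have "infinite (range b - b ` A)" using inf A by simp
  then obtain T where T: "finite T" "card T = n + 1" "T \<subseteq> range b - b ` A"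
    using infinite_arbitrarily_large by metis
  define g where "g k = (SOME p. b p = k)" for k
  have g: "b (g k) = k" if "k \<in> T" for k
    using T that someI_ex[of "\<lambda>p. b p = k"] by (auto simp: g_def)
  have gA: "x i p = 0" if "b p \<in> T" "i < m" for p i
    using T that by (auto simp: A_def)
  \<comment> \<open>The added vector has length \<open>1 - d < 1\<close>, as the open ball demands,
    and the sum of \<open>m\<close> of them still exceeds \<open>m - \<epsilon>\<close>.\<close>
  define d where "d = min (1 / 2) (\<epsilon> / (real m + 1))"
  have d: "0 < d" "d < 1" using \<epsilon> by (auto simp: d_def min_def)
  have "real m * d \<le> real m * (\<epsilon> / (real m + 1))" by (intro mult_left_mono) (auto simp: d_def)
  also have "\<dots> < \<epsilon>" using \<epsilon> by (simp add: field_simps)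
  finally have md: "real m * d < \<epsilon>" .
  define y where "y k i = x i + (1 - d) *\<^sub>R unit_vec (g k)" for k i
  have yc: "y k i \<in> c00" if "i < m" for k i using x that by (auto simp: y_def c00_mem unit_vec_c00)
  have y1: "block_norm b (y k i) < 1" if k: "k \<in> T" and i: "i < m" for k i
  proof -
    have xi: "x i \<in> c00" using x i by simp
    \<comment> \<open>Block \<open>k\<close> contains nothing of \<open>x i\<close>, so the two
      summands of \<open>y k i\<close> live in different blocks and the norms combine by a
      maximum.\<close>
    have "block_norm b (y k i) \<le> max (block_norm b (x i)) (1 - d)"
    proof (rule block_norm_least[OF yc[OF i]])
      fix l
      have "block_l1 b l (y k i) \<le> block_l1 b l (x i) + block_l1 b l ((1 - d) *\<^sub>R unit_vec (g k))"
        unfolding y_def using xi by (intro block.triangle) (auto simp: c00_mem unit_vec_c00)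
      also have "block_l1 b l ((1 - d) *\<^sub>R unit_vec (g k)) = (1 - d) * of_bool (k = l)"
        using d k by (simp add: block.scale unit_vec_c00 block_l1_unit_vec g)
      finally have *: "block_l1 b l (y k i) \<le> block_l1 b l (x i) + (1 - d) * of_bool (k = l)" .
      show "block_l1 b l (y k i) \<le> max (block_norm b (x i)) (1 - d)"
      proof (cases "k = l")
        case True
        have "block_l1 b l (x i) = 0"
          unfolding block_l1_def weighted_l1_def using gA k i True by (intro sum.neutral) auto
        then show ?thesis using * True by simp
      next
        case False
        then show ?thesis using * block_l1_le[OF xi, of b l] by simp
      qed
    qed
    then show ?thesis using x i d by (auto simp: max_def split: if_splits)
  qed
  have y2: "real m - \<epsilon> < block_norm b (\<Sum>i<m. y k i)" if k: "k \<in> T" for k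
  proof -
    have "(\<Sum>i<m. y k i) (g k) = (\<Sum>i<m. 1 - d)"
      unfolding sum_fun_apply using gA g[OF k] k by (intro sum.cong) (auto simp: y_def unit_vec_def)
    then have "(\<Sum>i<m. y k i) (g k) = real m - real m * d" by (simp add: algebra_simps)
    moreover have "(\<Sum>i<m. y k i) \<in> c00" using yc by (intro blocks.mem_sum) auto
    ultimately show ?thesis using coord_le_block_norm[of "\<Sum>i<m. y k i" "g k" b] md by simp
  qed
  define t where "t k = 1 / (real n + 1)" for k :: nat
  have t: "\<forall>k\<in>T. t k \<in> \<rat> \<and> 0 \<le> t k" "sum t T = 1" using T by (simp_all add: t_def)
  have y3: "block_norm b (x i - (\<Sum>k\<in>T. t k *\<^sub>R y k i)) < \<epsilon>" if i: "i < m" for i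
  proof -
    \<comment> \<open>The weights sum to 1, so \<open>x i\<close> cancels. The rest is
      \<open>(1 - d) / (n + 1)\<close> times \<open>w\<close>, which has at most one unit vector in
      each block.\<close>
    define w where "w = (\<Sum>k\<in>T. unit_vec (g k))"
    have w: "w \<in> c00" unfolding w_def by (intro blocks.mem_sum unit_vec_c00)
    have "(\<Sum>k\<in>T. t k *\<^sub>R y k i) = (\<Sum>k\<in>T. t k) *\<^sub>R x i + ((1 - d) / (real n + 1)) *\<^sub>R w"
      unfolding w_def scaleR_sum_left scaleR_sum_right sum.distrib[symmetric]
      by (intro sum.cong) (simp_all add: y_def t_def scaleR_add_right)
    then have eq: "x i - (\<Sum>k\<in>T. t k *\<^sub>R y k i) = (- ((1 - d) / (real n + 1))) *\<^sub>R w"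
      using t(2) by simp
    have "block_norm b w \<le> 1"
    proof (rule block_norm_least[OF w])
      fix l
      have "block_l1 b l w \<le> (\<Sum>k\<in>T. block_l1 b l (unit_vec (g k)))"
        unfolding w_def by (intro block.N_sum unit_vec_c00)
      also have "\<dots> = (\<Sum>k\<in>T. of_bool (k = l))"
        by (intro sum.cong) (auto simp: block_l1_unit_vec g)
      also have "\<dots> \<le> 1" using T by (simp add: of_bool_def sum.delta')
      finally show "block_l1 b l w \<le> 1" .
    qed
    then have "\<bar>(1 - d) / (real n + 1)\<bar> * block_norm b w \<le> \<bar>(1 - d) / (real n + 1)\<bar>"
      by (intro mult_left_le) auto
    also have "\<dots> \<le> 1 / (real n + 1)" using d by (simp add: divide_right_mono)
    finally show ?thesis using n unfolding eq blocks.scale[OF w] by simp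
  qed
  show "\<exists>(J::nat set) t y. finite J \<and> (\<forall>j\<in>J. t j \<in> \<rat> \<and> 0 \<le> t j) \<and> sum t J \<le> 1 \<and>
           (\<forall>j\<in>J. \<forall>i<m. y j i \<in> c00 \<and> block_norm b (y j i) < 1) \<and>
           (\<forall>j\<in>J. real m - \<epsilon> < block_norm b (\<Sum>i<m. y j i)) \<and>
           (\<forall>i<m. block_norm b (x i - (\<Sum>j\<in>J. t j *\<^sub>R y j i)) < \<epsilon>)"
    using T(1) t y1 y2 y3 yc by (intro exI[of _ T] exI[of _ t] exI[of _ y]) simp
qed

text \<open>Off \<open>p\<close>, the two vectors have mass less than
  \<open>1 - \<bar>y p\<bar>\<close> and \<open>1 - \<bar>z p\<bar>\<close> in the block; at
  \<open>p\<close> they cancel up to less than 1/3, because \<open>y p\<close> and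
  \<open>- z p\<close> both lie between 2/3 and 1. Together this is below
  \<open>2 - 4/3 + 1/3 = 1\<close>, which is the origin of the threshold 2/3.\<close>

lemma block_l1_opposite_le:
  assumes y: "y \<in> c00" "block_norm b y < 1" "y p > 2 / 3"
    and z: "z \<in> c00" "block_norm b z < 1" "- z p > 2 / 3"
  shows "block_l1 b (b p) (y + z) \<le> 1"
proof -
  define y' z' where "y' = y - y p *\<^sub>R unit_vec p" and "z' = z - z p *\<^sub>R unit_vec p"
  have m: "y' \<in> c00" "z' \<in> c00" using y z by (auto simp: y'_def z'_def c00_mem unit_vec_c00)
  have 1: "block_l1 b (b p) y' < 1 - \<bar>y p\<bar>" "block_l1 b (b p) z' < 1 - \<bar>z p\<bar>"
    using block_l1_split[OF y(1), of b p] block_l1_le[OF y(1), of b "b p"] y(2)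
      block_l1_split[OF z(1), of b p] block_l1_le[OF z(1), of b "b p"] z(2)
    by (auto simp: y'_def z'_def)
  have eq: "y + z = (y' + z') + (y p + z p) *\<^sub>R unit_vec p"
    by (simp add: y'_def z'_def scaleR_add_left)
  have "block_l1 b (b p) ((y p + z p) *\<^sub>R unit_vec p) = \<bar>y p + z p\<bar>"
    by (subst block.scale[OF unit_vec_c00]) (simp add: block_l1_unit_vec)
  moreover have "block_l1 b (b p) (y + z) \<le>
      block_l1 b (b p) (y' + z') + block_l1 b (b p) ((y p + z p) *\<^sub>R unit_vec p)"
    unfolding eq using m by (intro block.triangle) (auto simp: c00_mem unit_vec_c00)
  ultimately have "block_l1 b (b p) (y + z) \<le> block_l1 b (b p) y' + block_l1 b (b p) z' + \<bar>y p + z p\<bar>"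
    using block.triangle[OF m, of b "b p"] by linarith
  then show ?thesis
    using 1 y z coord_le_block_norm[OF y(1), of p b] coord_le_block_norm[OF z(1), of p b] by linarith
qed

text \<open>With one coordinate \<open>p i\<close> chosen in each of the \<open>r\<close> blocks, consider the slices given by the \<open>2 r\<close>
  functionals \<open>\<plusminus> e\<^sup>*\<^sub>p\<^sub>i\<close>: in every block the two points belonging to that block nearly cancel.\<close>

lemma not_spread_block_norm_if_finite:
  assumes fin: "finite (range b)"
  shows "\<not> spread_tuples_dense c00 (block_norm b)"
proof
  assume spread: "spread_tuples_dense c00 (block_norm b)"
  define r where "r = card (range b)"
  have r: "r > 0" using fin by (simp add: r_def card_gt_0_iff)
  obtain h where h: "bij_betw h {..<r} (range b)"
    using ex_bij_betw_nat_finite[OF fin] by (auto simp: r_def atLeast0LessThan)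
  define p where "p i = (SOME n. b n = h i)" for i
  have p: "b (p i) = h i" if "i < r" for i
  proof -
    have "h i \<in> range b" using h that by (auto simp: bij_betw_def)
    then have "\<exists>n. b n = h i" by (metis imageE)
    then show ?thesis unfolding p_def by (rule someI_ex)
  qed
  define m where "m = r + r"
  \<comment> \<open>Indices \<open>i\<close> and \<open>r + i\<close> use the same coordinate
    \<open>p i\<close>, with opposite signs \<open>\<sigma>\<close>.\<close>
  define q where "q i = (if i < r then p i else p (i - r))" for i
  define \<sigma> :: "nat \<Rightarrow> real" where "\<sigma> i = (if i < r then 1 else - 1)" for i
  have \<sigma>: "\<bar>\<sigma> i\<bar> = 1" for i by (auto simp: \<sigma>_def)
  \<comment> \<open>With \<open>m * e = 1 / 8\<close> the coordinates of the combination keep a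
    signed sum of at least \<open>m - 1 / 4\<close>, hence above \<open>m - 1 / 3\<close>; by
    \<open>sum_near_max\<close> each one in the selected tuple then passes the threshold 2/3 of
    \<open>block_l1_opposite_le\<close>.\<close>
  define e where "e = 1 / (8 * real m)"
  have m: "m > 0" using r by (simp add: m_def)
  have e: "0 < e" "e < 1" "real m * e = 1 / 8" using m by (auto simp: e_def field_simps)
  define x where "x i = ((1 - e) * \<sigma> i) *\<^sub>R unit_vec (q i)" for i
  have xc: "x i \<in> c00" for i by (simp add: x_def c00_mem unit_vec_c00)
  have "block_norm b (unit_vec n) \<le> 1" for n
    by (rule block_norm_least[OF unit_vec_c00]) (simp add: block_l1_unit_vec)
  then have le: "(1 - e) * block_norm b (unit_vec n) \<le> 1 - e" for n
    using e by (intro mult_left_le) auto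
  have x1: "block_norm b (x i) < 1" for i
  proof -
    have "block_norm b (x i) = (1 - e) * block_norm b (unit_vec (q i))"
      unfolding x_def using e \<sigma>[of i] by (subst blocks.scale[OF unit_vec_c00]) (simp add: abs_mult)
    then show ?thesis using le[of "q i"] e by linarith
  qed
  obtain J :: "nat set" and t y where J: "finite J" and t: "\<forall>j\<in>J. t j \<in> \<rat> \<and> 0 \<le> t j" "sum t J \<le> 1"
    and y: "\<forall>j\<in>J. \<forall>i<m. y j i \<in> c00 \<and> block_norm b (y j i) < 1"
    and Ny: "\<forall>j\<in>J. real m - e < block_norm b (\<Sum>i<m. y j i)"
    and Nx: "\<forall>i<m. block_norm b (x i - (\<Sum>j\<in>J. t j *\<^sub>R y j i)) < e"
    using spread[unfolded spread_tuples_dense_def, rule_format, of e m x] xc x1 e by blast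
  define w where "w j = (\<Sum>i<m. \<sigma> i * y j i (q i))" for j
  have "real m - 1 / 3 < (\<Sum>i<m. 1 - 2 * e)" using e by (simp add: right_diff_distrib)
  also have "\<dots> \<le> (\<Sum>i<m. \<sigma> i * (\<Sum>j\<in>J. t j *\<^sub>R y j i) (q i))"
  proof (intro sum_mono)
    fix i assume "i \<in> {..<m}"
    then have i: "i < m" by simp
    define k where "k = (\<Sum>j\<in>J. t j *\<^sub>R y j i)"
    have k: "k \<in> c00" unfolding k_def using y i by (intro blocks.mem_sum) (auto simp: c00_mem)
    have "\<bar>(x i - k) (q i)\<bar> \<le> block_norm b (x i - k)"
      using k xc by (intro coord_le_block_norm c00_mem)
    then have "\<bar>(x i - k) (q i)\<bar> < e" using Nx i by (auto simp: k_def)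
    moreover have "x i (q i) = (1 - e) * \<sigma> i" by (simp add: x_def unit_vec_def)
    ultimately have "\<bar>(1 - e) * \<sigma> i - k (q i)\<bar> < e" by simp
    then show "1 - 2 * e \<le> \<sigma> i * (\<Sum>j\<in>J. t j *\<^sub>R y j i) (q i)"
      unfolding k_def[symmetric] by (auto simp: \<sigma>_def split: if_splits)
  qed
  also have "\<dots> = (\<Sum>i<m. \<Sum>j\<in>J. t j * (\<sigma> i * y j i (q i)))"
    by (simp add: sum_fun_apply sum_distrib_left mult.left_commute)
  also have "\<dots> = (\<Sum>j\<in>J. t j * w j)" by (subst sum.swap) (simp add: w_def sum_distrib_left)
  finally have "\<exists>j\<in>J. real m - 1 / 3 < w j"
    using t m by (intro subconvex_pigeonhole[of J t]) auto
  then obtain j where j: "j \<in> J" "real m - 1 / 3 < w j" by blast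
  have yj: "y j i \<in> c00" "block_norm b (y j i) < 1" if "i < m" for i using y j that by auto
  have "\<sigma> i * y j i (q i) \<le> 1" if "i < m" for i
    using coord_le_block_norm[OF yj(1)[OF that], of "q i" b] yj(2)[OF that] by (auto simp: \<sigma>_def)
  then have big: "2 / 3 < \<sigma> i * y j i (q i)" if "i < m" for i
    using sum_near_max[of m "\<lambda>i. \<sigma> i * y j i (q i)" "1 / 3" i] j that by (auto simp: w_def)
  have "block_norm b (\<Sum>i<m. y j i) \<le> real m - 1"
  proof (rule block_norm_least)
    show "(\<Sum>i<m. y j i) \<in> c00" using yj by (intro blocks.mem_sum) auto
    fix l
    show "block_l1 b l (\<Sum>i<m. y j i) \<le> real m - 1"
    proof (cases "l \<in> range b")
      case False
      then have "block_l1 b l (\<Sum>i<m. y j i) = 0"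
        unfolding block_l1_def weighted_l1_def by (intro sum.neutral) auto
      then show ?thesis using m by simp
    next
      case True
      then obtain i where i: "i < r" "h i = l" using h by (metis bij_betw_imp_surj_on imageE lessThan_iff)
      then have l: "l = b (p i)" using p by simp
      \<comment> \<open>In block \<open>l\<close> the pair \<open>i\<close>, \<open>r + i\<close>
        contributes at most 1 instead of 2, so the total is at most \<open>(m - 2) + 1\<close>.
        Every block has such a pair, so the norm misses \<open>m\<close> by at least 1.\<close>
      define R where "R = {..<m} - {i, r + i}"
      have sub: "{i, r + i} \<subseteq> {..<m}" "i \<noteq> r + i" using i by (auto simp: m_def)
      have cR: "real (card R) = real m - 2"
        unfolding R_def using sub by (subst card_Diff_subset) (auto simp: m_def of_nat_diff)
      have eq: "(\<Sum>i<m. y j i) = (\<Sum>i\<in>R. y j i) + (y j i + y j (r + i))"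
        unfolding R_def using sub by (subst sum.subset_diff[of "{i, r + i}"]) auto
      have "block_l1 b l (\<Sum>i<m. y j i) \<le> block_l1 b l (\<Sum>i\<in>R. y j i) + block_l1 b l (y j i + y j (r + i))"
        unfolding eq using yj sub by (intro block.triangle blocks.mem_sum c00_mem) (auto simp: R_def)
      moreover have "block_l1 b l (y j i + y j (r + i)) \<le> 1"
        unfolding l using big[of i] big[of "r + i"] sub yj[of i] yj[of "r + i"] i
        by (intro block_l1_opposite_le) (auto simp: \<sigma>_def q_def)
      moreover have "block_l1 b l (\<Sum>i\<in>R. y j i) \<le> (\<Sum>i\<in>R. block_l1 b l (y j i))"
        using yj by (intro block.N_sum) (auto simp: R_def)
      moreover have "\<dots> \<le> (\<Sum>i\<in>R. 1)"
      proof (intro sum_mono)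
        fix i assume "i \<in> R"
        then have "i < m" by (auto simp: R_def)
        then show "block_l1 b l (y j i) \<le> 1" using block_l1_le[OF yj(1), of i b l] yj(2)[of i] by linarith
      qed
      moreover have "(\<Sum>i\<in>R. 1) = real m - 2" using cR by simp
      ultimately show ?thesis by linarith
    qed
  qed
  then show False using Ny j e by force
qed

section \<open>Codes of the block norms\<close>

definition block_code :: "(nat \<Rightarrow> nat) \<Rightarrow> qseq \<Rightarrow> real" where
  "block_code b v = block_norm b (qs_real v)"

lemma seminorm_V_block_code: "seminorm_V (block_code b)"
  unfolding seminorm_V_def block_code_def qs_real_add qs_real_scale
  using blocks.triangle blocks.scale qs_real_c00 by auto

lemma mu_bar_block_code: "mu_bar (block_code b) = block_norm b"
  by (rule mu_bar_unique) (auto simp: seminormed_space_block_norm block_code_def block_norm_def)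

lemma SD2P_block_code: "SD2P (block_code b) \<longleftrightarrow> infinite (range b)"
  using SD2P_iff_c00[OF seminorm_V_block_code] spread_block_norm_if_infinite
    not_spread_block_norm_if_finite by (auto simp: mu_bar_block_code)

lemma block_norm_eq_0: "x \<in> c00 \<Longrightarrow> block_norm b x = 0 \<Longrightarrow> x = (\<lambda>_. 0)"
  using coord_le_block_norm[of x _ b] by (auto simp: fun_eq_iff)

text \<open>The unit vectors are independent in the completion because the block norm dominates
  every coordinate. Landing in the smallest parameter set lets one reduction serve all
  three.\<close>

lemma block_code_B_set: "block_code b \<in> B_set"
proof -
  have "Xinfdim (block_code b)"
    unfolding Xinfdim_def
  proof
    fix m
    define x where "x i = (\<lambda>_::nat. unit_vec i)" for i
    have "\<forall>i<m. x i \<in> Xcarrier (block_code b)"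
      unfolding x_def by (intro allI impI const_Xcarrier seminorm_V_block_code unit_vec_c00)
    moreover have "c i = 0" if zero: "Xnorm (block_code b) (Xlincomb m c x) = 0" and i: "i < m" for c i
    proof -
      define u where "u = (\<Sum>i<m. c i *\<^sub>R unit_vec i)"
      have u: "u \<in> c00" unfolding u_def by (intro blocks.mem_sum c00_mem unit_vec_c00)
      have "Xlincomb m c x = (\<lambda>_. u)"
        by (simp add: Xlincomb_def x_def u_def fun_eq_iff sum_fun_apply)
      then have "block_norm b u = 0"
        using zero Xnorm_const[OF seminorm_V_block_code] by (simp add: mu_bar_block_code)
      then have "u i = 0" using block_norm_eq_0[OF u] by (simp add: fun_eq_iff)
      then show "c i = 0"
        using i by (simp add: u_def sum_fun_apply unit_vec_def if_distrib[of "\<lambda>v. _ * v"] cong: if_cong)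
    qed
    ultimately show "\<exists>x. (\<forall>i<m. x i \<in> Xcarrier (block_code b)) \<and>
        (\<forall>c. Xnorm (block_code b) (Xlincomb m c x) = 0 \<longrightarrow> (\<forall>i<m. c i = 0))" by blast
  qed
  then show ?thesis
    using seminorm_V_block_code block_norm_eq_0
    by (auto simp: B_set_def Pinf_set_def P_set_def mu_bar_block_code)
qed

section \<open>Zero-dimensional Polish spaces and the reduction\<close>

lemma polish_top_second_countable:
  assumes "polish_top W"
  shows "second_countable W"
proof -
  have "metrizable_space W" "separable_space W"
    using assms completely_metrizable_imp_metrizable_space by (auto simp: polish_top_def)
  then obtain M d where M: "Metric_space M d" "W = Metric_space.mtopology M d"
    by (auto simp: metrizable_space_def)
  interpret Metric_space M d by fact
  obtain C where C: "countable C" "C \<subseteq> M" "mtopology closure_of C = M"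
    using \<open>separable_space W\<close> by (auto simp: separable_space_def M(2))
  define \<B> where "\<B> = (\<lambda>(c, n::nat). mball c (1 / (real n + 1))) ` (C \<times> UNIV)"
  have "\<exists>V\<in>\<B>. x \<in> V \<and> V \<subseteq> U" if U: "openin mtopology U" and x: "x \<in> U" for U x
  proof -
    obtain r where r: "r > 0" "mball x r \<subseteq> U" using U x by (auto simp: openin_mtopology)
    have xM: "x \<in> M" using U x openin_subset by fastforce
    obtain n :: nat where n: "1 / (real n + 1) < r / 2"
      using reals_Archimedean[of "r / 2"] r by (auto simp: inverse_eq_divide add.commute)
    have "x \<in> mtopology closure_of C" using C xM by simp
    then obtain c where c: "c \<in> C" "c \<in> mball x (1 / (real n + 1))"
      by (auto simp: metric_closure_of Bex_def dest!: spec[of _ "1 / (real n + 1)"])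
    have "mball c (1 / (real n + 1)) \<subseteq> mball x r"
    proof
      fix z assume "z \<in> mball c (1 / (real n + 1))"
      then show "z \<in> mball x r"
        using c xM n triangle[of x c z] by (auto simp: commute)
    qed
    moreover have "x \<in> mball c (1 / (real n + 1))" using c by (auto simp: commute)
    ultimately show ?thesis using c r by (intro bexI[of _ "mball c (1 / (real n + 1))"]) (auto simp: \<B>_def)
  qed
  moreover have "countable \<B>" using C(1) by (auto simp: \<B>_def)
  moreover have "\<forall>V\<in>\<B>. openin mtopology V" by (auto simp: \<B>_def)
  ultimately show ?thesis unfolding second_countable_def M(2) by blast
qed

text \<open>The Lindelof property yields a countable clopen cover, and making it disjoint uses only
  finite Boolean operations at each index. Disjointness will bound how often a point is
  counted.\<close>

lemma open_eq_disjoint_clopen_union: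
  assumes W: "polish_top W" "W dim_le 0" and U: "openin W U"
  obtains C :: "nat \<Rightarrow> 'a set"
  where "\<And>k. openin W (C k)" "\<And>k. closedin W (C k)" "disjoint_family C" "(\<Union>k. C k) = U"
proof -
  define \<U> where "\<U> = {V. openin W V \<and> closedin W V \<and> V \<subseteq> U}"
  have cover: "U \<subseteq> \<Union>\<U>"
  proof
    fix x assume "x \<in> U"
    moreover have "neighbourhood_base_of (\<lambda>V. closedin W V \<and> openin W V) W"
      using W(2) by (simp add: dimension_le_0_neighbourhood_base_of_clopen)
    ultimately obtain V where "closedin W V" "openin W V" "x \<in> V" "V \<subseteq> U"
      using U unfolding neighbourhood_base_of by (meson subsetD)
    then show "x \<in> \<Union>\<U>" by (auto simp: \<U>_def)
  qed
  have "Lindelof_space (subtopology W U)"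
    using polish_top_second_countable[OF W(1)]
    by (intro second_countable_imp_Lindelof_space second_countable_subtopology)
  then have "\<exists>\<V>. countable \<V> \<and> \<V> \<subseteq> \<U> \<and> U \<subseteq> \<Union>\<V>"
    using cover by (subst (asm) Lindelof_space_subtopology_subset[OF openin_subset[OF U]]) (auto simp: \<U>_def)
  then obtain \<V> where \<V>: "countable \<V>" "\<V> \<subseteq> \<U>" "U \<subseteq> \<Union>\<V>" by blast
  \<comment> \<open>The empty set is inserted so that the family can be enumerated even when it is
    empty.\<close>
  define B where "B = from_nat_into (insert {} \<V>)"
  have rB: "range B = insert {} \<V>" unfolding B_def using \<V>(1) by (intro range_from_nat_into) auto
  have "B k \<in> insert {} \<V>" for k using rB by blast
  moreover have "openin W V \<and> closedin W V \<and> V \<subseteq> U" if "V \<in> insert {} \<V>" for V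
    using \<V>(2) that by (auto simp: \<U>_def)
  ultimately have B: "openin W (B k)" "closedin W (B k)" "B k \<subseteq> U" for k by blast+
  show thesis
  proof (rule that)
    show "openin W (disjointed B k)" for k
      unfolding disjointed_def using B by (intro openin_diff closedin_Union) auto
    show "closedin W (disjointed B k)" for k
      unfolding disjointed_def using B by (intro closedin_diff openin_Union) auto
    show "disjoint_family (disjointed B)" by (rule disjoint_family_disjointed)
    have "(\<Union>k. B k) = \<Union>\<V>" using rB by simp
    then have "U \<subseteq> (\<Union>k. B k)" using \<V>(3) by simp
    moreover have "(\<Union>k. B k) \<subseteq> U" by (rule UN_least) (rule B(3))
    ultimately have "(\<Union>k. B k) = U" by (rule antisym[rotated])
    then show "(\<Union>k. disjointed B k) = U" by (simp add: UN_disjointed_eq)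
  qed
qed

text \<open>Each set of a decreasing open sequence is split into disjoint clopen pieces. A point of
  \<open>G\<close> meets a piece on every level; any other point meets none from some level on, and
  at most one on each earlier level.\<close>

lemma gdelta_eq_infinitely_many_clopen:
  assumes W: "polish_top W" "W dim_le 0" and G: "gdelta_in W G"
  obtains A :: "nat \<Rightarrow> 'a set"
  where "\<And>i. openin W (A i)" "\<And>i. closedin W (A i)"
    "\<And>w. w \<in> topspace W \<Longrightarrow> w \<in> G \<longleftrightarrow> infinite {i. w \<in> A i}"
proof -
  obtain U where U: "\<And>n. openin W (U n)" "\<And>n. U (Suc n) \<subseteq> U n" "\<Inter>(range U) = G"
    using G by (auto simp: gdelta_in_descending)
  have "\<exists>C :: nat \<Rightarrow> 'a set. (\<forall>k. openin W (C k)) \<and> (\<forall>k. closedin W (C k)) \<and> disjoint_family C \<and> (\<Union>k. C k) = U n" for n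
    using open_eq_disjoint_clopen_union[OF W U(1)] by metis
  then obtain C :: "nat \<Rightarrow> nat \<Rightarrow> 'a set" where C: "\<And>n k. openin W (C n k)" "\<And>n k. closedin W (C n k)"
    "\<And>n. disjoint_family (C n)" "\<And>n. (\<Union>k. C n k) = U n" by metis
  define A where "A i = (case prod_decode i of (n, k) \<Rightarrow> C n k)" for i
  have anti: "U n \<subseteq> U m" if "m \<le> n" for m n using lift_Suc_antimono_le[of U] U(2) that by blast
  have A_enc: "A (prod_encode (n, k)) = C n k" for n k by (simp add: A_def)
  show thesis
  proof (rule that)
    show "openin W (A i)" "closedin W (A i)" for i by (simp_all add: A_def C split: prod.split)
    fix w assume "w \<in> topspace W"
    show "w \<in> G \<longleftrightarrow> infinite {i. w \<in> A i}"
    proof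
      assume "w \<in> G"
      then have "\<forall>n. \<exists>k. w \<in> C n k" using U(3) C(4) by blast
      then obtain k where k: "\<And>n. w \<in> C n (k n)" by metis
      have "inj (\<lambda>n. prod_encode (n, k n))" by (auto intro!: injI)
      then have "infinite (range (\<lambda>n. prod_encode (n, k n)))" by (rule range_inj_infinite)
      moreover have "range (\<lambda>n. prod_encode (n, k n)) \<subseteq> {i. w \<in> A i}" using k by (auto simp: A_enc)
      ultimately show "infinite {i. w \<in> A i}" by (rule infinite_super[rotated])
    next
      assume inf: "infinite {i. w \<in> A i}"
      show "w \<in> G"
      proof (rule ccontr)
        assume "w \<notin> G"
        then obtain m where m: "w \<notin> U m" using U(3) by blast
        have nC: "w \<notin> C n k" if "m \<le> n" for n k using C(4)[of n] anti[OF that] m by blast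
        have fin: "finite {k. w \<in> C n k}" for n
        proof (cases "\<exists>k. w \<in> C n k")
          case True
          then obtain k where k: "w \<in> C n k" by blast
          have "{k. w \<in> C n k} \<subseteq> {k}"
            using C(3)[of n] k unfolding disjoint_family_on_def by blast
          then show ?thesis by (rule finite_subset) simp
        qed simp
        have "{i. w \<in> A i} \<subseteq> prod_encode ` (SIGMA n:{..<m}. {k. w \<in> C n k})"
        proof
          fix i assume "i \<in> {i. w \<in> A i}"
          moreover obtain n k where i: "i = prod_encode (n, k)" by (metis prod_decode_inverse surj_pair)
          ultimately have "w \<in> C n k" by (simp add: A_enc)
          then show "i \<in> prod_encode ` (SIGMA n:{..<m}. {k. w \<in> C n k})"
            using i nC[of n k] by (intro image_eqI[of _ _ "(n, k)"]) (auto simp: not_le[symmetric])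
        qed
        then have "finite {i. w \<in> A i}" by (rule finite_subset) (auto intro!: fin)
        then show False using inf by simp
      qed
    qed
  qed
qed

text \<open>The counting function is the block label: it increases exactly at the members of
  \<open>D\<close>, so the blocks are the intervals between consecutive separators and there are
  infinitely many iff \<open>D\<close> is infinite.\<close>

lemma infinite_range_card_iff:
  fixes D :: "nat set"
  shows "infinite (range (\<lambda>j. card {i\<in>D. i \<le> j})) \<longleftrightarrow> infinite D"
proof
  assume "infinite (range (\<lambda>j. card {i\<in>D. i \<le> j}))"
  moreover have "range (\<lambda>j. card {i\<in>D. i \<le> j}) \<subseteq> {..card D}" if "finite D"
    using that by (auto intro: card_mono)
  ultimately show "infinite D" using finite_subset by blast
next
  assume inf: "infinite D"
  show "infinite (range (\<lambda>j. card {i\<in>D. i \<le> j}))"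
    unfolding infinite_nat_iff_unbounded_le
  proof
    fix n
    obtain T where T: "finite T" "card T = n" "T \<subseteq> D" using infinite_arbitrarily_large[OF inf] by metis
    then obtain j where j: "\<And>i. i \<in> T \<Longrightarrow> i \<le> j" by (meson finite_nat_set_iff_bounded_le)
    have "card T \<le> card {i\<in>D. i \<le> j}" using T j by (intro card_mono) auto
    then show "\<exists>k\<ge>n. k \<in> range (\<lambda>j. card {i\<in>D. i \<le> j})" using T by auto
  qed
qed

text \<open>The label of coordinate \<open>j\<close> depends only on membership in
  \<open>A 0\<close>, ..., \<open>A j\<close>. Hence each coordinate of the code is a locally
  constant function of \<open>w\<close>.\<close>

lemma continuous_map_block_code:
  assumes A: "\<And>i. openin W (A i)" "\<And>i. closedin W (A i)"
  shows "continuous_map W euclidean (\<lambda>w. block_code (\<lambda>j. card {i \<in> {i. w \<in> A i}. i \<le> j}))"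
proof -
  define b where "b w = (\<lambda>j. card {i \<in> {i. w \<in> A i}. i \<le> j})" for w
  have "continuous_map W euclidean (\<lambda>w. block_code (b w) v)" for v
    unfolding continuous_map_def
  proof (intro conjI allI impI)
    \<comment> \<open>Local constancy makes the preimage of every set open, so \<open>Y\<close> is
      arbitrary.\<close>
    fix Y :: "real set"
    obtain m where m: "\<And>n. qs_real v n \<noteq> 0 \<Longrightarrow> n \<le> m"
      using qs_real_c00[of v] by (auto simp: c00_def finite_nat_set_iff_bounded_le)
    show "openin W {w \<in> topspace W. block_code (b w) v \<in> Y}"
    proof (subst openin_subopen, intro ballI)
      fix w assume w: "w \<in> {w \<in> topspace W. block_code (b w) v \<in> Y}"
      \<comment> \<open>A neighbourhood of \<open>w\<close> on which membership in
        \<open>A 0\<close>, ..., \<open>A m\<close> does not change; it is open because the sets are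
        clopen.\<close>
      define T where "T = topspace W \<inter> (\<Inter>i\<in>{..m}. if w \<in> A i then A i else topspace W - A i)"
      have "openin W T"
        unfolding T_def using A by (intro openin_Int openin_Inter) auto
      moreover have "w \<in> T" using w by (auto simp: T_def)
      moreover have "T \<subseteq> {w \<in> topspace W. block_code (b w) v \<in> Y}"
      proof
        fix z assume z: "z \<in> T"
        have "z \<in> A i \<longleftrightarrow> w \<in> A i" if "i \<le> m" for i
        proof -
          have "z \<in> (if w \<in> A i then A i else topspace W - A i)" using z that unfolding T_def by blast
          then show ?thesis by (auto split: if_splits)
        qed
        then have "b z j = b w j" if "j \<le> m" for j
          unfolding b_def using that by (intro arg_cong[where f = card]) auto
        then have "block_code (b z) v = block_code (b w) v"
          unfolding block_code_def using m by (intro block_norm_cong) auto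
        then show "z \<in> {w \<in> topspace W. block_code (b w) v \<in> Y}" using w z by (auto simp: T_def)
      qed
      ultimately show "\<exists>T. openin W T \<and> w \<in> T \<and> T \<subseteq> {w \<in> topspace W. block_code (b w) v \<in> Y}" by blast
    qed
  qed simp
  then have "continuous_map W (product_topology (\<lambda>_. euclidean) UNIV) (\<lambda>w. block_code (b w))"
    by (simp add: continuous_map_componentwise_UNIV)
  then show ?thesis by (simp add: b_def euclidean_product_topology)
qed

theorem theorem5p6:
  assumes "I \<in> {P_set, Pinf_set, B_set}"
  shows "gdelta_complete TYPE('z) (subtopology euclidean I) {\<mu> \<in> I. SD2P \<mu>}"
  unfolding gdelta_complete_def
proof (intro conjI allI impI)
  have I: "B_set \<subseteq> I" "I \<subseteq> P_set" using assms by (auto simp: Pinf_set_def B_set_def)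
  show "gdelta_in (subtopology euclidean I) {\<mu> \<in> I. SD2P \<mu>}" by (rule gdelta_SD2P[OF I(2)])
  fix W :: "'z topology" and G
  assume W: "polish_top W \<and> W dim_le 0 \<and> gdelta_in W G"
  then obtain A :: "nat \<Rightarrow> 'z set" where A: "\<And>i. openin W (A i)" "\<And>i. closedin W (A i)"
    and G: "\<And>w. w \<in> topspace W \<Longrightarrow> w \<in> G \<longleftrightarrow> infinite {i. w \<in> A i}"
    using gdelta_eq_infinitely_many_clopen[of W G] by metis
  define h where "h w = block_code (\<lambda>j. card {i \<in> {i. w \<in> A i}. i \<le> j})" for w
  have hI: "h w \<in> I" for w using block_code_B_set I(1) by (auto simp: h_def)
  have "continuous_map W (subtopology euclidean I) h"
    using continuous_map_block_code[OF A] hI by (auto simp: continuous_map_in_subtopology h_def[abs_def])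
  moreover have "G = {w \<in> topspace W. h w \<in> {\<mu> \<in> I. SD2P \<mu>}}"
  proof -
    have "SD2P (h w) \<longleftrightarrow> infinite {i. w \<in> A i}" for w
      unfolding h_def SD2P_block_code by (rule infinite_range_card_iff)
    then show ?thesis using G gdelta_in_subset[of W G] W hI by auto
  qed
  ultimately show "\<exists>h. continuous_map W (subtopology euclidean I) h \<and>
      G = {w \<in> topspace W. h w \<in> {\<mu> \<in> I. SD2P \<mu>}}" by blast
qed

end
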